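(* Let $n\ge 2$ and let $\lambda>0$. Let $K\subset\mathbb{R}^n$ be a $\lambda$-convex body and let $S\subset\mathbb{R}^n$ be a $\lambda$-convex spindle. If $R(K)=R(S)$, then $$V_1(K)\ge V_1(S),$$ with equality if and only if $K$ is a $\lambda$-convex spindle.
   Context: A convex body in $\mathbb{R}^n$ is a compact convex subset with non-empty interior. For $\lambda>0$, a convex body $K\subset\mathbb{R}^n$ is called $\lambda$-convex if for every $p\in\partial K$ there exist a neighborhood $U_p$ of $p$ and a closed ball $B_{\lambda,p}$ of radius $1/\lambda$ such that $p\in\partial B_{\lambda,p}$ and $U_p\cap K\subset B_{\lambda,p}$. (By Blaschke's rolling theorem, $\lambda$-convex bodies are exactly the convex bodies that are intersections of finitely or infinitely many closed balls of radius $1/\lambda$.) A $\lambda$-convex spindle is the intersection of all closed balls of radius $1/\lambda$ that contain a given pair of (distinct) points; these two points, called the vertices of the spindle, are at distance at most $2/\lambda$ from each other. The circumradius $R(K)$ of a convex body $K$ is the radius of the smallest ball that contains $K$. The intrinsic volumes $V_j(K)$ are defined by the Steiner formula: for every $\varepsilon>0$, $\mathrm{Vol}(K+\varepsilon \mathbf{B})=\sum_{j=0}^n \kappa_{n-j}V_j(K)\varepsilon^{n-j}$, where $\mathrm{Vol}$ is Lebesgue measure, $\mathbf{B}$ is the closed unit Euclidean ball in $\mathbb{R}^n$, $+$ is Minkowski addition, and $\kappa_m$ is the volume of the unit ball in $\mathbb{R}^m$. In particular, $V_1(K)=\frac{1}{\kappa_{n-1}}\int_{\mathbb{S}^{n-1}}h_K(u)\,du$,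 where $h_K(u)=\max_{y\in K}\langle u,y\rangle$ is the support function and $du$ is the standard surface measure on the unit sphere $\mathbb{S}^{n-1}$; thus $V_1(K)$ is a fixed positive multiple (depending on $n$) of the mean width of $K$. *)

theory Defs
  imports "HOL-Analysis.Analysis"
begin

definition convex_body :: "(real ^ 'n) set \<Rightarrow> bool" where
  "convex_body K \<longleftrightarrow> convex K \<and> compact K \<and> interior K \<noteq> {}"

definition lambda_convex_body :: "real \<Rightarrow> (real ^ 'n) set \<Rightarrow> bool" where
  "lambda_convex_body lam K \<longleftrightarrow>
     convex_body K \<and>
     (\<forall>p \<in> frontier K. \<exists>U c. open U \<and> p \<in> U \<and>
        p \<in> sphere c (1 / lam) \<and> U \<inter> K \<subseteq> cball c (1 / lam))"

(* The bound on dist x y is essential: without it the family of balls could be empty and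
   its intersection the whole space. *)
definition lambda_convex_spindle :: "real \<Rightarrow> (real ^ 'n) set \<Rightarrow> bool" where
  "lambda_convex_spindle lam S \<longleftrightarrow>
     (\<exists>x y. x \<noteq> y \<and> dist x y \<le> 2 / lam \<and>
        S = \<Inter> {cball c (1 / lam) | c. {x, y} \<subseteq> cball c (1 / lam)})"

definition circumradius :: "(real ^ 'n) set \<Rightarrow> real" where
  "circumradius K = (LEAST r. 0 \<le> r \<and> (\<exists>c. K \<subseteq> cball c r))"

definition parallel_body :: "(real ^ 'n) set \<Rightarrow> real \<Rightarrow> (real ^ 'n) set" where
  "parallel_body K \<epsilon> = {x + \<epsilon> *\<^sub>R b | x b. x \<in> K \<and> b \<in> cball 0 1}"

(* The sequence of coefficients in the Steiner formula, continued by 0 beyond the dimension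
   so that it is uniquely determined. *)
definition intrinsic_volumes :: "(real ^ 'n) set \<Rightarrow> nat \<Rightarrow> real" where
  "intrinsic_volumes K = (THE V.
     (\<forall>\<epsilon>>0. measure lebesgue (parallel_body K \<epsilon>) =
        (\<Sum>j = 0..CARD('n). unit_ball_vol (real (CARD('n) - j)) * V j * \<epsilon> ^ (CARD('n) - j))) \<and>
     (\<forall>j > CARD('n). V j = 0))"

abbreviation intrinsic_volume :: "nat \<Rightarrow> (real ^ 'n) set \<Rightarrow> real" where
  "intrinsic_volume j K \<equiv> intrinsic_volumes K j"

end

theory Submission
  imports Defs "HOL-Computational_Algebra.Polynomial"
begin

text \<open>
  Write L = 1/lam, R = R(K) = R(S), and h for support functions. Up to a constant,
  the first intrinsic volume is the mean of h over directions: it is the linear coefficient of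
  the polynomial t \<mapsto> Vol(B + tK), and B + tK is squeezed between the star-shaped sets with radial
  functions 1 + t h - O(t^2) and 1 + t h.

  Place the circumcentre of K at the origin, so that 0 lies in the convex hull of the contact
  points R w of K with its circumsphere. By Blaschke's rolling theorem K lies in the ball of
  radius L touching at any support point. The centre y of such a ball satisfies
  |y|^2 \<le> L^2 - R^2, because the ball contains all contact points and 0 is in their hull. This
  gives the pointwise bound h(u) \<ge> G(u \<bullet> w) whenever u \<bullet> w \<ge> 0, where G(|u \<bullet> w|) is the support
  function of the spindle with vertices \<plusminus>R w, and G is increasing on [0,1].

  Now split the sphere into the Voronoi cells of the contact directions. Every cell is contained in the
  hemisphere around its direction w and is star-shaped with respect to w, so by Chebyshev's
  association inequality the mean of G(u \<bullet> w) over the cell is at least its mean over the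
  hemisphere. Summing over the cells gives the inequality. If G is strictly increasing, equality forces
  antipodal contact points; then K contains the spindle spanned by them, and equal means force
  equality of the two bodies.
\<close>

text \<open>\<open>intrinsic_volumes\<close> is a definite description, so nothing is known about
  V_1 before Steiner's formula has been proved. Adding a segment changes volumes affinely in its
  length; hence a polynomial formula holds with zonotopes in place of the ball, and it survives the
  limit because polynomials of bounded degree are closed under pointwise convergence.

  Spherical means are written as integrals over the unit ball of functions that are constant along
  rays. Two flows, the dilations and the stretches across an axis w, then take the part of polar
  coordinates. The second one moves a direction along a great circle through w, so the comparison of
  a cell with its hemisphere becomes a one-dimensional statement on each orbit.

  A cell is smaller than its hemisphere as soon as there is a further contact direction other than
  -w; this is where the equality case gets its antipodal points. If R = L, then G is constant and
  gives no strictness; but then K contains every point L u with |u| = 1, and antipodal contact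
  points exist anyway.\<close>

section \<open>Rotation invariance of Lebesgue measure\<close>

lemma nn_integral_lborel_translation:
  fixes g :: "'a::euclidean_space \<Rightarrow> ennreal"
  assumes [measurable]: "g \<in> borel_measurable borel"
  shows "(\<integral>\<^sup>+x. g (x + a) \<partial>lborel) = (\<integral>\<^sup>+x. g x \<partial>lborel)"
proof -
  have "(\<integral>\<^sup>+x. g x \<partial>lborel) = (\<integral>\<^sup>+x. g x \<partial>(distr lborel borel ((+) a)))"
    by (simp add: lborel_distr_plus)
  also have "\<dots> = (\<integral>\<^sup>+x. g (a + x) \<partial>lborel)" by (subst nn_integral_distr) auto
  finally show ?thesis by (simp add: add.commute)
qed

text \<open>
  Uniqueness of Haar measure: by Fubini's theorem a translation-invariant measure is a multiple of
  Lebesgue measure, and both measures agree on the unit ball.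
\<close>

lemma lborel_distr_orthogonal:
  fixes f :: "'a::euclidean_space \<Rightarrow> 'a"
  assumes f: "orthogonal_transformation f"
  shows "distr lborel borel f = lborel"
proof (rule measure_eqI)
  have lin: "linear f" using f by (rule orthogonal_transformation_linear)
  have [measurable]: "f \<in> borel_measurable borel"
    using linear_continuous_on[of f UNIV] lin
    by (intro borel_measurable_continuous_onI) (simp add: linear_conv_bounded_linear)
  obtain g where g: "f \<circ> g = id" using orthogonal_transformation_surj[OF f] surj_iff by (metis surj_iff)
  then have fg: "f (g y) = y" for y by (metis comp_apply id_apply)
  fix A assume "A \<in> sets (distr lborel borel f)"
  then have [measurable]: "A \<in> sets borel" by simp
  \<comment> \<open>The unit ball serves as test set: f preserves it, and its volume is finite and
    positive.\<close>
  define E where "E = cball (0::'a) 1"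
  have [measurable]: "E \<in> sets borel" by (simp add: E_def)
  have [measurable]: "f -` A \<in> sets borel" using measurable_sets[of f borel borel A] by simp
  have 1: "(\<integral>\<^sup>+x. indicator A (f x + y) \<partial>lborel) = emeasure lborel (f -` A)" for y
  proof -
    have "f x + y = f (x + g y)" for x using fg linear_add[OF lin] by simp
    then have "(\<integral>\<^sup>+x. indicator A (f x + y) \<partial>lborel) = (\<integral>\<^sup>+x. indicator A (f (x + g y)) \<partial>lborel)"
      by simp
    also have "\<dots> = (\<integral>\<^sup>+x. indicator A (f x) \<partial>lborel)"
      by (rule nn_integral_lborel_translation) simp
    also have "\<dots> = (\<integral>\<^sup>+x. indicator (f -` A) x \<partial>lborel)" by (simp add: indicator_def)
    finally show ?thesis by simp
  qed
  have 2: "(\<integral>\<^sup>+x. indicator E (y - f x) \<partial>lborel) = emeasure lborel E" for y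
  proof -
    have "y - f x = f (g y - x)" for x using fg linear_diff[OF lin] by simp
    then have "norm (y - f x) = dist (g y) x" for x
      using orthogonal_transformation_norm[OF f] by (simp add: dist_norm)
    then have "(\<integral>\<^sup>+x. indicator E (y - f x) \<partial>lborel) = (\<integral>\<^sup>+x. indicator (cball (g y) 1) x \<partial>lborel)"
      by (intro nn_integral_cong) (simp add: indicator_def E_def)
    then show ?thesis by (simp add: emeasure_cball E_def)
  qed
  \<comment> \<open>The double integral of 1_A(f x + y) 1_E(y) is computed in two ways. Integrating
    over x first gives the left side; shifting y by f x and only then integrating over x gives |A|
    |E|.\<close>
  have "emeasure lborel (f -` A) * emeasure lborel E
      = (\<integral>\<^sup>+y. (\<integral>\<^sup>+x. indicator A (f x + y) * indicator E y \<partial>lborel) \<partial>lborel)"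
    by (simp add: nn_integral_multc 1 nn_integral_cmult_indicator)
  also have "\<dots> = (\<integral>\<^sup>+x. (\<integral>\<^sup>+y. indicator A (f x + y) * indicator E y \<partial>lborel) \<partial>lborel)"
    by (rule lborel_pair.Fubini') measurable
  also have "\<dots> = (\<integral>\<^sup>+x. (\<integral>\<^sup>+y. indicator A y * indicator E (y - f x) \<partial>lborel) \<partial>lborel)"
  proof (rule nn_integral_cong)
    fix x
    show "(\<integral>\<^sup>+y. indicator A (f x + y) * indicator E y \<partial>lborel) = (\<integral>\<^sup>+y. indicator A y * indicator E (y - f x) \<partial>lborel)"
      using nn_integral_lborel_translation[of "\<lambda>y. indicator A y * indicator E (y - f x)" "f x"]
      by (simp add: add.commute)
  qed
  also have "\<dots> = (\<integral>\<^sup>+y. (\<integral>\<^sup>+x. indicator A y * indicator E (y - f x) \<partial>lborel) \<partial>lborel)"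
    by (rule lborel_pair.Fubini'[symmetric]) measurable
  also have "\<dots> = emeasure lborel A * emeasure lborel E"
    by (simp add: nn_integral_cmult 2 nn_integral_multc mult.commute nn_integral_cmult_indicator)
  finally have "emeasure lborel (f -` A) * emeasure lborel E = emeasure lborel A * emeasure lborel E" .
  moreover have "emeasure lborel E = ennreal (unit_ball_vol DIM('a))" by (simp add: emeasure_cball E_def)
  moreover have "unit_ball_vol (real DIM('a)) > 0" by simp
  ultimately have "emeasure lborel (f -` A) = emeasure lborel A"
    by (metis ennreal_mult_cancel_left mult.commute ennreal_eq_0_iff ennreal_neq_top not_le)
  then show "emeasure (distr lborel borel f) A = emeasure lborel A"
    by (simp add: emeasure_distr)
qed simp

lemma nn_integral_orthogonal:
  fixes g :: "'a::euclidean_space \<Rightarrow> ennreal" and f :: "'a \<Rightarrow> 'a"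
  assumes f: "orthogonal_transformation f" and [measurable]: "g \<in> borel_measurable borel"
  shows "(\<integral>\<^sup>+x. g (f x) \<partial>lborel) = (\<integral>\<^sup>+x. g x \<partial>lborel)"
proof -
  have [measurable]: "f \<in> borel_measurable borel"
    using linear_continuous_on[of f UNIV] orthogonal_transformation_linear[OF f]
    by (intro borel_measurable_continuous_onI) (simp add: linear_conv_bounded_linear)
  show ?thesis using nn_integral_distr[of f lborel borel g] by (simp add: lborel_distr_orthogonal[OF f])
qed

section \<open>Steiner's formula\<close>

definition sym_segment :: "'a::real_vector \<Rightarrow> real \<Rightarrow> 'a set" where
  "sym_segment v s = (\<lambda>r. r *\<^sub>R v) ` {-s..s}"

lemma compact_sym_segment: "compact (sym_segment (v::'a::real_normed_vector) s)"
  unfolding sym_segment_def by (intro compact_continuous_image continuous_intros) auto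

lemma convex_sym_segment: "convex (sym_segment v s)"
  unfolding sym_segment_def by (intro convex_linear_image) (auto simp: linear_iff scaleR_add_left)

lemma compact_set_plus: "compact A \<Longrightarrow> compact B \<Longrightarrow> compact (A + B :: 'a::real_normed_vector set)"
  using compact_sums[of A B] by (simp add: set_plus_def Collect_conj_eq) (smt (verit) Collect_cong)

abbreviation vol :: "'a::euclidean_space set \<Rightarrow> real" where
  "vol A \<equiv> measure lborel A"

lemma vol_translation: "vol ((+) a ` (A::'a::euclidean_space set)) = vol A" if "compact A"
proof -
  have "compact ((+) a ` A)" using that by (rule compact_translation)
  then have "vol ((+) a ` A) = measure lebesgue ((+) a ` A)"
    by (simp add: borel_compact measure_completion)
  also have "\<dots> = measure lebesgue A" by (rule measure_translation)
  also have "\<dots> = vol A" using that by (simp add: borel_compact measure_completion)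
  finally show ?thesis .
qed

lemma vol_mono: "compact A \<Longrightarrow> compact B \<Longrightarrow> A \<subseteq> B \<Longrightarrow> vol A \<le> vol (B::'a::euclidean_space set)"
  using emeasure_compact_finite[of B]
  by (intro measure_mono_fmeasurable) (auto simp: fmeasurable_def borel_compact)

text \<open>
  The two translates below have union and intersection of the same shape, so inclusion-exclusion makes
  the volume of a convex body plus a segment midpoint-affine in the length of the segment.
\<close>

lemma sym_segment_sum_translate:
  assumes "0 \<le> t" "t \<le> s" and A: "convex (A::'a::real_normed_vector set)"
  shows "(+) (t *\<^sub>R v) ` (A + sym_segment v s) \<union> (+) ((-t) *\<^sub>R v) ` (A + sym_segment v s) = A + sym_segment v (s + t)"
    and "(+) (t *\<^sub>R v) ` (A + sym_segment v s) \<inter> (+) ((-t) *\<^sub>R v) ` (A + sym_segment v s) = A + sym_segment v (s - t)"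
proof -
  have tr: "(+) (t *\<^sub>R v) ` (A + sym_segment v s) = {a + r *\<^sub>R v | a r. a \<in> A \<and> r \<in> {t-s..t+s}}" for t s
  proof safe
    fix x assume "x \<in> A + sym_segment v s"
    then obtain a r where "x = a + r *\<^sub>R v" "a \<in> A" "r \<in> {-s..s}" by (auto simp: set_plus_def sym_segment_def)
    then show "\<exists>a r. t *\<^sub>R v + x = a + r *\<^sub>R v \<and> a \<in> A \<and> r \<in> {t-s..t+s}"
      by (intro exI[of _ a] exI[of _ "t + r"]) (auto simp: scaleR_add_left)
  next
    fix a r assume *: "a \<in> A" "r \<in> {t-s..t+s}"
    then have "(r - t) *\<^sub>R v \<in> sym_segment v s" unfolding sym_segment_def by (intro imageI) auto
    then have "a + (r - t) *\<^sub>R v \<in> A + sym_segment v s" using * by (intro set_plus_intro)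
    moreover have "a + r *\<^sub>R v = t *\<^sub>R v + (a + (r - t) *\<^sub>R v)" by (simp add: algebra_simps)
    ultimately show "a + r *\<^sub>R v \<in> (+) (t *\<^sub>R v) ` (A + sym_segment v s)" by blast
  qed
  have tr0: "A + sym_segment v s = {a + r *\<^sub>R v | a r. a \<in> A \<and> r \<in> {-s..s}}" for s
    using tr[of 0 s] by simp
  show "(+) (t *\<^sub>R v) ` (A + sym_segment v s) \<union> (+) ((-t) *\<^sub>R v) ` (A + sym_segment v s) = A + sym_segment v (s + t)" (is "?L = ?R")
  proof
    have "{t-s..t+s} \<union> {-t-s..-t+s} \<subseteq> {-(s+t)..s+t}" using assms(1,2) by auto
    then show "?L \<subseteq> ?R" unfolding tr unfolding tr0 by blast
    show "?R \<subseteq> ?L"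
    proof
      fix x assume "x \<in> ?R"
      then obtain a r where *: "x = a + r *\<^sub>R v" "a \<in> A" "r \<in> {-(s+t)..s+t}" unfolding tr0 by blast
      then have "r \<in> {t-s..t+s} \<or> r \<in> {-t-s..-t+s}" using assms(1,2) by auto
      then show "x \<in> ?L" unfolding tr using * by blast
    qed
  qed
  show "(+) (t *\<^sub>R v) ` (A + sym_segment v s) \<inter> (+) ((-t) *\<^sub>R v) ` (A + sym_segment v s) = A + sym_segment v (s - t)" (is "?L = ?R")
  proof
    have "{-(s-t)..s-t} \<subseteq> {t-s..t+s} \<inter> {-t-s..-t+s}" using assms(1,2) by auto
    then show "?R \<subseteq> ?L" unfolding tr unfolding tr0 by blast
    show "?L \<subseteq> ?R"
    proof
      fix x assume "x \<in> ?L"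
      then obtain a r b q where x: "x = a + r *\<^sub>R v" "a \<in> A" "r \<in> {t-s..t+s}"
         "x = b + q *\<^sub>R v" "b \<in> A" "q \<in> {-t-s..-t+s}" unfolding tr by blast
      consider "r \<le> s - t" | "q \<ge> t - s" | "r > s - t" "q < t - s" by linarith
      then show "x \<in> ?R"
      proof cases
        case 1
        then have "r \<in> {-(s-t)..s-t}" using x by auto
        then show ?thesis unfolding tr0 using x(1,2) by blast
      next
        case 2
        then have "q \<in> {-(s-t)..s-t}" using x by auto
        then show ?thesis unfolding tr0 using x(4,5) by blast
      next
        case 3
        have lt: "q < s - t" using 3 assms by auto
        \<comment> \<open>Here r is too large and q too small. The convex combination of the two
          representations of x with weight \<mu> has parameter exactly s - t, and convexity keeps
          its other part in A.\<close>
        define \<mu> where "\<mu> = (s - t - q) / (r - q)"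
        have rq: "r - q > 0" using lt 3 by linarith
        have mu: "0 \<le> \<mu>" "\<mu> \<le> 1" unfolding \<mu>_def using lt rq 3 by (auto simp: divide_simps)
        have e: "\<mu> * (r - q) = s - t - q" using rq by (simp add: \<mu>_def)
        have "\<mu> *\<^sub>R a + (1 - \<mu>) *\<^sub>R b \<in> A" using A x mu by (intro convexD) auto
        moreover have "x = \<mu> *\<^sub>R (a + r *\<^sub>R v) + (1 - \<mu>) *\<^sub>R (b + q *\<^sub>R v)"
          using x by (metis add.commute add_diff_cancel_left' scaleR_left_diff_distrib scaleR_one diff_add_cancel)
        then have "x = (\<mu> *\<^sub>R a + (1 - \<mu>) *\<^sub>R b) + (\<mu> * (r - q) + q) *\<^sub>R v"
          by (simp add: algebra_simps)
        then have "x = (\<mu> *\<^sub>R a + (1 - \<mu>) *\<^sub>R b) + (s - t) *\<^sub>R v" using e by simp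
        moreover have "s - t \<in> {-(s-t)..s-t}" using assms(2) by auto
        ultimately show ?thesis unfolding tr0 by blast
      qed
    qed
  qed
qed

text \<open>D = f - f 0 is additive, hence D (k y) = k D y for natural k. Monotonicity takes the
  place of continuity: comparing N x with its integer part bounds N |D x - x D 1| by D 1 for every
  N.\<close>

lemma midpoint_affine_mono_imp_affine:
  fixes f :: "real \<Rightarrow> real"
  assumes mid: "\<And>s t. 0 \<le> t \<Longrightarrow> t \<le> s \<Longrightarrow> f (s + t) + f (s - t) = 2 * f s"
    and mono: "\<And>s t. 0 \<le> s \<Longrightarrow> s \<le> t \<Longrightarrow> f s \<le> f t" and "x \<ge> 0"
  shows "f x = (1 - x) * f 0 + x * f 1"
proof -
  define D where "D s = f s - f 0" for s
  have "f (x + y) + f 0 = f x + f y" if "0 \<le> x" "x \<le> y" for x y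
  proof -
    have "(x+y)/2 + (x+y)/2 = x + y" "(x+y)/2 + (y-x)/2 = y" "(x+y)/2 - (y-x)/2 = x"
      by (simp_all add: field_simps)
    then show ?thesis
      using mid[of "(x+y)/2" "(x+y)/2"] mid[of "(y-x)/2" "(x+y)/2"] that by simp
  qed
  then have add: "D (x + y) = D x + D y" if "0 \<le> x" "0 \<le> y" for x y
    using that unfolding D_def by (smt (verit) add.commute)
  have D0: "D 0 = 0" by (simp add: D_def)
  have mult: "D (real k * y) = real k * D y" if "y \<ge> 0" for k y
    by (induction k) (use that add D0 in \<open>auto simp: algebra_simps\<close>)
  have D1: "D 1 \<ge> 0" using mono[of 0 1] by (simp add: D_def)
  have bd: "\<bar>D x - x * D 1\<bar> * real N \<le> D 1" for N
  proof -
    define m where "m = nat \<lfloor>real N * x\<rfloor>"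
    have m: "real m \<le> real N * x" "real N * x \<le> real m + 1"
      using \<open>x \<ge> 0\<close> unfolding m_def by (auto simp: of_nat_nat)
    have "D (real m) \<le> D (real N * x)" "D (real N * x) \<le> D (real m + 1)"
      using m \<open>x \<ge> 0\<close> mono[of "real m" "real N * x"] mono[of "real N * x" "real m + 1"]
      by (auto simp: D_def)
    then have "real m * D 1 \<le> real N * D x" "real N * D x \<le> (real m + 1) * D 1"
      using mult[of 1 m] mult[of 1 "Suc m"] mult[of x N] \<open>x \<ge> 0\<close> by (auto simp: algebra_simps)
    moreover have "real m * D 1 \<le> real N * x * D 1" "real N * x * D 1 \<le> (real m + 1) * D 1"
      using m D1 by (auto intro!: mult_right_mono)
    ultimately have "\<bar>real N * D x - real N * x * D 1\<bar> \<le> D 1" by (simp add: algebra_simps)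
    also have "real N * D x - real N * x * D 1 = (D x - x * D 1) * real N" by (simp add: algebra_simps)
    finally show ?thesis by (simp add: abs_mult)
  qed
  have "D x = x * D 1"
  proof (rule ccontr)
    assume "D x \<noteq> x * D 1"
    then have p: "\<bar>D x - x * D 1\<bar> > 0" by simp
    obtain N where "real N * \<bar>D x - x * D 1\<bar> > D 1" using reals_Archimedean3[OF p] by blast
    then show False using bd[of N] by (simp add: mult.commute)
  qed
  then show ?thesis by (simp add: D_def algebra_simps)
qed

lemma vol_sym_segment_affine:
  assumes A: "convex A" "compact (A::'a::euclidean_space set)" and "s \<ge> 0"
  shows "vol (A + sym_segment v s) = (1 - s) * vol A + s * vol (A + sym_segment v 1)"
proof -
  have c: "compact (A + sym_segment v s)" for s by (intro compact_set_plus A compact_sym_segment)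
  have A0: "A + sym_segment v 0 = A" by (auto simp: sym_segment_def set_plus_def)
  have "vol (A + sym_segment v s) = (1 - s) * vol (A + sym_segment v 0) + s * vol (A + sym_segment v 1)"
  proof (rule midpoint_affine_mono_imp_affine[OF _ _ \<open>s \<ge> 0\<close>])
    fix s t :: real assume st: "0 \<le> t" "t \<le> s"
    let ?P = "(+) (t *\<^sub>R v) ` (A + sym_segment v s)" and ?Q = "(+) ((-t) *\<^sub>R v) ` (A + sym_segment v s)"
    have "compact ?P" "compact ?Q" by (intro compact_translation c)+
    then have "?P \<in> fmeasurable lborel" "?Q \<in> fmeasurable lborel"
      using emeasure_compact_finite by (auto simp: fmeasurable_def borel_compact)
    then have "vol (?P \<union> ?Q) + vol (?P \<inter> ?Q) = vol ?P + vol ?Q"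
      using measure_Un3[of ?P lborel ?Q] by linarith
    then show "vol (A + sym_segment v (s + t)) + vol (A + sym_segment v (s - t)) = 2 * vol (A + sym_segment v s)"
      unfolding sym_segment_sum_translate[OF st A(1)] vol_translation[OF c[of s]] by simp
  next
    fix s t :: real assume "0 \<le> s" "s \<le> t"
    then have "A + sym_segment v s \<subseteq> A + sym_segment v t" by (intro set_plus_mono2) (auto simp: sym_segment_def)
    then show "vol (A + sym_segment v s) \<le> vol (A + sym_segment v t)" using c by (intro vol_mono)
  qed
  then show ?thesis by (simp add: A0)
qed

section \<open>Volumes of convex sets plus dilated zonotopes\<close>

fun zonotope :: "'a::real_vector list \<Rightarrow> 'a set" where
  "zonotope [] = {0}"
| "zonotope (v # vs) = sym_segment v 1 + zonotope vs"

lemma compact_zonotope: "compact (zonotope (vs::'a::real_normed_vector list))"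
  by (induction vs) (auto intro!: compact_set_plus compact_sym_segment)

lemma convex_zonotope: "convex (zonotope vs)"
  by (induction vs) (auto intro!: convex_set_plus convex_sym_segment)

lemma sym_segment_scaleR: "e \<ge> 0 \<Longrightarrow> sym_segment (e *\<^sub>R v) 1 = sym_segment v e"
proof -
  assume e: "e \<ge> 0"
  show ?thesis
  proof (cases "e = 0")
    case True then show ?thesis by (auto simp: sym_segment_def image_constant_conv)
  next
    case False
    have "sym_segment v e = (\<lambda>r. r *\<^sub>R v) ` ((\<lambda>r. r * e) ` {-1..1})"
      unfolding sym_segment_def using e False by (simp add: image_mult_atLeastAtMost mult.commute[of _ e])
    then show ?thesis by (simp add: sym_segment_def image_image mult.commute)
  qed
qed

lemma zonotope_scaleR: "zonotope (map (scaleR e) vs) = (*\<^sub>R) e ` zonotope vs"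
proof (induction vs)
  case (Cons v vs)
  have "sym_segment (e *\<^sub>R v) 1 = (*\<^sub>R) e ` sym_segment v 1" by (simp add: sym_segment_def image_image mult.commute)
  then have "zonotope (map (scaleR e) (v # vs)) = (*\<^sub>R) e ` sym_segment v 1 + (*\<^sub>R) e ` zonotope vs"
    using Cons by simp
  also have "\<dots> = (*\<^sub>R) e ` zonotope (v # vs)"
  proof (intro equalityI subsetI)
    fix x assume "x \<in> (*\<^sub>R) e ` sym_segment v 1 + (*\<^sub>R) e ` zonotope vs"
    then obtain a b where "a \<in> sym_segment v 1" "b \<in> zonotope vs" "x = e *\<^sub>R (a + b)"
      by (auto simp: set_plus_def scaleR_add_right)
    then show "x \<in> (*\<^sub>R) e ` zonotope (v # vs)" by (auto intro: set_plus_intro)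
  next
    fix x assume "x \<in> (*\<^sub>R) e ` zonotope (v # vs)"
    then obtain a b where "a \<in> sym_segment v 1" "b \<in> zonotope vs" "x = e *\<^sub>R (a + b)"
      by (auto simp: set_plus_def)
    then show "x \<in> (*\<^sub>R) e ` sym_segment v 1 + (*\<^sub>R) e ` zonotope vs"
      by (auto simp: scaleR_add_right intro: set_plus_intro)
  qed
  finally show ?case .
qed simp

text \<open>Induction over the generators with A generalised. Splitting off the segment along v
  writes the volume as (1 - e) times that of A + e Z plus e times that of (A + segment) + e Z, where
  Z belongs to the remaining generators.\<close>

lemma vol_add_zonotope_poly:
  assumes "convex A" "compact (A::'a::euclidean_space set)"
  shows "\<exists>p. \<forall>e\<ge>0. vol (A + (*\<^sub>R) e ` zonotope vs) = poly p e"
  using assms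
proof (induction vs arbitrary: A)
  case Nil
  have "A + (\<lambda>x. e *\<^sub>R x) ` {0} = A" for e by (simp add: set_plus_def)
  then show ?case by (intro exI[of _ "[:vol A:]"]) simp
next
  case (Cons v vs)
  have "convex (A + sym_segment v 1)" "compact (A + sym_segment v 1)"
    using Cons.prems by (auto intro: convex_set_plus convex_sym_segment compact_set_plus compact_sym_segment)
  from Cons.IH[OF this] obtain q
    where q: "\<And>e. e \<ge> 0 \<Longrightarrow> vol (A + sym_segment v 1 + (*\<^sub>R) e ` zonotope vs) = poly q e" by auto
  from Cons.IH[OF Cons.prems] obtain p
    where p: "\<And>e. e \<ge> 0 \<Longrightarrow> vol (A + (*\<^sub>R) e ` zonotope vs) = poly p e" by auto
  have "vol (A + (*\<^sub>R) e ` zonotope (v # vs)) = poly ([:1,-1:] * p + [:0,1:] * q) e" if "e \<ge> 0" for e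
  proof -
    let ?Z = "(*\<^sub>R) e ` zonotope vs"
    have Z: "convex ?Z" "compact ?Z"
      by (auto intro: convex_scaling convex_zonotope compact_scaling compact_zonotope)
    have "(*\<^sub>R) e ` zonotope (v # vs) = sym_segment v e + ?Z"
      using zonotope_scaleR[of e "v # vs"] zonotope_scaleR[of e vs] sym_segment_scaleR[OF that, of v] by simp
    then have "A + (*\<^sub>R) e ` zonotope (v # vs) = (A + ?Z) + sym_segment v e" by (simp add: add_ac)
    then have "vol (A + (*\<^sub>R) e ` zonotope (v # vs)) = (1 - e) * vol (A + ?Z) + e * vol ((A + ?Z) + sym_segment v 1)"
      using vol_sym_segment_affine[of "A + ?Z" e v] Cons.prems Z that by (simp add: convex_set_plus compact_set_plus)
    also have "(A + ?Z) + sym_segment v 1 = A + sym_segment v 1 + ?Z" by (simp add: add_ac)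
    finally show ?thesis using p[OF that] q[OF that] by (simp add: algebra_simps)
  qed
  then show ?case by blast
qed

text \<open>The induction over generators raises the degree with every segment. Volumes grow at most
  like the power of the dimension, and this cuts the degree down to a bound that does not depend on
  the zonotope.\<close>

lemma poly_degree_le_growth:
  fixes p :: "real poly"
  assumes "\<And>x. x \<ge> 1 \<Longrightarrow> 0 \<le> poly p x" "\<And>x. x \<ge> 1 \<Longrightarrow> poly p x \<le> C * x ^ n"
  shows "degree p \<le> n"
proof (rule ccontr)
  assume "\<not> degree p \<le> n"
  then have d: "degree p > n" by simp
  have "lead_coeff p \<noteq> 0" using d by auto
  then consider "lead_coeff p > 0" | "lead_coeff p < 0" by linarith
  then show False
  proof cases
    case 1
    let ?q = "p - monom C n"
    have dq: "degree ?q = degree p" using d degree_monom_le[of C n]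
      by (metis degree_add_eq_left degree_minus diff_conv_add_uminus le_less_trans)
    have "coeff ?q (degree p) = lead_coeff p" using d by simp
    then have "lead_coeff ?q > 0" using 1 dq by simp
    from poly_pinfty_gt_lc[OF this] obtain N where N: "\<And>x. x \<ge> N \<Longrightarrow> poly ?q x \<ge> lead_coeff ?q" by blast
    have "poly ?q (max N 1) > 0" using N[of "max N 1"] \<open>lead_coeff ?q > 0\<close> by linarith
    then show False using assms(2)[of "max N 1"] by (simp add: poly_monom)
  next
    case 2
    then have "lead_coeff (-p) > 0" by simp
    from poly_pinfty_gt_lc[OF this] obtain N where N: "\<And>x. x \<ge> N \<Longrightarrow> poly (-p) x \<ge> lead_coeff (-p)" by blast
    show False using N[of "max N 1"] \<open>lead_coeff (-p) > 0\<close> assms(1)[of "max N 1"] by simp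
  qed
qed

lemma vol_scale_cball: "r \<ge> 0 \<Longrightarrow> vol (cball (0::'a::euclidean_space) r) = unit_ball_vol DIM('a) * r ^ DIM('a)"
  using content_cball[of r "0::'a"] by (simp add: measure_completion)

lemma vol_add_zonotope_poly_degree:
  assumes "convex A" "compact (A::'a::euclidean_space set)"
  shows "\<exists>p. degree p \<le> DIM('a) \<and> (\<forall>e\<ge>0. vol (A + (*\<^sub>R) e ` zonotope vs) = poly p e)"
proof -
  obtain p where p: "\<And>e. e \<ge> 0 \<Longrightarrow> vol (A + (*\<^sub>R) e ` zonotope vs) = poly p e"
    using vol_add_zonotope_poly[OF assms] by blast
  obtain a where a: "a \<ge> 0" "A \<subseteq> cball 0 a"
    using compact_imp_bounded[OF assms(2)] by (metis bounded_pos less_imp_le mem_cball_0 subsetI)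
  obtain b where b: "b \<ge> 0" "zonotope vs \<subseteq> cball 0 b"
    using compact_imp_bounded[OF compact_zonotope[of vs]] by (metis bounded_pos less_imp_le mem_cball_0 subsetI)
  have "degree p \<le> DIM('a)"
  proof (rule poly_degree_le_growth)
    fix x :: real assume x: "x \<ge> 1"
    show "0 \<le> poly p x" using p[of x] x by (metis measure_nonneg order.trans zero_le_one)
    have "A + (*\<^sub>R) x ` zonotope vs \<subseteq> cball 0 ((a + b) * x)"
    proof
      fix y assume "y \<in> A + (*\<^sub>R) x ` zonotope vs"
      then obtain u w where "y = u + x *\<^sub>R w" "u \<in> A" "w \<in> zonotope vs" by (auto simp: set_plus_def)
      then have "norm y \<le> norm u + x * norm w" "norm u \<le> a" "norm w \<le> b"
        using a b x norm_triangle_ineq[of u "x *\<^sub>R w"] by (auto simp: subset_iff)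
      moreover have "x * norm w \<le> x * b" "a \<le> a * x" using x a \<open>norm w \<le> b\<close>
        by (auto intro!: mult_left_mono mult_le_cancel_left1[THEN iffD2] simp: mult_le_cancel_left1)
      ultimately show "y \<in> cball 0 ((a + b) * x)" by (simp add: algebra_simps)
    qed
    then have "vol (A + (*\<^sub>R) x ` zonotope vs) \<le> vol (cball (0::'a) ((a + b) * x))"
      by (intro vol_mono compact_set_plus compact_scaling compact_zonotope assms) auto
    also have "\<dots> = unit_ball_vol DIM('a) * (a + b) ^ DIM('a) * x ^ DIM('a)"
      using a b x by (subst vol_scale_cball) (auto simp: power_mult_distrib)
    finally show "poly p x \<le> unit_ball_vol DIM('a) * (a + b) ^ DIM('a) * x ^ DIM('a)"
      using p[of x] x by simp
  qed
  then show ?thesis using p by blast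
qed

text \<open>Each segment contributes |x \<bullet> v| to the support function of the zonotope. This
  bound and its attainment in the next lemma reduce the approximation of the ball to an
  approximation of the norm.\<close>

lemma zonotope_inner_le: "z \<in> zonotope vs \<Longrightarrow> z \<bullet> x \<le> (\<Sum>v\<leftarrow>vs. \<bar>x \<bullet> v\<bar>)"
proof (induction vs arbitrary: z)
  case (Cons v vs)
  then obtain r w where z: "z = r *\<^sub>R v + w" "r \<in> {-1..1}" "w \<in> zonotope vs"
    by (auto simp: set_plus_def sym_segment_def)
  have "r * (v \<bullet> x) \<le> \<bar>r\<bar> * \<bar>v \<bullet> x\<bar>" by (metis abs_ge_self abs_mult)
  also have "\<dots> \<le> 1 * \<bar>v \<bullet> x\<bar>" using z by (intro mult_right_mono) auto
  finally show ?case using z Cons.IH[of w] by (simp add: inner_add_left inner_commute[of x])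
qed simp

lemma zonotope_inner_attained: "\<exists>z\<in>zonotope vs. z \<bullet> x = (\<Sum>v\<leftarrow>vs. \<bar>x \<bullet> v\<bar>)"
proof (induction vs)
  case (Cons v vs)
  then obtain w where w: "w \<in> zonotope vs" "w \<bullet> x = (\<Sum>v\<leftarrow>vs. \<bar>x \<bullet> v\<bar>)" by blast
  define r where "r = (if x \<bullet> v \<ge> 0 then 1 else -1::real)"
  have "r *\<^sub>R v \<in> sym_segment v 1" unfolding sym_segment_def by (intro imageI) (simp add: r_def)
  then have "r *\<^sub>R v + w \<in> zonotope (v # vs)" using w by (auto intro: set_plus_intro)
  moreover have "(r *\<^sub>R v + w) \<bullet> x = (\<Sum>v\<leftarrow>v # vs. \<bar>x \<bullet> v\<bar>)"
    using w by (simp add: r_def inner_add_left inner_diff_left inner_commute[of v])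
  ultimately show ?case by blast
qed simp

section \<open>Approximation of the ball by zonotopes\<close>

text \<open>Rotation invariance moves x to a multiple of a fixed unit vector e. The norm is thereby
  a continuous superposition of the functions |x \<bullet> y|, which is why the ball is a limit of
  zonotopes.\<close>

lemma integral_abs_inner_cball:
  obtains c where "c > 0" "\<And>x::real^'n. (\<integral>y. indicator (cball 0 1) y * \<bar>x \<bullet> y\<bar> \<partial>lborel) = c * norm x"
proof -
  let ?B = "cball (0::real^'n) 1"
  define I where "I x = (\<integral>y. indicator ?B y * \<bar>x \<bullet> y\<bar> \<partial>lborel)" for x :: "real^'n"
  define e :: "real^'n" where "e = axis (SOME i. True) 1"
  have e: "norm e = 1" by (simp add: e_def)
  have int: "integrable lborel (\<lambda>y. indicator ?B y * \<bar>x \<bullet> y\<bar>)" for x :: "real^'n"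
    using borel_integrable_compact[of ?B "\<lambda>y. \<bar>x \<bullet> y\<bar>"] by (simp add: continuous_intros)
  have I_hom: "I x = I e * norm x" for x
  proof -
    obtain f where f: "orthogonal_transformation f" "f (norm x *\<^sub>R e) = x"
      using orthogonal_transformation_exists[of "norm x *\<^sub>R e" x] e by auto
    have [measurable]: "f \<in> borel_measurable borel"
      using linear_continuous_on[of f UNIV] orthogonal_transformation_linear[OF f(1)]
      by (intro borel_measurable_continuous_onI) (simp add: linear_conv_bounded_linear)
    have "I x = (\<integral>y. indicator ?B y * \<bar>x \<bullet> y\<bar> \<partial>(distr lborel borel f))"
      by (simp add: I_def lborel_distr_orthogonal[OF f(1)])
    also have "\<dots> = (\<integral>y. indicator ?B (f y) * \<bar>x \<bullet> f y\<bar> \<partial>lborel)"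
      using borel_measurable_integrable[OF int[of x]] by (subst integral_distr) auto
    also have "\<dots> = (\<integral>y. norm x * (indicator ?B y * \<bar>e \<bullet> y\<bar>) \<partial>lborel)"
    proof (rule Bochner_Integration.integral_cong[OF refl])
      fix y
      have "x \<bullet> f y = norm x * (e \<bullet> y)"
        using f(1)[unfolded orthogonal_transformation_def] f(2) inner_scaleR_left[of "norm x" e y] by metis
      moreover have "norm (f y) = norm y" using f(1) by (rule orthogonal_transformation_norm)
      ultimately show "indicator ?B (f y) * \<bar>x \<bullet> f y\<bar> = norm x * (indicator ?B y * \<bar>e \<bullet> y\<bar>)"
        by (simp add: indicator_def abs_mult)
    qed
    finally show ?thesis by (simp add: I_def)
  qed
  have "I e > 0"
  proof -
    \<comment> \<open>This ball lies inside the unit ball, and e \<bullet> y \<ge> 1/4 on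
      it.\<close>
    let ?D = "cball ((1/2) *\<^sub>R e) (1/4)"
    have "0 < unit_ball_vol CARD('n) * (1/4) ^ CARD('n) * (1/4)" by simp
    also have "\<dots> = (\<integral>y. indicator ?D y * (1/4) \<partial>lborel)"
      using content_cball[of "1/4" "(1/2) *\<^sub>R e"] by (simp add: measure_completion)
    also have "\<dots> \<le> I e" unfolding I_def
    proof (rule integral_mono)
      fix y :: "real^'n"
      show "indicator ?D y * (1/4) \<le> indicator ?B y * \<bar>e \<bullet> y\<bar>"
      proof (cases "y \<in> ?D")
        case True
        then have d: "norm ((1/2) *\<^sub>R e - y) \<le> 1/4" by (simp add: dist_norm)
        have "\<bar>e \<bullet> ((1/2) *\<^sub>R e - y)\<bar> \<le> norm e * norm ((1/2) *\<^sub>R e - y)" by (rule Cauchy_Schwarz_ineq2)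
        then have "\<bar>1/2 - e \<bullet> y\<bar> \<le> 1/4" using d e by (simp add: inner_diff_right flip: norm_eq_sqrt_inner power2_norm_eq_inner)
        then have "e \<bullet> y \<ge> 1/4" by linarith
        moreover have "norm y \<le> norm ((1/2) *\<^sub>R e) + norm ((1/2) *\<^sub>R e - y)"
          by (metis add.commute diff_add_cancel norm_minus_commute norm_triangle_ineq)
        then have "norm y \<le> 1" using d e by simp
        ultimately show ?thesis using True by simp
      qed (simp add: indicator_def)
      show "integrable lborel (\<lambda>y. indicator ?D y * (1/4) :: real)"
        using borel_integrable_compact[of ?D "\<lambda>y. 1/4::real"] by simp
    qed (rule int)
    finally show ?thesis .
  qed
  then show ?thesis using that I_hom unfolding I_def by blast
qed

text \<open>A Riemann sum for the preceding integral: the ball is cut into Borel pieces close to the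
  nodes \<open>ys ! i\<close>, and each node is weighted by the volume of its piece divided by
  c.\<close>

lemma sum_abs_inner_approx_norm:
  assumes "\<delta> > 0"
  obtains vs :: "(real^'n) list"
  where "\<And>x. (1 - \<delta>) * norm x \<le> (\<Sum>v\<leftarrow>vs. \<bar>x \<bullet> v\<bar>)" "\<And>x. (\<Sum>v\<leftarrow>vs. \<bar>x \<bullet> v\<bar>) \<le> (1 + \<delta>) * norm x"
proof -
  let ?B = "cball (0::real^'n) 1"
  obtain c where c: "c > 0" and I: "\<And>x::real^'n. (\<integral>y. indicator ?B y * \<bar>x \<bullet> y\<bar> \<partial>lborel) = c * norm x"
    using integral_abs_inner_cball by blast
  define \<kappa> where "\<kappa> = vol ?B"
  have k: "\<kappa> > 0" unfolding \<kappa>_def by (simp add: vol_scale_cball)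
  \<comment> \<open>Nodes at distance below \<eta> cause an error of at most \<eta> |x| \<kappa> in
    the value c |x|, that is, the relative error \<eta> \<kappa> / c = \<delta>.\<close>
  define \<eta> where "\<eta> = \<delta> * c / \<kappa>"
  have eta: "\<eta> > 0" using assms c k by (simp add: \<eta>_def)
  have "?B \<subseteq> (\<Union>y\<in>UNIV. ball y \<eta>)" using centre_in_ball[THEN iffD2, OF eta] by blast
  then obtain Y where Y: "finite Y" "?B \<subseteq> (\<Union>y\<in>Y. ball y \<eta>)"
    using compactE_image[OF compact_cball, of UNIV "\<lambda>y. ball y \<eta>"] by (metis open_ball)
  obtain ys where ys: "set ys = Y" using finite_list[OF Y(1)] by blast
  define N where "N = length ys"
  define A where "A i = (if i < N then ball (ys ! i) \<eta> else {})" for i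
  define D where "D i = disjointed A i \<inter> ?B" for i
  have [measurable]: "D i \<in> sets borel" for i
  proof -
    have "A i \<in> sets borel" for i by (simp add: A_def)
    then show ?thesis unfolding D_def disjointed_def by auto
  qed
  have Dball: "dist (ys ! i) y < \<eta>" if "y \<in> D i" for i y
    using that disjointed_subset[of A i] by (auto simp: D_def A_def split: if_splits)
  have Dcov: "\<exists>!i. i < N \<and> y \<in> D i" if yB: "y \<in> ?B" for y
  proof -
    obtain u where "u \<in> Y" "y \<in> ball u \<eta>" using yB Y by blast
    then obtain i where "y \<in> A i" using ys by (metis A_def N_def in_set_conv_nth)
    then have "y \<in> (\<Union>i. disjointed A i)" unfolding UN_disjointed_eq by blast
    then obtain j where j: "y \<in> disjointed A j" by blast
    then have "y \<in> A j" using disjointed_subset[of A j] by blast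
    then have jN: "j < N" by (auto simp: A_def split: if_splits)
    show ?thesis
    proof (rule ex1I[of _ j])
      show "j < N \<and> y \<in> D j" using jN j yB by (simp add: D_def)
      fix k assume "k < N \<and> y \<in> D k"
      then show "k = j" using j disjoint_family_disjointed[of A] unfolding D_def disjoint_family_on_def by blast
    qed
  qed
  define w where "w i = vol (D i)" for i
  have w0: "w i \<ge> 0" for i by (simp add: w_def)
  have intD: "integrable lborel (indicator (D i) :: _ \<Rightarrow> real)" for i
  proof -
    have "emeasure lborel (D i) \<le> emeasure lborel ?B" by (intro emeasure_mono) (auto simp: D_def)
    also have "\<dots> < \<infinity>" by (rule emeasure_compact_finite) simp
    finally show ?thesis by simp
  qed
  have bd: "\<bar>c * norm x - (\<Sum>i<N. w i * \<bar>x \<bullet> ys ! i\<bar>)\<bar> \<le> \<eta> * norm x * \<kappa>" for x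
  proof -
    let ?f = "\<lambda>y. indicator ?B y * \<bar>x \<bullet> y\<bar>" and ?g = "\<lambda>y. \<Sum>i<N. indicator (D i) y * \<bar>x \<bullet> ys ! i\<bar>"
    have f: "integrable lborel ?f"
      using borel_integrable_compact[of ?B "\<lambda>y. \<bar>x \<bullet> y\<bar>"] by (simp add: continuous_intros)
    have g: "integrable lborel ?g"
      by (intro Bochner_Integration.integrable_sum integrable_mult_left intD)
    have Bi: "integrable lborel (\<lambda>y. indicator ?B y * (\<eta> * norm x))"
      using borel_integrable_compact[of ?B "\<lambda>y. \<eta> * norm x"] by simp
    have ig: "(\<integral>y. ?g y \<partial>lborel) = (\<Sum>i<N. w i * \<bar>x \<bullet> ys ! i\<bar>)"
      by (subst Bochner_Integration.integral_sum) (simp_all add: w_def integrable_mult_left intD)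
    have pw: "\<bar>?f y - ?g y\<bar> \<le> indicator ?B y * (\<eta> * norm x)" for y
    proof (cases "y \<in> ?B")
      case True
      obtain i where i: "i < N" "y \<in> D i" "\<And>j. j < N \<Longrightarrow> y \<in> D j \<Longrightarrow> j = i" using Dcov[OF True] by blast
      have "?g y = (\<Sum>j<N. if j = i then \<bar>x \<bullet> ys ! i\<bar> else 0)"
      proof (rule sum.cong[OF refl])
        fix j assume "j \<in> {..<N}"
        then have "y \<in> D j \<longleftrightarrow> j = i" using i(2) i(3)[of j] by blast
        then show "indicator (D j) y * \<bar>x \<bullet> ys ! j\<bar> = (if j = i then \<bar>x \<bullet> ys ! i\<bar> else 0)"
          by (simp add: indicator_def)
      qed
      also have "\<dots> = \<bar>x \<bullet> ys ! i\<bar>" using i(1) by simp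
      finally have gi: "?g y = \<bar>x \<bullet> ys ! i\<bar>" .
      have "\<bar>?f y - ?g y\<bar> = \<bar>\<bar>x \<bullet> y\<bar> - \<bar>x \<bullet> ys ! i\<bar>\<bar>" using True by (simp only: gi) simp
      also have "\<dots> \<le> \<bar>x \<bullet> (y - ys ! i)\<bar>" by (simp add: inner_diff_right)
      also have "\<dots> \<le> norm x * norm (y - ys ! i)" by (rule Cauchy_Schwarz_ineq2)
      also have "\<dots> \<le> norm x * \<eta>" using Dball[OF i(2)]
        by (intro mult_left_mono) (auto simp: dist_norm norm_minus_commute)
      finally show ?thesis using True by (simp add: mult.commute)
    next
      case False
      then have "?g y = 0" by (intro sum.neutral) (auto simp: D_def)
      then show ?thesis using False by simp
    qed
    have "c * norm x - (\<Sum>i<N. w i * \<bar>x \<bullet> ys ! i\<bar>) = (\<integral>y. ?f y - ?g y \<partial>lborel)"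
      by (subst Bochner_Integration.integral_diff[OF f g]) (simp only: I ig)
    also have "\<bar>\<dots>\<bar> \<le> (\<integral>y. \<bar>?f y - ?g y\<bar> \<partial>lborel)" by (rule integral_abs_bound)
    also have "\<dots> \<le> (\<integral>y. indicator ?B y * (\<eta> * norm x) \<partial>lborel)"
      using f g Bi pw by (intro integral_mono Bochner_Integration.integrable_abs Bochner_Integration.integrable_diff) auto
    also have "\<dots> = \<eta> * norm x * \<kappa>" by (simp add: \<kappa>_def)
    finally show ?thesis .
  qed
  define vs where "vs = map (\<lambda>i. (w i / c) *\<^sub>R (ys ! i)) [0..<N]"
  have vs: "(\<Sum>v\<leftarrow>vs. \<bar>x \<bullet> v\<bar>) * c = (\<Sum>i<N. w i * \<bar>x \<bullet> ys ! i\<bar>)" for x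
  proof -
    have "(\<Sum>v\<leftarrow>vs. \<bar>x \<bullet> v\<bar>) = (\<Sum>i<N. (w i / c) * \<bar>x \<bullet> ys ! i\<bar>)"
      using w0 c by (simp add: vs_def o_def abs_mult interv_sum_list_conv_sum_set_nat atLeast0LessThan)
    then show ?thesis using c by (simp add: sum_distrib_right)
  qed
  have eta': "\<eta> * \<kappa> = \<delta> * c" using k by (simp add: \<eta>_def)
  have *: "\<bar>c * norm x - (\<Sum>v\<leftarrow>vs. \<bar>x \<bullet> v\<bar>) * c\<bar> \<le> \<delta> * norm x * c" for x
  proof -
    have "\<eta> * norm x * \<kappa> = \<delta> * norm x * c"
      using arg_cong[OF eta', of "\<lambda>t. t * norm x"] by (simp only: mult_ac)
    then show ?thesis using bd[of x] by (simp only: vs)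
  qed
  have "\<bar>norm x - (\<Sum>v\<leftarrow>vs. \<bar>x \<bullet> v\<bar>)\<bar> * c \<le> \<delta> * norm x * c" for x
  proof -
    have "c * norm x - (\<Sum>v\<leftarrow>vs. \<bar>x \<bullet> v\<bar>) * c = (norm x - (\<Sum>v\<leftarrow>vs. \<bar>x \<bullet> v\<bar>)) * c"
      by (simp add: algebra_simps)
    then show ?thesis
      using *[of x] c by (simp only: abs_mult abs_of_pos)
  qed
  then have "\<bar>norm x - (\<Sum>v\<leftarrow>vs. \<bar>x \<bullet> v\<bar>)\<bar> \<le> \<delta> * norm x" for x
    using c by (metis mult_le_cancel_right_pos)
  then have n: "\<bar>norm x - (\<Sum>v\<leftarrow>vs. \<bar>x \<bullet> v\<bar>)\<bar> \<le> \<delta> * norm x" for x .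
  have "norm x - (\<Sum>v\<leftarrow>vs. \<bar>x \<bullet> v\<bar>) \<le> \<delta> * norm x"
    "(\<Sum>v\<leftarrow>vs. \<bar>x \<bullet> v\<bar>) - norm x \<le> \<delta> * norm x" for x
    using n[of x] by linarith+
  then show ?thesis by (intro that[of vs]) (simp_all add: algebra_simps)
qed

text \<open>Bounds on the support function become inclusions: the upper one is used in the direction
  of the point itself, the lower one contradicts a hyperplane that separates a point of the small
  ball from the zonotope.\<close>

lemma zonotope_approx_cball:
  assumes "\<delta> > 0"
  obtains vs where "cball 0 (1 - \<delta>) \<subseteq> zonotope vs" "zonotope vs \<subseteq> cball (0::real^'n) (1 + \<delta>)"
proof -
  obtain vs :: "(real^'n) list" where lo: "\<And>x. (1 - \<delta>) * norm x \<le> (\<Sum>v\<leftarrow>vs. \<bar>x \<bullet> v\<bar>)"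
    and up: "\<And>x. (\<Sum>v\<leftarrow>vs. \<bar>x \<bullet> v\<bar>) \<le> (1 + \<delta>) * norm x"
    using sum_abs_inner_approx_norm[OF assms] by blast
  have "zonotope vs \<subseteq> cball 0 (1 + \<delta>)"
  proof
    fix z assume "z \<in> zonotope vs"
    then have "norm z * norm z \<le> (1 + \<delta>) * norm z"
      using zonotope_inner_le[of z vs z] up[of z] by (simp add: norm_eq_sqrt_inner)
    then show "z \<in> cball 0 (1 + \<delta>)" using assms by (cases "z = 0") auto
  qed
  moreover have "cball 0 (1 - \<delta>) \<subseteq> zonotope vs"
  proof
    fix x :: "real^'n" assume x: "x \<in> cball 0 (1 - \<delta>)"
    show "x \<in> zonotope vs"
    proof (rule ccontr)
      assume "x \<notin> zonotope vs"
      then obtain a b where ab: "a \<bullet> x < b" "\<And>z. z \<in> zonotope vs \<Longrightarrow> a \<bullet> z > b"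
        using separating_hyperplane_closed_point[OF convex_zonotope compact_imp_closed[OF compact_zonotope]]
        by blast
      obtain z where z: "z \<in> zonotope vs" "z \<bullet> (-a) = (\<Sum>v\<leftarrow>vs. \<bar>(-a) \<bullet> v\<bar>)"
        using zonotope_inner_attained by blast
      have "b < a \<bullet> z" using ab z by blast
      also have "a \<bullet> z \<le> - ((1 - \<delta>) * norm a)" using z(2) lo[of "-a"] by (simp add: inner_commute)
      also have "\<dots> \<le> - (norm a * norm x)" using x mult_left_mono[of "norm x" "1 - \<delta>" "norm a"]
        by (simp add: mult.commute[of _ "norm a"])
      also have "\<dots> \<le> a \<bullet> x" using Cauchy_Schwarz_ineq2[of a x] by linarith
      finally show False using ab(1) by simp
    qed
  qed
  ultimately show ?thesis using that by blast
qed

lemma parallel_body_eq: "parallel_body K e = K + (*\<^sub>R) e ` cball 0 1"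
  unfolding parallel_body_def set_plus_def by blast

section \<open>Limits of polynomials and the Steiner polynomial\<close>

text \<open>A polynomial of degree at most n is the Lagrange interpolant of its values at n + 1
  nodes. Convergence at the nodes therefore gives convergence everywhere to the interpolant of the
  limit values.\<close>

lemma poly_pointwise_limit:
  fixes f :: "real \<Rightarrow> real" and n :: nat
  assumes "\<And>\<eta>. \<eta> > 0 \<Longrightarrow> \<exists>p. degree p \<le> n \<and> (\<forall>x>0. \<bar>poly p x - f x\<bar> \<le> \<eta> * f x)"
  shows "\<exists>p. degree p \<le> n \<and> (\<forall>x>0. poly p x = f x)"
proof -
  \<comment> \<open>Lagrange basis for the nodes 1, ..., n + 1. The shift by one keeps the nodes in
    the range x > 0, where f is controlled.\<close>
  define l where "l i = (\<Prod>j\<in>{0..n}-{i}. smult (1 / (real i - real j)) [:- (real j + 1), 1:])" for i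
  have dl: "degree (l i) \<le> n" if "i \<le> n" for i
  proof -
    have "degree (l i) \<le> (\<Sum>j\<in>{0..n}-{i}. degree (smult (1 / (real i - real j)) [:- (real j + 1), 1:]))"
      unfolding l_def by (rule degree_prod_sum_le[unfolded o_def]) simp
    also have "\<dots> \<le> (\<Sum>j\<in>{0..n}-{i}. 1)" by (intro sum_mono) simp
    also have "\<dots> = n" using that by simp
    finally show ?thesis .
  qed
  have li: "poly (l i) (real i + 1) = 1" for i
    unfolding l_def poly_prod
  proof (intro prod.neutral ballI)
    fix j assume "j \<in> {0..n} - {i}"
    then have "real i - real j \<noteq> 0" by auto
    then show "poly (smult (1 / (real i - real j)) [:- (real j + 1), 1:]) (real i + 1) = 1"
      by (simp add: diff_divide_distrib[symmetric] add_divide_distrib[symmetric])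
  qed
  have lj: "poly (l i) (real j + 1) = 0" if "j \<le> n" "j \<noteq> i" for i j
    unfolding l_def poly_prod using that
    by (intro prod_zero bexI[of _ j]) (auto simp flip: add_divide_distrib)
  have interp: "p = (\<Sum>i\<in>{0..n}. smult (poly p (real i + 1)) (l i))" (is "p = ?q")
    if "degree p \<le> n" for p :: "real poly"
  proof (rule poly_eqI_degree[where A = "(\<lambda>i. real i + 1) ` {0..n}"])
    fix x assume "x \<in> (\<lambda>i. real i + 1) ` {0..n}"
    then obtain j where j: "j \<le> n" "x = real j + 1" by auto
    have "poly ?q x = (\<Sum>i\<in>{0..n}. if i = j then poly p (real j + 1) else 0)"
      unfolding poly_sum by (intro sum.cong) (use j li lj in auto)
    then show "poly p x = poly ?q x" using j by simp
  next
    have c: "card ((\<lambda>i. real i + 1) ` {0..n}) = n + 1" by (subst card_image) (auto simp: inj_on_def)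
    show "degree p < card ((\<lambda>i. real i + 1) ` {0..n})" using that c by simp
    have "degree ?q \<le> n" by (intro degree_sum_le order_trans[OF degree_smult_le dl]) auto
    then show "degree ?q < card ((\<lambda>i. real i + 1) ` {0..n})" using c by simp
  qed
  define P where "P = (\<Sum>i\<in>{0..n}. smult (f (real i + 1)) (l i))"
  have "\<forall>k. \<exists>p. degree p \<le> n \<and> (\<forall>x>0. \<bar>poly p x - f x\<bar> \<le> inverse (real (Suc k)) * f x)"
    using assms by auto
  then obtain p where p: "\<And>k. degree (p k) \<le> n"
    "\<And>k x. x > 0 \<Longrightarrow> \<bar>poly (p k) x - f x\<bar> \<le> inverse (real (Suc k)) * f x" by metis
  have lim: "(\<lambda>k. poly (p k) x) \<longlonglongrightarrow> f x" if "x > 0" for x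
  proof (rule Lim_transform_bound[where g = "\<lambda>k. inverse (real (Suc k)) * f x" and f = "\<lambda>k. poly (p k) x - f x", THEN LIM_zero_cancel])
    show "\<forall>\<^sub>F k in sequentially. norm (poly (p k) x - f x) \<le> norm (inverse (real (Suc k)) * f x)"
    proof (rule always_eventually, rule allI)
      fix k show "norm (poly (p k) x - f x) \<le> norm (inverse (real (Suc k)) * f x)"
        using p(2)[OF that, of k] by (metis abs_ge_self order_trans real_norm_def)
    qed
    show "(\<lambda>k. inverse (real (Suc k)) * f x) \<longlonglongrightarrow> 0"
      using tendsto_mult_right[OF LIMSEQ_inverse_real_of_nat, of "f x"] by simp
  qed
  have "poly P x = f x" if "x > 0" for x
  proof (rule LIMSEQ_unique)
    show "(\<lambda>k. poly (p k) x) \<longlonglongrightarrow> f x" by (rule lim[OF that])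
    have "(\<lambda>k. \<Sum>i\<in>{0..n}. poly (p k) (real i + 1) * poly (l i) x) \<longlonglongrightarrow> (\<Sum>i\<in>{0..n}. f (real i + 1) * poly (l i) x)"
      by (intro tendsto_intros lim) simp
    moreover have "poly (p k) x = (\<Sum>i\<in>{0..n}. poly (p k) (real i + 1) * poly (l i) x)" for k
      using arg_cong[OF interp[OF p(1)[of k]], of "\<lambda>q. poly q x"] by (simp add: poly_sum)
    ultimately show "(\<lambda>k. poly (p k) x) \<longlonglongrightarrow> poly P x" by (simp add: P_def poly_sum)
  qed
  moreover have "degree P \<le> n"
    unfolding P_def by (intro degree_sum_le order_trans[OF degree_smult_le dl]) auto
  ultimately show ?thesis by blast
qed

lemma vol_scaleR_image:
  assumes "compact (A::'a::euclidean_space set)" "c \<ge> 0"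
  shows "vol ((*\<^sub>R) c ` A) = c ^ DIM('a) * vol A"
proof -
  have "compact ((*\<^sub>R) c ` A)" using assms by (intro compact_scaling)
  then have "vol ((*\<^sub>R) c ` A) = measure lebesgue ((\<lambda>x. 0 + c *\<^sub>R x) ` A)"
    by (simp add: borel_compact measure_completion)
  also have "\<dots> = \<bar>c\<bar> ^ DIM('a) * measure lebesgue A"
    using measure_lebesgue_affine[of c 0 A] by (simp add: add.commute)
  finally show ?thesis using assms by (simp add: borel_compact measure_completion)
qed

lemma one_plus_power_le: "0 \<le> d \<Longrightarrow> d \<le> 1 \<Longrightarrow> (1 + d) ^ n \<le> 1 + 3 ^ n * (d::real)"
proof (induction n)
  case (Suc n)
  have "(1 + d) ^ Suc n \<le> (1 + d) * (1 + 3 ^ n * d)"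
    using Suc by (simp add: mult_left_mono)
  also have "\<dots> = 1 + (1 + 3 ^ n + 3 ^ n * d) * d" by (simp add: algebra_simps)
  also have "\<dots> \<le> 1 + 3 ^ Suc n * d"
  proof -
    have "3 ^ n * d \<le> 3 ^ n * 1" "1 \<le> (3::real) ^ n" using Suc by (auto intro: mult_left_mono)
    then have "1 + 3 ^ n + 3 ^ n * d \<le> 3 ^ Suc n" unfolding power_Suc by linarith
    then show ?thesis using Suc by (simp add: mult_right_mono)
  qed
  finally show ?case .
qed simp

lemma of_nat_le_three_power: "real n \<le> 3 ^ n"
proof (induction n)
  case (Suc n)
  have "1 \<le> (3::real) ^ n" by simp
  with Suc show ?case unfolding power_Suc of_nat_Suc by linarith
qed simp

text \<open>Since 0 lies in K, dilations by factors below 1 map K into itself. Thus a zonotope Z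
  between the balls of radii 1 - d and 1 + d puts K + e Z between dilates of K + e B by the same
  factors, with a relative error of volume that does not depend on e.\<close>

lemma steiner_polynomial_zero_mem:
  fixes K :: "(real^'n) set"
  assumes K: "convex K" "compact K" "0 \<in> K"
  shows "\<exists>p. degree p \<le> CARD('n) \<and> (\<forall>e>0. poly p e = vol (parallel_body K e))"
proof (rule poly_pointwise_limit)
  let ?n = "CARD('n)"
  fix \<eta> :: real assume eta: "\<eta> > 0"
  \<comment> \<open>The factor 3 ^ n covers both sides: the constant of
    \<open>one_plus_power_le\<close> above, and n \<le> 3 ^ n in Bernoulli's inequality
    below.\<close>
  define d where "d = min (\<eta> / 3 ^ ?n) (1/2)"
  have d: "0 < d" "d \<le> 1/2" "3 ^ ?n * d \<le> \<eta>"
    using eta by (auto simp: d_def min_def field_simps)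
  obtain vs where vs: "cball 0 (1 - d) \<subseteq> zonotope vs" "zonotope vs \<subseteq> cball (0::real^'n) (1 + d)"
    using zonotope_approx_cball[OF d(1)] by blast
  obtain p where p: "degree p \<le> ?n" "\<And>e. e \<ge> 0 \<Longrightarrow> vol (K + (*\<^sub>R) e ` zonotope vs) = poly p e"
    using vol_add_zonotope_poly_degree[OF K(1,2), of vs] by auto
  have "\<bar>poly p e - vol (parallel_body K e)\<bar> \<le> \<eta> * vol (parallel_body K e)" if e: "e > 0" for e
  proof -
    let ?P = "K + (*\<^sub>R) e ` cball 0 1" and ?Z = "K + (*\<^sub>R) e ` zonotope vs"
    have cP: "compact ?P" by (intro compact_set_plus compact_scaling K) simp
    have cZ: "compact ?Z" by (intro compact_set_plus compact_scaling compact_zonotope K)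
    have shrink: "c *\<^sub>R k \<in> K" if "k \<in> K" "0 \<le> c" "c \<le> 1" for c k
      using convexD_alt[OF K(1) K(3) that] by simp
    have 1: "?Z \<subseteq> (*\<^sub>R) (1 + d) ` ?P"
    proof
      fix x assume "x \<in> ?Z"
      then obtain k z where x: "x = k + e *\<^sub>R z" "k \<in> K" "z \<in> zonotope vs" by (auto simp: set_plus_def)
      have "norm ((1 / (1 + d)) *\<^sub>R z) \<le> 1" using vs(2) x(3) d by (auto simp: field_simps)
      then have "(1 / (1 + d)) *\<^sub>R k + e *\<^sub>R ((1 / (1 + d)) *\<^sub>R z) \<in> ?P"
        using d x by (intro set_plus_intro imageI shrink) auto
      moreover have "x = (1 + d) *\<^sub>R ((1 / (1 + d)) *\<^sub>R k + e *\<^sub>R ((1 / (1 + d)) *\<^sub>R z))"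
        using d x(1) by (simp add: scaleR_add_right)
      ultimately show "x \<in> (*\<^sub>R) (1 + d) ` ?P" by blast
    qed
    have 2: "(*\<^sub>R) (1 - d) ` ?P \<subseteq> ?Z"
    proof
      fix x assume "x \<in> (*\<^sub>R) (1 - d) ` ?P"
      then obtain y where y: "x = (1 - d) *\<^sub>R y" "y \<in> ?P" by blast
      then obtain k b where "y = k + e *\<^sub>R b" "k \<in> K" "b \<in> cball 0 1"
        by (auto simp: set_plus_def)
      with y have x: "x = (1 - d) *\<^sub>R (k + e *\<^sub>R b)" "k \<in> K" "b \<in> cball 0 1" by auto
      have "norm ((1 - d) *\<^sub>R b) \<le> (1 - d) * 1" using x(3) d by (simp add: mult_left_le)
      then have "(1 - d) *\<^sub>R b \<in> zonotope vs" using vs(1) by (simp add: subset_iff)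
      then have "(1 - d) *\<^sub>R k + e *\<^sub>R ((1 - d) *\<^sub>R b) \<in> ?Z"
        using d x by (intro set_plus_intro imageI shrink) auto
      then show "x \<in> ?Z" using x(1) by (simp add: scaleR_add_right mult.commute)
    qed
    have v1: "vol ?Z \<le> (1 + d) ^ ?n * vol ?P"
      using vol_mono[OF cZ _ 1] cP d by (simp add: compact_scaling vol_scaleR_image)
    have v2: "(1 - d) ^ ?n * vol ?P \<le> vol ?Z"
      using vol_mono[OF _ cZ 2] cP d by (simp add: compact_scaling vol_scaleR_image)
    have b1: "(1 + d) ^ ?n \<le> 1 + \<eta>" using one_plus_power_le[of d ?n] d by linarith
    have "real ?n \<le> 3 ^ ?n" by (rule of_nat_le_three_power)
    then have "real ?n * d \<le> \<eta>" using d by (meson less_imp_le mult_right_mono order_trans)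
    then have b2: "1 - \<eta> \<le> (1 - d) ^ ?n" using Bernoulli_inequality[of "-d" ?n] d by simp
    have "vol ?Z \<le> (1 + \<eta>) * vol ?P" "(1 - \<eta>) * vol ?P \<le> vol ?Z"
      using v1 v2 mult_right_mono[OF b1, of "vol ?P"] mult_right_mono[OF b2, of "vol ?P"] by auto
    then have "\<bar>vol ?Z - vol ?P\<bar> \<le> \<eta> * vol ?P" by (simp add: abs_le_iff algebra_simps)
    then show ?thesis using p(2)[of e] e by (simp add: parallel_body_eq)
  qed
  then show "\<exists>p. degree p \<le> ?n \<and> (\<forall>e>0. \<bar>poly p e - vol (parallel_body K e)\<bar> \<le> \<eta> * vol (parallel_body K e))"
    using p(1) by blast
qed

lemma compact_parallel_body: "compact K \<Longrightarrow> compact (parallel_body K e)"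
  unfolding parallel_body_eq by (intro compact_set_plus compact_scaling) auto

lemma parallel_body_translation: "parallel_body ((+) a ` K) e = (+) a ` parallel_body K e"
proof (intro equalityI subsetI)
  fix x assume "x \<in> parallel_body ((+) a ` K) e"
  then obtain k b where "k \<in> K" "b \<in> cball 0 1" "x = a + k + e *\<^sub>R b"
    unfolding parallel_body_def by blast
  then show "x \<in> (+) a ` parallel_body K e"
    unfolding parallel_body_def by (intro image_eqI[of _ _ "k + e *\<^sub>R b"]) auto
next
  fix x assume "x \<in> (+) a ` parallel_body K e"
  then obtain k b where "k \<in> K" "b \<in> cball 0 1" "x = a + (k + e *\<^sub>R b)"
    unfolding parallel_body_def by blast
  then have "x = a + k + e *\<^sub>R b" "a + k \<in> (+) a ` K" "b \<in> cball 0 1" by auto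
  then show "x \<in> parallel_body ((+) a ` K) e" unfolding parallel_body_def by blast
qed

lemma intrinsic_volumes_translation:
  "compact K \<Longrightarrow> intrinsic_volumes ((+) a ` K) = intrinsic_volumes (K :: (real^'n) set)"
  unfolding intrinsic_volumes_def parallel_body_translation by (simp only: measure_translation)

lemma vol_lebesgue: "compact (A::'a::euclidean_space set) \<Longrightarrow> measure lebesgue A = vol A"
  by (simp add: borel_compact measure_completion)

theorem steiner_polynomial:
  fixes K :: "(real^'n) set"
  assumes K: "convex K" "compact K" "K \<noteq> {}"
  shows "\<exists>p. degree p \<le> CARD('n) \<and> (\<forall>e>0. poly p e = vol (parallel_body K e))"
proof -
  obtain k where k: "k \<in> K" using K by blast
  let ?K = "(+) (-k) ` K"
  have "convex ?K" "compact ?K" "0 \<in> ?K"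
    using K k by (simp_all only: convex_translation compact_translation) (simp add: image_iff)
  from steiner_polynomial_zero_mem[OF this]
  show ?thesis unfolding parallel_body_translation vol_translation[OF compact_parallel_body[OF K(2)]] .
qed

text \<open>The definite description is resolved: the coefficients of the Steiner polynomial give
  existence, and two polynomials that agree for all e > 0 coincide, which gives uniqueness up to the
  dimension. Beyond it the values are prescribed to be 0.\<close>

theorem steiner_formula:
  fixes K :: "(real^'n) set"
  assumes K: "convex K" "compact K" "K \<noteq> {}" and "e > 0"
  shows "vol (parallel_body K e) =
    (\<Sum>j = 0..CARD('n). unit_ball_vol (real (CARD('n) - j)) * intrinsic_volumes K j * e ^ (CARD('n) - j))"
proof -
  let ?n = "CARD('n)"
  let ?S = "\<lambda>V::nat \<Rightarrow> real. (\<forall>e>0. vol (parallel_body K e) =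
        (\<Sum>j = 0..?n. unit_ball_vol (real (?n - j)) * V j * e ^ (?n - j))) \<and> (\<forall>j > ?n. V j = 0)"
  \<comment> \<open>Steiner's sum as a polynomial in e: the index is reversed, so the coefficient of
    e^i carries V (n - i).\<close>
  define Q where "Q V = (\<Sum>i = 0..?n. monom (unit_ball_vol (real i) * V (?n - i)) i)" for V :: "nat \<Rightarrow> real"
  have Q: "poly (Q V) e = (\<Sum>j = 0..?n. unit_ball_vol (real (?n - j)) * V j * e ^ (?n - j))" for V e
  proof -
    have "poly (Q V) e = (\<Sum>i = 0..?n. unit_ball_vol (real i) * V (?n - i) * e ^ i)"
      by (simp add: Q_def poly_sum poly_monom)
    also have "\<dots> = (\<Sum>j = 0..?n. unit_ball_vol (real (?n - j)) * V (?n - (?n - j)) * e ^ (?n - j))"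
      by (rule sum.reindex_bij_witness[of _ "\<lambda>j. ?n - j" "\<lambda>j. ?n - j"]) auto
    also have "\<dots> = (\<Sum>j = 0..?n. unit_ball_vol (real (?n - j)) * V j * e ^ (?n - j))"
      by (intro sum.cong) auto
    finally show ?thesis .
  qed
  have cQ: "coeff (Q V) i = unit_ball_vol (real i) * V (?n - i)" if "i \<le> ?n" for V i
    using that by (simp add: Q_def coeff_sum)
  have "\<exists>!V. ?S V"
  proof (rule ex_ex1I)
    obtain p where p: "degree p \<le> ?n" "\<And>e. e > 0 \<Longrightarrow> poly p e = vol (parallel_body K e)"
      using steiner_polynomial[OF K] by blast
    define V where "V j = (if j \<le> ?n then coeff p (?n - j) / unit_ball_vol (real (?n - j)) else 0)" for j
    have "Q V = p"
    proof (rule poly_eqI)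
      fix i
      show "coeff (Q V) i = coeff p i"
      proof (cases "i \<le> ?n")
        case True
        have "unit_ball_vol (real i) \<noteq> 0" by (rule less_imp_neq[symmetric], rule unit_ball_vol_pos) simp
        then show ?thesis using True by (simp add: cQ V_def)
      next
        case False
        then show ?thesis using p(1) by (auto simp: Q_def coeff_sum coeff_eq_0)
      qed
    qed
    then have "vol (parallel_body K e) = (\<Sum>j = 0..?n. unit_ball_vol (real (?n - j)) * V j * e ^ (?n - j))"
      if "e > 0" for e using p(2)[OF that] Q[of V e] by simp
    then have "?S V" by (auto simp: V_def)
    then show "\<exists>V. ?S V" by blast
  next
    fix V W assume V: "?S V" and W: "?S W"
    have "poly (Q V) e = poly (Q W) e" if "e > 0" for e using V W that by (simp add: Q)
    then have "{0<..} \<subseteq> {e. poly (Q V - Q W) e = 0}" by auto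
    then have "infinite {e. poly (Q V - Q W) e = 0}" using infinite_Ioi finite_subset by blast
    then have QQ: "Q V = Q W" using poly_roots_finite[of "Q V - Q W"] by auto
    show "V = W"
    proof
      fix j show "V j = W j"
      proof (cases "j \<le> ?n")
        case True
        have "unit_ball_vol (real (?n - j)) \<noteq> 0" by (rule less_imp_neq[symmetric], rule unit_ball_vol_pos) simp
        then show ?thesis using cQ[of "?n - j" V] cQ[of "?n - j" W] QQ True by simp
      next
        case False then show ?thesis using V W by simp
      qed
    qed
  qed
  from theI'[OF this] have "?S (intrinsic_volumes K)"
    unfolding intrinsic_volumes_def vol_lebesgue[OF compact_parallel_body[OF K(2)]] .
  then show ?thesis using \<open>e > 0\<close> by blast
qed

section \<open>Integration along one-parameter flows\<close>

text \<open>
  Polar coordinates without a surface measure: instead of a section of the flow T, a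
  weight e of total mass 1 along every orbit is used.
\<close>

lemma nn_integral_flow:
  fixes T :: "real \<Rightarrow> 'a::euclidean_space \<Rightarrow> 'a" and f e :: "'a \<Rightarrow> ennreal"
  assumes T[measurable]: "(\<lambda>p. T (fst p) (snd p)) \<in> borel_measurable (borel \<Otimes>\<^sub>M borel)"
    and [measurable]: "f \<in> borel_measurable borel" "e \<in> borel_measurable borel"
    and scal: "\<And>c g. c > 0 \<Longrightarrow> g \<in> borel_measurable borel \<Longrightarrow>
      (\<integral>\<^sup>+x. g x \<partial>lborel) = ennreal (c ^ Suc k) * (\<integral>\<^sup>+x. g (T c x) \<partial>lborel)"
    and inv: "\<And>c x. c > 0 \<Longrightarrow> T (1 / c) (T c x) = x"
    and base: "AE x in lborel. f x \<noteq> 0 \<longrightarrow>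
      (\<integral>\<^sup>+c. indicator {0<..} c * (e (T (1 / c) x) * ennreal (1 / c)) \<partial>lborel) = 1"
  shows "(\<integral>\<^sup>+x. f x \<partial>lborel) =
    (\<integral>\<^sup>+x. e x * (\<integral>\<^sup>+c. indicator {0<..} c * (f (T c x) * ennreal (c ^ k)) \<partial>lborel) \<partial>lborel)"
proof -
  have [measurable]: "T c \<in> borel_measurable borel" for c
  proof -
    have "(\<lambda>x. T (fst (c, x)) (snd (c, x))) \<in> borel_measurable borel"
      by (rule measurable_compose[OF _ T]) measurable
    then show ?thesis by simp
  qed
  have [measurable]: "(\<lambda>p. T (1 / fst p) (snd p)) \<in> borel_measurable (borel \<Otimes>\<^sub>M borel)"
  proof -
    have "(\<lambda>p. T (fst (1 / fst p, snd p)) (snd (1 / fst p, snd p :: 'a))) \<in> borel_measurable (borel \<Otimes>\<^sub>M borel)"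
      by (rule measurable_compose[OF _ T]) measurable
    then show ?thesis by simp
  qed
  have [measurable]: "(\<lambda>p. T (1 / snd p) (fst p)) \<in> borel_measurable (borel \<Otimes>\<^sub>M borel)"
  proof -
    have "(\<lambda>p. T (fst (1 / snd p, fst p)) (snd (1 / snd p, fst p :: 'a))) \<in> borel_measurable (borel \<Otimes>\<^sub>M borel)"
      by (rule measurable_compose[OF _ T]) measurable
    then show ?thesis by simp
  qed
  have [measurable]: "(\<lambda>p. T (snd p) (fst p)) \<in> borel_measurable (borel \<Otimes>\<^sub>M borel)"
  proof -
    have "(\<lambda>p. T (fst (snd p, fst p)) (snd (snd p, fst p :: 'a))) \<in> borel_measurable (borel \<Otimes>\<^sub>M borel)"
      by (rule measurable_compose[OF _ T]) measurable
    then show ?thesis by simp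
  qed
  have [measurable]: "(\<lambda>c. T (1 / c) x) \<in> borel_measurable borel" for x
  proof -
    have "(\<lambda>c. T (fst (1 / c, x)) (snd (1 / c, x))) \<in> borel_measurable borel"
      by (rule measurable_compose[OF _ T]) measurable
    then show ?thesis by simp
  qed
  have [measurable]: "(\<lambda>c. T c x) \<in> borel_measurable borel" for x
  proof -
    have "(\<lambda>c. T (fst (c, x)) (snd (c, x))) \<in> borel_measurable borel"
      by (rule measurable_compose[OF _ T]) measurable
    then show ?thesis by simp
  qed
  have "(\<integral>\<^sup>+x. f x \<partial>lborel) = (\<integral>\<^sup>+x. (\<integral>\<^sup>+c. f x * (indicator {0<..} c * (e (T (1 / c) x) * ennreal (1 / c))) \<partial>lborel) \<partial>lborel)"
  proof (rule nn_integral_cong_AE)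
    show "AE x in lborel. f x = (\<integral>\<^sup>+c. f x * (indicator {0<..} c * (e (T (1 / c) x) * ennreal (1 / c))) \<partial>lborel)"
      using base
    proof eventually_elim
      case (elim x)
      have "(\<integral>\<^sup>+c. f x * (indicator {0<..} c * (e (T (1 / c) x) * ennreal (1 / c))) \<partial>lborel)
        = f x * (\<integral>\<^sup>+c. (indicator {0<..} c * (e (T (1 / c) x) * ennreal (1 / c))) \<partial>lborel)"
        by (rule nn_integral_cmult) measurable
      then show ?case using elim by (cases "f x = 0") auto
    qed
  qed
  also have "\<dots> = (\<integral>\<^sup>+c. (\<integral>\<^sup>+x. f x * (indicator {0<..} c * (e (T (1 / c) x) * ennreal (1 / c))) \<partial>lborel) \<partial>lborel)"
    by (rule lborel_pair.Fubini') measurable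
  also have "\<dots> = (\<integral>\<^sup>+c. (\<integral>\<^sup>+x. e x * (indicator {0<..} c * (f (T c x) * ennreal (c ^ k))) \<partial>lborel) \<partial>lborel)"
  proof (rule nn_integral_cong)
    fix c :: real
    show "(\<integral>\<^sup>+x. f x * (indicator {0<..} c * (e (T (1 / c) x) * ennreal (1 / c))) \<partial>lborel)
        = (\<integral>\<^sup>+x. e x * (indicator {0<..} c * (f (T c x) * ennreal (c ^ k))) \<partial>lborel)"
    proof (cases "c > 0")
      \<comment> \<open>Substituting T c x for x turns e (T (1/c) x) into e x. The Jacobian c^(k+1)
        and the factor 1/c of the weight leave c^k.\<close>
      case True
      have "(\<integral>\<^sup>+x. f x * (indicator {0<..} c * (e (T (1 / c) x) * ennreal (1 / c))) \<partial>lborel)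
        = (\<integral>\<^sup>+x. ennreal (1 / c) * (f x * e (T (1 / c) x)) \<partial>lborel)"
        using True by (simp add: mult_ac)
      also have "\<dots> = ennreal (1 / c) * (\<integral>\<^sup>+x. f x * e (T (1 / c) x) \<partial>lborel)"
        by (rule nn_integral_cmult) measurable
      also have "(\<integral>\<^sup>+x. f x * e (T (1 / c) x) \<partial>lborel) = ennreal (c ^ Suc k) * (\<integral>\<^sup>+x. f (T c x) * e (T (1 / c) (T c x)) \<partial>lborel)"
        by (rule scal[OF True]) measurable
      also have "ennreal (1 / c) * (ennreal (c ^ Suc k) * (\<integral>\<^sup>+x. f (T c x) * e (T (1 / c) (T c x)) \<partial>lborel))
        = ennreal (c ^ k) * (\<integral>\<^sup>+x. f (T c x) * e x \<partial>lborel)"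
        using True by (simp add: inv mult.assoc[symmetric] ennreal_mult[symmetric])
      also have "\<dots> = (\<integral>\<^sup>+x. ennreal (c ^ k) * (f (T c x) * e x) \<partial>lborel)"
        by (rule nn_integral_cmult[symmetric]) measurable
      finally show ?thesis using True by (simp add: mult_ac)
    qed simp
  qed
  also have "\<dots> = (\<integral>\<^sup>+x. (\<integral>\<^sup>+c. e x * (indicator {0<..} c * (f (T c x) * ennreal (c ^ k))) \<partial>lborel) \<partial>lborel)"
    by (rule lborel_pair.Fubini') measurable
  also have "\<dots> = (\<integral>\<^sup>+x. e x * (\<integral>\<^sup>+c. (indicator {0<..} c * (f (T c x) * ennreal (c ^ k))) \<partial>lborel) \<partial>lborel)"
    by (intro nn_integral_cong nn_integral_cmult) measurable
  finally show ?thesis .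
qed

text \<open>Verifies the normalisation \<open>base\<close> of \<open>nn_integral_flow\<close> for
  any quantity t that the flow multiplies by c, with the weight 1/t on t \<ge> 1: on the orbit the
  integrand is the constant 1/t for 0 < c \<le> t.\<close>

lemma nn_integral_flow_weight:
  assumes "t > 0"
  shows "(\<integral>\<^sup>+c. indicator {0<..} c * (ennreal (if t / c \<ge> 1 then 1 / (t / c) else 0) * ennreal (1 / c)) \<partial>lborel) = 1"
proof -
  have "(\<integral>\<^sup>+c. indicator {0<..} c * (ennreal (if t / c \<ge> 1 then 1 / (t / c) else 0) * ennreal (1 / c)) \<partial>lborel)
    = (\<integral>\<^sup>+c. ennreal (1 / t) * indicator {0<..t} c \<partial>lborel)"
    by (intro nn_integral_cong)
      (use assms in \<open>auto simp: indicator_def ennreal_mult[symmetric] field_simps\<close>)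
  also have "\<dots> = ennreal (1 / t) * emeasure lborel {0<..t}"
    by (rule nn_integral_cmult_indicator) simp
  also have "\<dots> = 1" using assms by (simp add: ennreal_mult[symmetric])
  finally show ?thesis .
qed

lemma nn_integral_scaleR:
  fixes g :: "'a::euclidean_space \<Rightarrow> ennreal"
  assumes "c > 0" and [measurable]: "g \<in> borel_measurable borel"
  shows "(\<integral>\<^sup>+x. g x \<partial>lborel) = ennreal (c ^ DIM('a)) * (\<integral>\<^sup>+x. g (c *\<^sub>R x) \<partial>lborel)"
  using assms by (subst lborel_affine[of c 0]) (simp_all add: nn_integral_density nn_integral_distr nn_integral_cmult)

section \<open>Stretches across an axis\<close>

text \<open>For a unit vector w this keeps the component of x along w and multiplies the component
  orthogonal to w by c.\<close>

definition stretch :: "'a::real_inner \<Rightarrow> real \<Rightarrow> 'a \<Rightarrow> 'a" where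
  "stretch w c x = c *\<^sub>R x + ((1 - c) * (x \<bullet> w)) *\<^sub>R w"

lemma stretch_measurable [measurable]:
  "(\<lambda>p. stretch w (fst p) (snd p)) \<in> borel_measurable (borel \<Otimes>\<^sub>M borel :: (real \<times> 'a::euclidean_space) measure)"
  unfolding stretch_def by measurable

lemma nn_integral_stretch_Basis:
  fixes g :: "'a::euclidean_space \<Rightarrow> ennreal"
  assumes "c > 0" "a \<in> Basis" and [measurable]: "g \<in> borel_measurable borel"
  shows "(\<integral>\<^sup>+x. g x \<partial>lborel) = ennreal (c ^ (DIM('a) - 1)) * (\<integral>\<^sup>+x. g (stretch a c x) \<partial>lborel)"
proof -
  define C where "C j = (if j = a then 1 else c)" for j
  have T: "0 + (\<Sum>j\<in>Basis. (C j * (x \<bullet> j)) *\<^sub>R j) = stretch a c x" for x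
  proof -
    have "(\<Sum>j\<in>Basis. (C j * (x \<bullet> j)) *\<^sub>R j)
      = (\<Sum>j\<in>Basis. c *\<^sub>R ((x \<bullet> j) *\<^sub>R j) + (if j = a then ((1 - c) * (x \<bullet> j)) *\<^sub>R j else 0))"
      by (intro sum.cong) (auto simp: C_def algebra_simps)
    also have "\<dots> = stretch a c x"
      by (simp only: sum.distrib flip: scaleR_sum_right)
        (simp add: stretch_def euclidean_representation assms(2))
    finally show ?thesis by simp
  qed
  have P: "(\<Prod>j\<in>Basis. \<bar>C j\<bar>) = c ^ (DIM('a) - 1)"
  proof -
    have "(\<Prod>j\<in>Basis. \<bar>C j\<bar>) = (\<Prod>j\<in>Basis - {a}. \<bar>C j\<bar>)"
      using assms(2) by (subst prod.remove[of _ a]) (auto simp: C_def)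
    also have "\<dots> = (\<Prod>j\<in>Basis - {a}. c)" using assms(1) by (intro prod.cong) (auto simp: C_def)
    also have "\<dots> = c ^ (DIM('a) - 1)" using assms(2) by simp
    finally show ?thesis .
  qed
  have "lborel = density (distr lborel borel (stretch a c)) (\<lambda>_. ennreal (c ^ (DIM('a) - 1)))"
    using lborel_affine_euclidean[of C 0] assms(1) unfolding T P by (simp add: C_def)
  moreover have "stretch a c \<in> borel_measurable borel" unfolding stretch_def by measurable
  ultimately show ?thesis
    using nn_integral_density[of "\<lambda>_. ennreal (c ^ (DIM('a) - 1))" "distr lborel borel (stretch a c)" g]
    by (simp add: nn_integral_distr nn_integral_cmult)
qed

text \<open>A rotation takes a coordinate axis to w, and along a coordinate axis the stretch is
  diagonal with determinant c^(n-1).\<close>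

lemma nn_integral_stretch:
  fixes g :: "real^'n \<Rightarrow> ennreal"
  assumes "c > 0" "norm w = 1" and [measurable]: "g \<in> borel_measurable borel"
  shows "(\<integral>\<^sup>+x. g x \<partial>lborel) = ennreal (c ^ (CARD('n) - 1)) * (\<integral>\<^sup>+x. g (stretch w c x) \<partial>lborel)"
proof -
  obtain a :: "real^'n" where a: "a \<in> Basis" using nonempty_Basis by blast
  obtain f where f: "orthogonal_transformation f" "f a = w"
    using orthogonal_transformation_exists[of a w] a assms(2) by auto
  have lin: "linear f" using f(1) by (rule orthogonal_transformation_linear)
  have [measurable]: "f \<in> borel_measurable borel" "stretch w c \<in> borel_measurable borel"
    "stretch a c \<in> borel_measurable borel"
    using linear_continuous_on[of f UNIV] lin unfolding stretch_def
    by (intro borel_measurable_continuous_onI, simp add: linear_conv_bounded_linear) measurable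
  have eq: "stretch w c (f x) = f (stretch a c x)" for x
  proof -
    have "f x \<bullet> w = x \<bullet> a" using f unfolding orthogonal_transformation_def by metis
    then show ?thesis by (simp add: stretch_def linear_add[OF lin] linear_scale[OF lin] f(2))
  qed
  have "(\<integral>\<^sup>+x. g x \<partial>lborel) = (\<integral>\<^sup>+x. g (f x) \<partial>lborel)"
    by (rule nn_integral_orthogonal[OF f(1), symmetric]) measurable
  also have "\<dots> = ennreal (c ^ (CARD('n) - 1)) * (\<integral>\<^sup>+x. g (f (stretch a c x)) \<partial>lborel)"
    using nn_integral_stretch_Basis[OF assms(1) a, of "\<lambda>x. g (f x)"] by simp
  also have "(\<integral>\<^sup>+x. g (f (stretch a c x)) \<partial>lborel) = (\<integral>\<^sup>+x. g (stretch w c x) \<partial>lborel)"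
    using nn_integral_orthogonal[OF f(1), of "\<lambda>x. g (stretch w c x)"] by (simp add: eq)
  finally show ?thesis .
qed

lemma nn_integral_power_Ioc:
  assumes "a \<ge> 0"
  shows "(\<integral>\<^sup>+c. indicator {0<..} c * (indicator {..a} c * ennreal (c ^ k)) \<partial>lborel) = ennreal (a ^ Suc k / Suc k)"
proof -
  have "(\<integral>\<^sup>+c. indicator {0<..} c * (indicator {..a} c * ennreal (c ^ k)) \<partial>lborel)
    = (\<integral>\<^sup>+c. ennreal (c ^ k) * indicator {0..a} c \<partial>lborel)"
  proof (rule nn_integral_cong_AE)
    have "AE c in lborel. c \<noteq> (0::real)" by (rule AE_lborel_singleton)
    then show "AE c in lborel. indicator {0<..} c * (indicator {..a} c * ennreal (c ^ k)) = ennreal (c ^ k) * indicator {0..a} c"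
      by eventually_elim (auto simp: indicator_def)
  qed
  also have "\<dots> = ennreal (a ^ Suc k / Suc k - 0 ^ Suc k / Suc k)"
  proof (rule nn_integral_FTC_Icc)
    fix x show "((\<lambda>x. x ^ Suc k / real (Suc k)) has_real_derivative x ^ k) (at x)"
      using DERIV_cdivide[OF DERIV_pow[of "Suc k" x UNIV], of "real (Suc k)"] by simp
  qed (use assms in auto)
  finally show ?thesis by simp
qed

section \<open>Spherical Voronoi cells\<close>

lemma not_AE_open:
  fixes U :: "'a::euclidean_space set"
  assumes "open U" "U \<noteq> {}" "\<And>x. x \<in> U \<Longrightarrow> \<not> P x"
  shows "\<not> (AE x in lborel. P x)"
proof
  assume "AE x in lborel. P x"
  then have "AE x in lborel. x \<notin> U" by eventually_elim (use assms(3) in blast)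
  then have "U \<in> null_sets lborel" using assms(1) by (simp add: AE_iff_null_sets)
  then have "negligible U" by (simp add: negligible_iff_null_sets null_sets_completionI)
  then show False using open_not_negligible assms(1,2) by blast
qed

lemma integral_pos_open:
  fixes f :: "'a::euclidean_space \<Rightarrow> real"
  assumes f: "integrable lborel f" and nn: "\<And>x. 0 \<le> f x"
    and U: "open U" "U \<noteq> {}" "\<And>x. x \<in> U \<Longrightarrow> f x > 0"
  shows "integral\<^sup>L lborel f > 0"
proof -
  have "\<not> (AE x in lborel. f x = 0)" using not_AE_open[OF U(1,2), of "\<lambda>x. f x = 0"] U(3) by force
  then have "integral\<^sup>L lborel f \<noteq> 0" using integral_nonneg_eq_0_iff_AE[OF f] nn by simp
  moreover have "integral\<^sup>L lborel f \<ge> 0" using nn by (intro integral_nonneg_AE) simp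
  ultimately show ?thesis by simp
qed

section \<open>Chebyshev's association inequality on the half-line\<close>

text \<open>Initial segments of the positive half-line. The stretch factors c that keep a point
  inside a cell star-shaped about w form such a set.\<close>

definition down_closed :: "real set \<Rightarrow> bool" where
  "down_closed D \<longleftrightarrow> D \<subseteq> {0<..} \<and> (\<forall>c\<in>D. \<forall>c'. 0 < c' \<longrightarrow> c' \<le> c \<longrightarrow> c' \<in> D)"

text \<open>Put h = (g - \<Gamma>) q, whose total integral vanishes. Either g \<ge> \<Gamma>
  somewhere outside D; then, as g decreases and D lies to the left, h \<ge> 0 on all of D. Or g <
  \<Gamma> on the whole complement; then h has a nonpositive integral there and a nonnegative one
  over D.\<close>

lemma down_closed_integral:
  fixes g q :: "real \<Rightarrow> real"
  assumes [measurable]: "D \<in> sets borel" "g \<in> borel_measurable borel" "q \<in> borel_measurable borel"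
    and dcD: "down_closed D"
    and q0: "\<forall>c>0. q c > 0" "integrable lborel (\<lambda>c. indicator {0<..} c * q c)"
    and g0: "\<forall>c>0. \<forall>c'\<ge>c. g c' \<le> g c" "\<forall>c. 0 \<le> g c \<and> g c \<le> M"
    and tot: "(\<integral>c. indicator {0<..} c * (g c * q c) \<partial>lborel) = \<Gamma> * (\<integral>c. indicator {0<..} c * q c \<partial>lborel)"
  shows "integrable lborel (\<lambda>c. indicator D c * (g c * q c))"
    and "integrable lborel (\<lambda>c. indicator D c * q c)"
    and "\<Gamma> * (\<integral>c. indicator D c * q c \<partial>lborel) \<le> (\<integral>c. indicator D c * (g c * q c) \<partial>lborel)"
    and "\<forall>c>0. \<forall>c'>c. g c' < g c \<Longrightarrow> c0 \<in> D \<Longrightarrow> c1 > 0 \<Longrightarrow> c1 \<notin> D \<Longrightarrow>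
      \<Gamma> * (\<integral>c. indicator D c * q c \<partial>lborel) < (\<integral>c. indicator D c * (g c * q c) \<partial>lborel)"
proof -
  have D: "D \<subseteq> {0<..}" "\<And>c c'. c \<in> D \<Longrightarrow> 0 < c' \<Longrightarrow> c' \<le> c \<Longrightarrow> c' \<in> D"
    using dcD unfolding down_closed_def by blast+
  have q: "\<And>c. c > 0 \<Longrightarrow> q c > 0" "integrable lborel (\<lambda>c. indicator {0<..} c * q c)"
    using q0 by blast+
  have g: "\<And>c c'. 0 < c \<Longrightarrow> c \<le> c' \<Longrightarrow> g c' \<le> g c" "\<And>c. 0 \<le> g c" "\<And>c. g c \<le> M"
    using g0 by blast+
  have intq: "integrable lborel (\<lambda>c. indicator A c * q c)" if "A \<subseteq> {0<..}" "A \<in> sets borel" for A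
  proof (rule Bochner_Integration.integrable_bound[OF q(2)])
    show "(\<lambda>c. indicator A c * q c) \<in> borel_measurable lborel" using that(2) by simp
    show "AE c in lborel. norm (indicator A c * q c) \<le> norm (indicator {0<..} c * q c)"
      using that(1) by (intro always_eventually allI) (auto simp: indicator_def)
  qed
  have intg: "integrable lborel (\<lambda>c. indicator A c * (g c * q c))" if "A \<subseteq> {0<..}" "A \<in> sets borel" for A
  proof (rule Bochner_Integration.integrable_bound)
    show "integrable lborel (\<lambda>c. M * (indicator {0<..} c * q c))" using q(2) by simp
    show "(\<lambda>c. indicator A c * (g c * q c)) \<in> borel_measurable lborel" using that(2) by simp
    show "AE c in lborel. norm (indicator A c * (g c * q c)) \<le> norm (M * (indicator {0<..} c * q c))"
    proof (intro always_eventually allI)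
      fix c
      have "\<bar>g c\<bar> \<le> \<bar>M\<bar>" using g(2,3)[of c] by linarith
      then show "norm (indicator A c * (g c * q c)) \<le> norm (M * (indicator {0<..} c * q c))"
        using that(1) by (auto simp: indicator_def abs_mult mult_right_mono)
    qed
  qed
  show i1: "integrable lborel (\<lambda>c. indicator D c * (g c * q c))" using intg[OF D(1)] by simp
  show i2: "integrable lborel (\<lambda>c. indicator D c * q c)" using intq[OF D(1)] by simp
  define h where "h A c = indicator A c * ((g c - \<Gamma>) * q c)" for A c
  have hA: "h A c = indicator A c * (g c * q c) - \<Gamma> * (indicator A c * q c)" for A c
    by (simp add: h_def algebra_simps)
  have inth: "integrable lborel (h A)"
    and ih: "integral\<^sup>L lborel (h A) = (\<integral>c. indicator A c * (g c * q c) \<partial>lborel) - \<Gamma> * (\<integral>c. indicator A c * q c \<partial>lborel)"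
    if "A \<subseteq> {0<..}" "A \<in> sets borel" for A
    unfolding hA using intg[OF that] intq[OF that] by simp_all
  let ?C = "{0<..} - D"
  have h0: "integral\<^sup>L lborel (h {0<..}) = 0" using ih[of "{0<..}"] tot by simp
  have hsplit: "integral\<^sup>L lborel (h D) + integral\<^sup>L lborel (h ?C) = 0"
  proof -
    have "h {0<..} c = h D c + h ?C c" for c using D(1) by (auto simp: h_def indicator_def)
    then have e: "h {0<..} = (\<lambda>c. h D c + h ?C c)" by (rule ext)
    have "integral\<^sup>L lborel (h {0<..}) = integral\<^sup>L lborel (h D) + integral\<^sup>L lborel (h ?C)"
      unfolding e by (intro Bochner_Integration.integral_add inth D(1)) auto
    then show ?thesis using h0 by simp
  qed
  have iD: "integral\<^sup>L lborel (h D) = (\<integral>c. indicator D c * (g c * q c) \<partial>lborel) - \<Gamma> * (\<integral>c. indicator D c * q c \<partial>lborel)"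
    using ih[OF D(1)] by simp
  have Dlt: "c < c'" if "c \<in> D" "c' \<in> ?C" for c c'
    using that D(2)[of c c'] by force
  have two: "(\<exists>c1\<in>?C. g c1 \<ge> \<Gamma>) \<or> (\<forall>c\<in>?C. g c < \<Gamma>)" by force
  have "integral\<^sup>L lborel (h D) \<ge> 0" using two
  proof
    assume "\<exists>c1\<in>?C. g c1 \<ge> \<Gamma>"
    then obtain c1 where c1: "c1 \<in> ?C" "g c1 \<ge> \<Gamma>" by blast
    have "h D c \<ge> 0" for c
    proof (cases "c \<in> D")
      case True
      then have "g c1 \<le> g c" using Dlt[OF True c1(1)] D(1) by (intro g(1)) auto
      then show ?thesis using c1 q(1)[of c] D(1) True by (auto simp: h_def)
    qed (simp add: h_def)
    then show ?thesis by (intro integral_nonneg_AE) simp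
  next
    assume *: "\<forall>c\<in>?C. g c < \<Gamma>"
    have "- h ?C c \<ge> 0" for c
    proof (cases "c \<in> ?C")
      case True
      then have "(g c - \<Gamma>) * q c \<le> 0" using *[rule_format, OF True] q(1)[of c]
        by (intro mult_nonpos_nonneg) auto
      then show ?thesis using True by (simp add: h_def)
    qed (simp add: h_def)
    then have "integral\<^sup>L lborel (\<lambda>c. - h ?C c) \<ge> 0" by (intro integral_nonneg_AE) simp
    then show ?thesis using hsplit by simp
  qed
  then show "\<Gamma> * (\<integral>c. indicator D c * q c \<partial>lborel) \<le> (\<integral>c. indicator D c * (g c * q c) \<partial>lborel)"
    using iD by simp
  assume st0: "\<forall>c>0. \<forall>c'>c. g c' < g c" and c01: "c0 \<in> D" "c1 > 0" "c1 \<notin> D"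
  have st: "\<And>c c'. 0 < c \<Longrightarrow> c < c' \<Longrightarrow> g c' < g c" using st0 by blast
  \<comment> \<open>The same two cases, now with a nonempty open interval of strict sign: below c0
    in the first case, above c1 in the second.\<close>
  have "integral\<^sup>L lborel (h D) > 0" using two
  proof
    assume "\<exists>c1\<in>?C. g c1 \<ge> \<Gamma>"
    then obtain c1 where c1: "c1 \<in> ?C" "g c1 \<ge> \<Gamma>" by blast
    have pos: "h D c > 0" if "c \<in> D" for c
    proof -
      have "g c1 < g c" using Dlt[OF that c1(1)] D(1) that by (intro st) auto
      then show ?thesis using c1 q(1)[of c] D(1) that by (auto simp: h_def)
    qed
    show ?thesis
    proof (rule integral_pos_open[where U = "{0<..<c0}"])
      show "integrable lborel (h D)" using inth[OF D(1)] by simp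
      show "0 \<le> h D c" for c using pos[of c] by (cases "c \<in> D") (auto simp: h_def)
      show "{0<..<c0} \<noteq> {}" using c01 D(1) by auto
      show "h D c > 0" if "c \<in> {0<..<c0}" for c using that D(2)[OF c01(1), of c] pos by auto
    qed simp
  next
    assume *: "\<forall>c\<in>?C. g c < \<Gamma>"
    have pos: "- h ?C c > 0" if "c \<in> ?C" for c
    proof -
      have "(g c - \<Gamma>) * q c < 0" using *[rule_format, OF that] q(1)[of c] that
        by (intro mult_neg_pos) auto
      then show ?thesis using that by (simp add: h_def)
    qed
    have "integral\<^sup>L lborel (\<lambda>c. - h ?C c) > 0"
    proof (rule integral_pos_open[where U = "{c1<..}"])
      show "integrable lborel (\<lambda>c. - h ?C c)" using inth[of ?C] by simp
      show "0 \<le> - h ?C c" for c using pos[of c] by (cases "c \<in> ?C") (auto simp: h_def)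
      show "{c1<..} \<noteq> {}" by (metis greaterThan_iff empty_iff gt_ex)
      show "- h ?C c > 0" if "c \<in> {c1<..}" for c
      proof (rule pos)
        show "c \<in> ?C" using that c01 D(2)[of c c1] by auto
      qed
    qed simp
    then show ?thesis using hsplit by simp
  qed
  then show "\<Gamma> * (\<integral>c. indicator D c * q c \<partial>lborel) < (\<integral>c. indicator D c * (g c * q c) \<partial>lborel)"
    using iD by simp
qed

text \<open>
  In the coordinates (s, z) along and across the axis w, the slope t = |z|/s has density
  proportional to this function for the uniform measure on the directions of
  the hemisphere around w; here n = k + 2.
\<close>

definition slope_density :: "nat \<Rightarrow> real \<Rightarrow> real" where
  "slope_density k t = t ^ k / sqrt (1 + t\<^sup>2) ^ (k + 2)"

lemma slope_density_measurable [measurable]: "slope_density k \<in> borel_measurable borel"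
  unfolding slope_density_def by measurable

lemma slope_density_pos: "t > 0 \<Longrightarrow> slope_density k t > 0"
  unfolding slope_density_def by (simp add: add_pos_nonneg)

lemma sqrt_one_plus_pos: "sqrt (1 + t\<^sup>2) > (0::real)"
  by (simp add: add_pos_nonneg)

text \<open>Dominated by 1 / (1 + c^2), whose antiderivative arctan is bounded.\<close>

lemma slope_density_integrable: "integrable lborel (\<lambda>c. indicator {0<..} c * slope_density k c)"
proof (rule Bochner_Integration.integrable_bound)
  have "(\<integral>\<^sup>+x. ennreal (inverse (1 + x\<^sup>2)) * indicator {0..} x \<partial>lborel) = ennreal (pi / 2 - arctan 0)"
  proof (rule nn_integral_FTC_atLeast)
    show "(arctan \<longlongrightarrow> pi / 2) at_top" by (rule tendsto_arctan_at_top)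
    show "DERIV arctan x :> inverse (1 + x\<^sup>2)" for x by (rule DERIV_arctan)
  qed (simp_all add: add_nonneg_nonneg)
  moreover have "(\<integral>\<^sup>+x. ennreal (inverse (1 + x\<^sup>2)) * indicator {0..} x \<partial>lborel)
      = (\<integral>\<^sup>+x. ennreal (norm (indicator {0..} x * (1 / (1 + x\<^sup>2)) :: real)) \<partial>lborel)"
    by (intro nn_integral_cong) (simp add: indicator_def inverse_eq_divide)
  ultimately have "(\<integral>\<^sup>+x. ennreal (norm (indicator {0..} x * (1 / (1 + x\<^sup>2)) :: real)) \<partial>lborel) < \<infinity>"
    by simp
  then show "integrable lborel (\<lambda>x. indicator {0..} x * (1 / (1 + x\<^sup>2)) :: real)"
    by (intro integrableI_bounded) measurable
  show "AE c in lborel. norm (indicator {0<..} c * slope_density k c) \<le> norm (indicator {0..} c * (1 / (1 + c\<^sup>2)) :: real)"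
  proof (intro always_eventually allI)
    fix c :: real
    show "norm (indicator {0<..} c * slope_density k c) \<le> norm (indicator {0..} c * (1 / (1 + c\<^sup>2)))"
    proof (cases "c > 0")
      case True
      have "c \<le> sqrt (1 + c\<^sup>2)" by (rule real_le_rsqrt) simp
      then have "c ^ k \<le> sqrt (1 + c\<^sup>2) ^ k" using True by (intro power_mono) auto
      moreover have "sqrt (1 + c\<^sup>2) ^ (k + 2) = sqrt (1 + c\<^sup>2) ^ k * (1 + c\<^sup>2)"
        by (simp add: power_add)
      moreover have "1 + c\<^sup>2 > 0" "sqrt (1 + c\<^sup>2) ^ k > 0" by (auto simp: add_pos_nonneg)
      ultimately have "slope_density k c = (c ^ k / sqrt (1 + c\<^sup>2) ^ k) / (1 + c\<^sup>2)"
        and "c ^ k / sqrt (1 + c\<^sup>2) ^ k \<le> 1"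
        unfolding slope_density_def by (simp_all only: divide_divide_eq_left divide_le_eq_1_pos)
      then have "slope_density k c \<le> 1 / (1 + c\<^sup>2)"
        using divide_right_mono[of "c ^ k / sqrt (1 + c\<^sup>2) ^ k" 1 "1 + c\<^sup>2"] by (simp add: add_nonneg_nonneg)
      then show ?thesis using True slope_density_pos[OF True, of k] by simp
    qed simp
  qed
qed measurable

section \<open>Slope coordinates on a hemisphere\<close>

text \<open>For a unit vector w and x \<bullet> w > 0 this is the tangent of the angle between x and
  w: invariant under dilations, and multiplied by c under \<open>stretch w c\<close>.\<close>

definition slope :: "'a::real_inner \<Rightarrow> 'a \<Rightarrow> real" where
  "slope w x = norm (x - (x \<bullet> w) *\<^sub>R w) / (x \<bullet> w)"

lemma slope_measurable [measurable]: "slope (w::'a::euclidean_space) \<in> borel_measurable borel"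
  unfolding slope_def by measurable

lemma stretch_inner: "norm w = 1 \<Longrightarrow> stretch w c x \<bullet> w = x \<bullet> w"
  by (simp add: stretch_def inner_add_left dot_square_norm algebra_simps)

lemma stretch_perp: "norm w = 1 \<Longrightarrow> stretch w c x - (stretch w c x \<bullet> w) *\<^sub>R w = c *\<^sub>R (x - (x \<bullet> w) *\<^sub>R w)"
  by (simp add: stretch_inner) (simp add: stretch_def algebra_simps)

lemma slope_stretch: "norm w = 1 \<Longrightarrow> c > 0 \<Longrightarrow> slope w (stretch w c x) = c * slope w x"
  unfolding slope_def stretch_perp by (simp add: stretch_inner)

lemma stretch_stretch: "norm w = 1 \<Longrightarrow> stretch w c (stretch w d x) = stretch w (c * d) x"
  unfolding stretch_def[of w c] stretch_inner by (simp add: stretch_def algebra_simps)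

lemma stretch_one: "stretch w 1 x = x" by (simp add: stretch_def)

lemma slope_scaleR: "c > 0 \<Longrightarrow> slope w (c *\<^sub>R x) = slope w x"
proof -
  assume "c > 0"
  have "c *\<^sub>R x - (c *\<^sub>R x \<bullet> w) *\<^sub>R w = c *\<^sub>R (x - (x \<bullet> w) *\<^sub>R w)" by (simp add: algebra_simps)
  then show ?thesis unfolding slope_def using \<open>c > 0\<close> by simp
qed

lemma norm_eq_slope:
  assumes "norm w = 1" "x \<bullet> w > 0"
  shows "norm x = (x \<bullet> w) * sqrt (1 + (slope w x)\<^sup>2)"
proof -
  have o: "orthogonal ((x \<bullet> w) *\<^sub>R w) (x - (x \<bullet> w) *\<^sub>R w)"
    using assms(1) by (simp add: orthogonal_def inner_diff_right dot_square_norm inner_commute power2_eq_square)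
  have "(norm x)\<^sup>2 = (x \<bullet> w)\<^sup>2 + (norm (x - (x \<bullet> w) *\<^sub>R w))\<^sup>2"
    using norm_add_Pythagorean[OF o] assms(1) by simp
  also have "\<dots> = (x \<bullet> w)\<^sup>2 * (1 + (slope w x)\<^sup>2)"
    using assms(2) by (simp add: slope_def power_divide distrib_left)
  finally have "sqrt ((norm x)\<^sup>2) = sqrt ((x \<bullet> w)\<^sup>2 * (1 + (slope w x)\<^sup>2))" by simp
  then show ?thesis using assms(2) by (simp add: real_sqrt_mult)
qed

lemma AE_not_hyperplane:
  assumes "v \<noteq> (0::'a::euclidean_space)"
  shows "AE x in lborel. v \<bullet> x \<noteq> 0"
proof -
  have n: "negligible {x. v \<bullet> x = 0}" using assms by (simp add: negligible_hyperplane)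
  have "{x. v \<bullet> x = 0} \<in> sets borel" by (simp add: closed_hyperplane)
  then have "{x. v \<bullet> x = 0} \<in> null_sets lborel"
    using n by (simp add: negligible_iff_null_sets null_sets_completion_iff)
  then have "AE x in lborel. x \<notin> {x. v \<bullet> x = 0}" by (rule AE_not_in)
  then show ?thesis by simp
qed

text \<open>Points of the axis are fixed by all stretches, so the normalisation of the flow fails
  there. In dimension at least 2 the axis lies in a hyperplane, hence is a null set.\<close>

lemma AE_perp_nonzero:
  assumes "DIM('a::euclidean_space) \<ge> 2"
  shows "AE x in lborel. x - (x \<bullet> w) *\<^sub>R w \<noteq> (0::'a)"
proof -
  obtain v where v: "v \<noteq> 0" "orthogonal w v" using orthogonal_to_vector_exists[OF assms] by blast
  show ?thesis using AE_not_hyperplane[OF v(1)]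
  proof eventually_elim
    case (elim x)
    show ?case
    proof
      assume "x - (x \<bullet> w) *\<^sub>R w = 0"
      then have "x = (x \<bullet> w) *\<^sub>R w" by simp
      then have "v \<bullet> x = (x \<bullet> w) * (v \<bullet> w)" by (metis inner_scaleR_right)
      then show False using elim v(2) by (simp add: orthogonal_def inner_commute)
    qed
  qed
qed

text \<open>
  The product of the weights 1/s (for the dilations) and 1/t (for the stretches across the axis),
  together with the factor that remains from the radial integration over the unit ball.
\<close>

definition cell_weight :: "nat \<Rightarrow> 'a::real_inner \<Rightarrow> 'a \<Rightarrow> real" where
  "cell_weight k w x = (if x \<bullet> w \<ge> 1 \<and> slope w x \<ge> 1
     then 1 / (x \<bullet> w) ^ (k + 3) / slope w x ^ (k + 1) / (k + 2) else 0)"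

lemma cell_weight_measurable [measurable]: "cell_weight k (w::'a::euclidean_space) \<in> borel_measurable borel"
  unfolding cell_weight_def by measurable

text \<open>Two applications of \<open>nn_integral_flow\<close>. The dilations, weighted by 1/s with
  s = x \<bullet> w, integrate out the radius and leave (1/|x|)^n / n. The stretches, weighted by
  the inverse slope, then spread the rest over orbits, along which |x| = s sqrt (1 + slope^2). The
  outer weight does not depend on C or \<phi>, so cells can be compared orbit by orbit.\<close>

lemma cell_formula:
  fixes w :: "real^'n" and \<phi> :: "real \<Rightarrow> real"
  assumes n: "CARD('n) = k + 2" and w: "norm w = 1"
    and C[measurable]: "C \<in> sets borel" and Cpos: "\<And>x. x \<in> C \<Longrightarrow> x \<bullet> w > 0"
    and cone: "\<And>x c. x \<in> C \<Longrightarrow> c > 0 \<Longrightarrow> c *\<^sub>R x \<in> C"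
    and [measurable]: "\<phi> \<in> borel_measurable borel" and nn: "\<And>t. 0 \<le> \<phi> t"
  shows "(\<integral>\<^sup>+x. indicator (cball 0 1 \<inter> C) x * ennreal (\<phi> (slope w x)) \<partial>lborel)
    = (\<integral>\<^sup>+x. ennreal (cell_weight k w x) *
        (\<integral>\<^sup>+c. indicator {c. 0 < c \<and> stretch w c x \<in> C} c * ennreal (\<phi> (c * slope w x) * slope_density k (c * slope w x)) \<partial>lborel) \<partial>lborel)"
proof -
  have [measurable]: "cball (0::real^'n) 1 \<in> sets borel" by simp
  have Ccone: "c *\<^sub>R x \<in> C \<longleftrightarrow> x \<in> C" if "c > 0" for c x
    using cone[of x c] cone[of "c *\<^sub>R x" "1/c"] that by auto
  let ?f = "\<lambda>x. indicator (cball 0 1 \<inter> C) x * ennreal (\<phi> (slope w x))"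
  let ?e1 = "\<lambda>x::real^'n. ennreal (if x \<bullet> w \<ge> 1 then 1 / (x \<bullet> w) else 0)"
  let ?e2 = "\<lambda>x::real^'n. ennreal (if slope w x \<ge> 1 then 1 / slope w x else 0)"
  let ?H = "\<lambda>x. ?e1 x * (indicator C x * ennreal (\<phi> (slope w x) * ((1 / norm x) ^ (k + 2) / (k + 2))))"
  have "(\<integral>\<^sup>+x. ?f x \<partial>lborel) = (\<integral>\<^sup>+x. ?e1 x * (\<integral>\<^sup>+c. indicator {0<..} c * (?f (c *\<^sub>R x) * ennreal (c ^ (k + 1))) \<partial>lborel) \<partial>lborel)"
  proof (rule nn_integral_flow[where T = "\<lambda>c x. c *\<^sub>R x" and k = "k + 1"])
    show "(\<integral>\<^sup>+x. g x \<partial>lborel) = ennreal (c ^ Suc (k + 1)) * (\<integral>\<^sup>+x. g (c *\<^sub>R x) \<partial>lborel)"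
      if "c > 0" "g \<in> borel_measurable borel" for c and g :: "real^'n \<Rightarrow> ennreal"
      using nn_integral_scaleR[OF that] n by simp
    show "AE x in lborel. ?f x \<noteq> 0 \<longrightarrow>
      (\<integral>\<^sup>+c. indicator {0<..} c * (?e1 ((1 / c) *\<^sub>R x) * ennreal (1 / c)) \<partial>lborel) = 1"
    proof (intro always_eventually allI impI)
      fix x assume "?f x \<noteq> 0"
      then have "x \<in> C" by (auto simp: indicator_def split: if_splits)
      then have "x \<bullet> w > 0" by (rule Cpos)
      from nn_integral_flow_weight[OF this]
      show "(\<integral>\<^sup>+c. indicator {0<..} c * (?e1 ((1 / c) *\<^sub>R x) * ennreal (1 / c)) \<partial>lborel) = 1"
        by (simp cong: if_cong)
    qed
    show "?f \<in> borel_measurable borel" by measurable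
    show "?e1 \<in> borel_measurable borel" by measurable
    show "(\<lambda>p::real \<times> (real^'n). fst p *\<^sub>R snd p) \<in> borel_measurable (borel \<Otimes>\<^sub>M borel)" by measurable
  qed simp
  also have "\<dots> = (\<integral>\<^sup>+x. ?H x \<partial>lborel)"
  proof (rule nn_integral_cong)
    fix x :: "real^'n"
    have "(\<integral>\<^sup>+c. indicator {0<..} c * (?f (c *\<^sub>R x) * ennreal (c ^ (k + 1))) \<partial>lborel)
      = indicator C x * ennreal (\<phi> (slope w x) * ((1 / norm x) ^ (k + 2) / (k + 2)))"
    proof (cases "x \<in> C")
      case True
      then have x0: "norm x > 0" using Cpos[of x] by auto
      have "(\<integral>\<^sup>+c. indicator {0<..} c * (?f (c *\<^sub>R x) * ennreal (c ^ (k + 1))) \<partial>lborel)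
        = (\<integral>\<^sup>+c. ennreal (\<phi> (slope w x)) * (indicator {0<..} c * (indicator {..1 / norm x} c * ennreal (c ^ (k + 1)))) \<partial>lborel)"
      proof (rule nn_integral_cong)
        fix c :: real
        have "c \<le> 1 / norm x \<longleftrightarrow> c * norm x \<le> 1" using x0 by (simp add: field_simps)
        then show "indicator {0<..} c * (?f (c *\<^sub>R x) * ennreal (c ^ (k + 1)))
          = ennreal (\<phi> (slope w x)) * (indicator {0<..} c * (indicator {..1 / norm x} c * ennreal (c ^ (k + 1))))"
          using True by (cases "c > 0") (auto simp: indicator_def Ccone slope_scaleR mult_ac)
      qed
      also have "\<dots> = ennreal (\<phi> (slope w x)) * ennreal ((1 / norm x) ^ Suc (k + 1) / Suc (k + 1))"
        by (subst nn_integral_cmult) (measurable, subst nn_integral_power_Ioc, auto)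
      also have "\<dots> = ennreal (\<phi> (slope w x) * ((1 / norm x) ^ (k + 2) / (k + 2)))"
        using nn by (subst ennreal_mult[symmetric]) (auto simp: add_ac)
      finally show ?thesis using True by simp
    next
      case False
      then have z: "indicator {0<..} c * (?f (c *\<^sub>R x) * ennreal (c ^ (k + 1))) = 0" for c
        by (cases "c > 0") (auto simp: Ccone)
      show ?thesis unfolding z using False by simp
    qed
    then show "?e1 x * (\<integral>\<^sup>+c. indicator {0<..} c * (?f (c *\<^sub>R x) * ennreal (c ^ (k + 1))) \<partial>lborel) = ?H x"
      by simp
  qed
  also have "\<dots> = (\<integral>\<^sup>+x. ?e2 x * (\<integral>\<^sup>+c. indicator {0<..} c * (?H (stretch w c x) * ennreal (c ^ k)) \<partial>lborel) \<partial>lborel)"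
  proof (rule nn_integral_flow)
    show "(\<integral>\<^sup>+x. g x \<partial>lborel) = ennreal (c ^ Suc k) * (\<integral>\<^sup>+x. g (stretch w c x) \<partial>lborel)"
      if "c > 0" "g \<in> borel_measurable borel" for c and g :: "real^'n \<Rightarrow> ennreal"
      using nn_integral_stretch[OF that(1) w that(2)] n by simp
    show "stretch w (1 / c) (stretch w c x) = x" if "c > 0" for c x
      using that by (simp add: stretch_stretch[OF w] stretch_one)
    have "AE x in lborel. x - (x \<bullet> w) *\<^sub>R w \<noteq> 0" by (rule AE_perp_nonzero) (simp add: n)
    then show "AE x in lborel. ?H x \<noteq> 0 \<longrightarrow>
      (\<integral>\<^sup>+c. indicator {0<..} c * (?e2 (stretch w (1 / c) x) * ennreal (1 / c)) \<partial>lborel) = 1"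
    proof eventually_elim
      case (elim x)
      show ?case
      proof
        assume "?H x \<noteq> 0"
        then have "x \<in> C" by (auto simp: indicator_def split: if_splits)
        then have "x \<bullet> w > 0" by (rule Cpos)
        then have "slope w x > 0" using elim by (simp add: slope_def)
        from nn_integral_flow_weight[OF this]
        have "(\<integral>\<^sup>+c. indicator {0<..} c * (ennreal (if slope w x / c \<ge> 1 then 1 / (slope w x / c) else 0) * ennreal (1 / c)) \<partial>lborel) = 1" .
        moreover have "indicator {0<..} c * (?e2 (stretch w (1 / c) x) * ennreal (1 / c))
          = indicator {0<..} c * (ennreal (if slope w x / c \<ge> 1 then 1 / (slope w x / c) else 0) * ennreal (1 / c))" for c
          by (cases "c > 0") (simp_all add: slope_stretch[OF w])
        ultimately show "(\<integral>\<^sup>+c. indicator {0<..} c * (?e2 (stretch w (1 / c) x) * ennreal (1 / c)) \<partial>lborel) = 1"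
          by simp
      qed
    qed
    show "?H \<in> borel_measurable borel" by measurable
    show "?e2 \<in> borel_measurable borel" by measurable
  qed (rule stretch_measurable)
  also have "\<dots> = (\<integral>\<^sup>+x. ennreal (cell_weight k w x) *
        (\<integral>\<^sup>+c. indicator {c. 0 < c \<and> stretch w c x \<in> C} c * ennreal (\<phi> (c * slope w x) * slope_density k (c * slope w x)) \<partial>lborel) \<partial>lborel)"
  proof (rule nn_integral_cong)
    fix x :: "real^'n"
    let ?s = "x \<bullet> w" and ?t = "slope w x"
    show "?e2 x * (\<integral>\<^sup>+c. indicator {0<..} c * (?H (stretch w c x) * ennreal (c ^ k)) \<partial>lborel)
       = ennreal (cell_weight k w x) *
        (\<integral>\<^sup>+c. indicator {c. 0 < c \<and> stretch w c x \<in> C} c * ennreal (\<phi> (c * ?t) * slope_density k (c * ?t)) \<partial>lborel)"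
    proof (cases "?s \<ge> 1 \<and> ?t \<ge> 1")
      case True
      \<comment> \<open>Everything that does not depend on c: the powers of s come from the weight
        and from |x|^(k+2), and the power of t from c^k = (c t)^k / t^k.\<close>
      let ?m = "1 / ?s ^ (k + 3) / ?t ^ k / (k + 2)"
      have m0: "?m \<ge> 0" using True by simp
      have e2: "?e2 x = ennreal (1 / ?t)" using True by simp
      have em: "ennreal (1 / ?t * ?m) = ennreal (1 / ?t) * ennreal ?m"
        using True m0 by (intro ennreal_mult) auto
      have "indicator {0<..} c * (?H (stretch w c x) * ennreal (c ^ k))
        = ennreal ?m * (indicator {c. 0 < c \<and> stretch w c x \<in> C} c * ennreal (\<phi> (c * ?t) * slope_density k (c * ?t)))" for c
      proof (cases "c > 0 \<and> stretch w c x \<in> C")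
        case c: True
        have N: "norm (stretch w c x) = ?s * sqrt (1 + (c * ?t)\<^sup>2)"
          using norm_eq_slope[OF w, of "stretch w c x"] True c by (simp add: stretch_inner[OF w] slope_stretch[OF w])
        let ?r = "sqrt (1 + (c * ?t)\<^sup>2)"
        have r: "?r > 0" by (rule sqrt_one_plus_pos)
        have "1 / ?s * (\<phi> (c * ?t) * ((1 / (?s * ?r)) ^ (k + 2) / (k + 2))) * c ^ k
          = ?m * (\<phi> (c * ?t) * slope_density k (c * ?t))"
        proof -
          have e: "?s ^ (k + 3) = ?s * ?s ^ (k + 2)" by (simp add: numeral_3_eq_3)
          have "1 / ?s * (p * (1 / (S * R) / (k + 2))) * C = 1 / (?s * S) / T / (k + 2) * (p * (C * T / R))"
            if "S > 0" "R > 0" "T > 0" for p S R T C :: real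
            using that True by (simp add: divide_simps)
          from this[of "?s ^ (k + 2)" "?r ^ (k + 2)" "?t ^ k" "\<phi> (c * ?t)" "c ^ k"] r True
          show ?thesis unfolding slope_density_def e power_one_over power_mult_distrib by simp
        qed
        then have "ennreal (1 / ?s) * ennreal (\<phi> (c * ?t) * ((1 / (?s * ?r)) ^ (k + 2) / (k + 2))) * ennreal (c ^ k)
          = ennreal ?m * ennreal (\<phi> (c * ?t) * slope_density k (c * ?t))"
          using True c nn r m0 by (simp only: ennreal_mult'[symmetric] ennreal_mult''[symmetric]) (simp add: ennreal_mult[symmetric] slope_density_pos less_imp_le)
        then show ?thesis using True c by (simp add: stretch_inner[OF w] slope_stretch[OF w] N mult.assoc)
      qed (auto simp: indicator_def)
      then have "(\<integral>\<^sup>+c. indicator {0<..} c * (?H (stretch w c x) * ennreal (c ^ k)) \<partial>lborel)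
        = (\<integral>\<^sup>+c. ennreal ?m * (indicator {c. 0 < c \<and> stretch w c x \<in> C} c * ennreal (\<phi> (c * ?t) * slope_density k (c * ?t))) \<partial>lborel)"
        by simp
      also have "\<dots> = ennreal ?m * (\<integral>\<^sup>+c. indicator {c. 0 < c \<and> stretch w c x \<in> C} c * ennreal (\<phi> (c * ?t) * slope_density k (c * ?t)) \<partial>lborel)"
      proof (rule nn_integral_cmult)
        have "(\<lambda>c. stretch w c x) \<in> borel_measurable borel" unfolding stretch_def by measurable
        then have [measurable]: "{c. 0 < c \<and> stretch w c x \<in> C} \<in> sets borel" by measurable
        show "(\<lambda>c. indicator {c. 0 < c \<and> stretch w c x \<in> C} c * ennreal (\<phi> (c * ?t) * slope_density k (c * ?t))) \<in> borel_measurable lborel"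
          by measurable
      qed
      also have "?e2 x * (ennreal ?m * (\<integral>\<^sup>+c. indicator {c. 0 < c \<and> stretch w c x \<in> C} c * ennreal (\<phi> (c * ?t) * slope_density k (c * ?t)) \<partial>lborel))
        = ennreal (1 / ?t * ?m) * (\<integral>\<^sup>+c. indicator {c. 0 < c \<and> stretch w c x \<in> C} c * ennreal (\<phi> (c * ?t) * slope_density k (c * ?t)) \<partial>lborel)"
        unfolding e2 em by (rule mult.assoc[symmetric])
      also have "1 / ?t * ?m = cell_weight k w x" using True by (simp add: cell_weight_def)
      finally show ?thesis .
    next
      case False
      then consider "\<not> ?s \<ge> 1" | "\<not> ?t \<ge> 1" by blast
      then show ?thesis
      proof cases
        case 1
        then have z: "?H (stretch w c x) = 0" for c by (simp add: stretch_inner[OF w])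
        show ?thesis unfolding z using 1 by (simp add: cell_weight_def)
      next
        case 2
        then show ?thesis by (simp add: cell_weight_def)
      qed
    qed
  qed
  finally show ?thesis .
qed

section \<open>Comparison of a star-shaped cell with the whole hemisphere\<close>

text \<open>The mean of g (slope w x) over the hemisphere around w in dimension k + 2.\<close>

definition slope_mean :: "nat \<Rightarrow> (real \<Rightarrow> real) \<Rightarrow> real" where
  "slope_mean k g = (\<integral>c. indicator {0<..} c * (g c * slope_density k c) \<partial>lborel) / (\<integral>c. indicator {0<..} c * slope_density k c \<partial>lborel)"

lemma slope_density_integral_pos: "(\<integral>c. indicator {0<..} c * slope_density k c \<partial>lborel) > 0"
proof (rule integral_pos_open[where U = "{0<..}"])
  show "0 \<le> indicator {0<..} x * slope_density k x" for x by (cases "x > 0") (auto simp: slope_density_pos less_imp_le)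
qed (auto simp: slope_density_pos slope_density_integrable intro: exI[of _ "1::real"])

text \<open>Decreasing in the slope means increasing in the cosine u \<bullet> w: g stands for the
  function G of the overview in terms of the tangent of the angle.\<close>

locale slope_profile =
  fixes g :: "real \<Rightarrow> real" and M :: real
  assumes g_meas[measurable]: "g \<in> borel_measurable borel"
    and g_anti: "\<And>c c'. 0 < c \<Longrightarrow> c \<le> c' \<Longrightarrow> g c' \<le> g c"
    and g_nonneg: "\<And>c. 0 \<le> g c" and g_le: "\<And>c. g c \<le> M"
begin

lemma slope_mean_nonneg: "slope_mean k g \<ge> 0"
  unfolding slope_mean_def
proof (rule divide_nonneg_nonneg)
  show "(\<integral>c. indicator {0<..} c * (g c * slope_density k c) \<partial>lborel) \<ge> 0"
  proof (intro integral_nonneg_AE always_eventually allI)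
    fix c show "0 \<le> indicator {0<..} c * (g c * slope_density k c)"
      using g_nonneg slope_density_pos[of c k] by (cases "c > 0") auto
  qed
qed (use slope_density_integral_pos[of k] in simp)

text \<open>\<open>down_closed_integral\<close> after the substitution c t for c. It multiplies
  numerator and denominator of the mean by the same factor, so one value \<Gamma> serves all
  orbits.\<close>

lemma ray_compare:
  fixes t :: real and k :: nat
  assumes t: "t > 0" and [measurable]: "D \<in> sets borel" and dcD: "down_closed D"
  defines "J \<equiv> \<lambda>\<phi>::real \<Rightarrow> real. \<integral>\<^sup>+c. indicator D c * ennreal (\<phi> (c * t) * slope_density k (c * t)) \<partial>lborel"
  shows "ennreal (slope_mean k g) * J (\<lambda>_. 1) \<le> J g"
    and "D = {0<..} \<Longrightarrow> ennreal (slope_mean k g) * J (\<lambda>_. 1) = J g"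
    and "\<forall>c>0. \<forall>c'>c. g c' < g c \<Longrightarrow> c0 \<in> D \<Longrightarrow> c1 > 0 \<Longrightarrow> c1 \<notin> D \<Longrightarrow>
      ennreal (slope_mean k g) * J (\<lambda>_. 1) < J g"
proof -
  let ?\<Gamma> = "slope_mean k g"
  let ?g = "\<lambda>c. g (c * t)" and ?q = "\<lambda>c. slope_density k (c * t)"
  have sub: "(\<integral>c. indicator {0<..} c * f c \<partial>lborel) = t * (\<integral>c. indicator {0<..} c * f (c * t) \<partial>lborel)" for f :: "real \<Rightarrow> real"
  proof -
    have "(indicator {0<..} (t * c) :: real) = indicator {0<..} c" for c using t by (simp add: indicator_def zero_less_mult_iff)
    then show ?thesis
      using lborel_integral_real_affine[of t "\<lambda>c. indicator {0<..} c * f c" 0] t by (simp add: mult.commute)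
  qed
  have intq: "integrable lborel (\<lambda>c. indicator {0<..} c * ?q c)"
  proof -
    have "(indicator {0<..} (t * c) :: real) = indicator {0<..} c" for c using t by (simp add: indicator_def zero_less_mult_iff)
    then show ?thesis
      using lborel_integrable_real_affine[OF slope_density_integrable[of k], of t 0] t by (simp add: mult.commute)
  qed
  have "(\<integral>c. indicator {0<..} c * (g c * slope_density k c) \<partial>lborel) = ?\<Gamma> * (\<integral>c. indicator {0<..} c * slope_density k c \<partial>lborel)"
    using slope_density_integral_pos[of k] by (simp add: slope_mean_def)
  then have "t * (\<integral>c. indicator {0<..} c * (?g c * ?q c) \<partial>lborel) = t * (?\<Gamma> * (\<integral>c. indicator {0<..} c * ?q c \<partial>lborel))"
    unfolding sub[of "\<lambda>c. g c * slope_density k c"] sub[of "slope_density k"] by simp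
  then have tot: "(\<integral>c. indicator {0<..} c * (?g c * ?q c) \<partial>lborel) = ?\<Gamma> * (\<integral>c. indicator {0<..} c * ?q c \<partial>lborel)"
    using t by simp
  have D: "D \<subseteq> {0<..}" using dcD by (simp add: down_closed_def)
  have anti: "\<forall>c>0. \<forall>c'\<ge>c. ?g c' \<le> ?g c" using t by (auto intro!: g_anti)
  have bd: "\<forall>c. 0 \<le> ?g c \<and> ?g c \<le> M" using g_nonneg g_le by blast
  have qpos: "?q c > 0" if "c > 0" for c using that t by (intro slope_density_pos) auto
  then have qpos': "\<forall>c>0. ?q c > 0" by blast
  have "?g \<in> borel_measurable borel" "?q \<in> borel_measurable borel" by measurable
  note dc = down_closed_integral[OF assms(2) this dcD qpos' intq anti bd tot]
  have i1: "integrable lborel (\<lambda>c. indicator D c * (?g c * ?q c))" by (rule dc(1))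
  have i2: "integrable lborel (\<lambda>c. indicator D c * ?q c)" by (rule dc(2))
  have qn: "indicator D c * ?q c \<ge> 0" for c using qpos[of c] D by (cases "c \<in> D") (auto simp: less_imp_le)
  have gqn: "indicator D c * (?g c * ?q c) \<ge> 0" for c
    using qpos[of c] g_nonneg[of "c * t"] D by (cases "c \<in> D") (auto simp: less_imp_le)
  have Jg: "J g = ennreal (\<integral>c. indicator D c * (?g c * ?q c) \<partial>lborel)"
    using nn_integral_eq_integral[OF i1] gqn unfolding J_def
    by (simp add: ennreal_indicator[symmetric] ennreal_mult'[symmetric])
  have J1: "J (\<lambda>_. 1) = ennreal (\<integral>c. indicator D c * ?q c \<partial>lborel)"
    using nn_integral_eq_integral[OF i2] qn unfolding J_def
    by (simp add: ennreal_indicator[symmetric] ennreal_mult'[symmetric])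
  have i0: "(\<integral>c. indicator D c * ?q c \<partial>lborel) \<ge> 0" using qn by (intro integral_nonneg_AE) simp
  have J1': "ennreal ?\<Gamma> * J (\<lambda>_. 1) = ennreal (?\<Gamma> * (\<integral>c. indicator D c * ?q c \<partial>lborel))"
    unfolding J1 using i0 slope_mean_nonneg by (simp add: ennreal_mult)
  show "ennreal ?\<Gamma> * J (\<lambda>_. 1) \<le> J g"
    unfolding J1' Jg by (intro ennreal_leI dc(3))
  show "ennreal ?\<Gamma> * J (\<lambda>_. 1) = J g" if "D = {0<..}"
    unfolding J1' Jg that tot ..
  assume st: "\<forall>c>0. \<forall>c'>c. g c' < g c" and c: "c0 \<in> D" "c1 > 0" "c1 \<notin> D"
  have "?\<Gamma> * (\<integral>c. indicator D c * ?q c \<partial>lborel) < (\<integral>c. indicator D c * (?g c * ?q c) \<partial>lborel)"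
  proof (rule dc(4)[OF _ c])
    show "\<forall>c>0. \<forall>c'>c. ?g c' < ?g c" using st t by auto
  qed
  then show "ennreal ?\<Gamma> * J (\<lambda>_. 1) < J g"
    unfolding J1' Jg using mult_nonneg_nonneg[OF slope_mean_nonneg[of k] i0]
    by (intro ennreal_lessI) (linarith, assumption)
qed

text \<open>\<open>cell_formula\<close> writes both sides as integrals over the same orbits with the
  same weight. A full hemisphere contains its orbits entirely, hence equality there. Strictness
  needs an open set of positive weight whose orbits both meet C and leave it.\<close>

lemma cell_compare:
  fixes w :: "real^'n"
  assumes n: "CARD('n) = k + 2" and w: "norm w = 1"
    and C[measurable]: "C \<in> sets borel" and Cpos: "\<And>x. x \<in> C \<Longrightarrow> x \<bullet> w > 0"
    and cone: "\<And>x c. x \<in> C \<Longrightarrow> c > 0 \<Longrightarrow> c *\<^sub>R x \<in> C"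
    and star: "\<And>x c. x \<in> C \<Longrightarrow> 0 < c \<Longrightarrow> c \<le> 1 \<Longrightarrow> stretch w c x \<in> C"
  defines "I \<equiv> \<integral>\<^sup>+x. indicator (cball 0 1 \<inter> C) x * ennreal (g (slope w x)) \<partial>lborel"
  shows "ennreal (slope_mean k g) * emeasure lborel (cball 0 1 \<inter> C) \<le> I"
    and "C = {x. x \<bullet> w > 0} \<Longrightarrow> ennreal (slope_mean k g) * emeasure lborel (cball 0 1 \<inter> C) = I"
    and "\<forall>c>0. \<forall>c'>c. g c' < g c \<Longrightarrow> open U \<Longrightarrow> U \<noteq> {} \<Longrightarrow>
      (\<And>x. x \<in> U \<Longrightarrow> x \<bullet> w \<ge> 1 \<and> slope w x \<ge> 1 \<and> (\<exists>c>0. stretch w c x \<in> C) \<and> (\<exists>c>0. stretch w c x \<notin> C)) \<Longrightarrow>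
      ennreal (slope_mean k g) * emeasure lborel (cball 0 1 \<inter> C) < I"
proof -
  let ?\<Gamma> = "slope_mean k g"
  define D where "D x = {c. 0 < c \<and> stretch w c x \<in> C}" for x
  define J where "J \<phi> x = (\<integral>\<^sup>+c. indicator (D x) c * ennreal (\<phi> (c * slope w x) * slope_density k (c * slope w x)) \<partial>lborel)"
    for \<phi> :: "real \<Rightarrow> real" and x
  have [measurable]: "cball (0::real^'n) 1 \<in> sets borel" by simp
  have [measurable]: "D x \<in> sets borel" for x
  proof -
    have "(\<lambda>c. stretch w c x) \<in> borel_measurable borel" unfolding stretch_def by measurable
    then show ?thesis unfolding D_def by measurable
  qed
  have Jm: "J \<phi> \<in> borel_measurable borel" if [measurable]: "\<phi> \<in> borel_measurable borel" for \<phi>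
  proof -
    have [measurable]: "(\<lambda>p. stretch w (snd p) (fst p)) \<in> borel_measurable (borel \<Otimes>\<^sub>M borel)"
      unfolding stretch_def by measurable
    have *: "indicator (D x) c = (indicator {0<..} c * indicator C (stretch w c x) :: ennreal)" for x c
      by (auto simp: D_def indicator_def)
    show ?thesis unfolding J_def * by measurable
  qed
  have Dm: "D x \<in> sets borel" for x by measurable
  have Ddown: "down_closed (D x)" for x
    unfolding down_closed_def
  proof (intro conjI ballI allI impI)
    fix c c' assume "c \<in> D x" "0 < c'" "c' \<le> c"
    then show "c' \<in> D x"
      using star[of "stretch w c x" "c' / c"] by (simp add: D_def stretch_stretch[OF w])
  qed (auto simp: D_def)
  have Ig: "I = (\<integral>\<^sup>+x. ennreal (cell_weight k w x) * J g x \<partial>lborel)"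
    unfolding I_def J_def D_def by (rule cell_formula[OF n w C Cpos cone]) (auto simp: g_nonneg)
  have E: "emeasure lborel (cball 0 1 \<inter> C) = (\<integral>\<^sup>+x. ennreal (cell_weight k w x) * J (\<lambda>_. 1) x \<partial>lborel)"
  proof -
    have "emeasure lborel (cball 0 1 \<inter> C) = (\<integral>\<^sup>+x. indicator (cball 0 1 \<inter> C) x * ennreal 1 \<partial>lborel)"
      by simp
    also have "\<dots> = (\<integral>\<^sup>+x. ennreal (cell_weight k w x) * J (\<lambda>_. 1) x \<partial>lborel)"
      unfolding J_def D_def by (rule cell_formula[OF n w C Cpos cone]) auto
    finally show ?thesis .
  qed
  have E': "ennreal ?\<Gamma> * emeasure lborel (cball 0 1 \<inter> C)
      = (\<integral>\<^sup>+x. ennreal (cell_weight k w x) * (ennreal ?\<Gamma> * J (\<lambda>_. 1) x) \<partial>lborel)"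
  proof -
    have "(\<lambda>x. ennreal (cell_weight k w x) * J (\<lambda>_. 1) x) \<in> borel_measurable lborel"
      using Jm[of "\<lambda>_. 1"] by simp
    then show ?thesis unfolding E by (subst nn_integral_cmult[symmetric]) (auto simp: mult_ac)
  qed
  have le: "ennreal (cell_weight k w x) * (ennreal ?\<Gamma> * J (\<lambda>_. 1) x) \<le> ennreal (cell_weight k w x) * J g x" for x
  proof (cases "x \<bullet> w \<ge> 1 \<and> slope w x \<ge> 1")
    case True
    then have "slope w x > 0" by simp
    from ray_compare(1)[OF this Dm Ddown, of k x]
    show ?thesis unfolding J_def by (intro mult_left_mono) auto
  qed (auto simp: cell_weight_def)
  show "ennreal ?\<Gamma> * emeasure lborel (cball 0 1 \<inter> C) \<le> I"
    unfolding E' Ig by (intro nn_integral_mono le)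
  show "ennreal ?\<Gamma> * emeasure lborel (cball 0 1 \<inter> C) = I" if "C = {x. x \<bullet> w > 0}"
    unfolding E' Ig
  proof (rule nn_integral_cong)
    fix x
    show "ennreal (cell_weight k w x) * (ennreal ?\<Gamma> * J (\<lambda>_. 1) x) = ennreal (cell_weight k w x) * J g x"
    proof (cases "x \<bullet> w \<ge> 1 \<and> slope w x \<ge> 1")
      case True
      then have s: "slope w x > 0" by simp
      have "D x = {0<..}" using True by (auto simp: D_def that stretch_inner[OF w])
      from ray_compare(2)[OF s Dm Ddown this, of k]
      show ?thesis unfolding J_def by simp
    qed (auto simp: cell_weight_def)
  qed
  assume st: "\<forall>c>0. \<forall>c'>c. g c' < g c" and U: "open U" "U \<noteq> {}"
    and Ux: "\<And>x. x \<in> U \<Longrightarrow> x \<bullet> w \<ge> 1 \<and> slope w x \<ge> 1 \<and> (\<exists>c>0. stretch w c x \<in> C) \<and> (\<exists>c>0. stretch w c x \<notin> C)"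
  show "ennreal ?\<Gamma> * emeasure lborel (cball 0 1 \<inter> C) < I"
    unfolding E' Ig
  proof (rule nn_integral_less)
    show "(\<lambda>x. ennreal (cell_weight k w x) * (ennreal ?\<Gamma> * J (\<lambda>_. 1) x)) \<in> borel_measurable lborel"
      using Jm[of "\<lambda>_. 1"] by simp
    show "(\<lambda>x. ennreal (cell_weight k w x) * J g x) \<in> borel_measurable lborel"
      using Jm[OF g_meas] by simp
    have "emeasure lborel (cball 0 1 \<inter> C) \<le> emeasure lborel (cball (0::real^'n) 1)" by (intro emeasure_mono) auto
    also have "\<dots> < \<infinity>" by (rule emeasure_compact_finite) simp
    finally show "(\<integral>\<^sup>+x. ennreal (cell_weight k w x) * (ennreal ?\<Gamma> * J (\<lambda>_. 1) x) \<partial>lborel) \<noteq> \<infinity>"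
      unfolding E'[symmetric] by (simp add: ennreal_mult_eq_top_iff)
    show "AE x in lborel. ennreal (cell_weight k w x) * (ennreal ?\<Gamma> * J (\<lambda>_. 1) x) \<le> ennreal (cell_weight k w x) * J g x"
      using le by simp
    show "\<not> (AE x in lborel. ennreal (cell_weight k w x) * J g x \<le> ennreal (cell_weight k w x) * (ennreal ?\<Gamma> * J (\<lambda>_. 1) x))"
    proof (rule not_AE_open[OF U])
      fix x assume x: "x \<in> U"
      obtain c0 c1 where c: "c0 \<in> D x" "c1 > 0" "c1 \<notin> D x" using Ux[OF x] by (auto simp: D_def)
      have s: "x \<bullet> w \<ge> 1" "slope w x \<ge> 1" using Ux[OF x] by auto
      then have "slope w x > 0" by simp
      from ray_compare(3)[OF this Dm Ddown st c, of k]
      have "ennreal ?\<Gamma> * J (\<lambda>_. 1) x < J g x" unfolding J_def by simp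
      moreover have "cell_weight k w x > 0" using s by (auto simp: cell_weight_def)
      ultimately show "\<not> ennreal (cell_weight k w x) * J g x \<le> ennreal (cell_weight k w x) * (ennreal ?\<Gamma> * J (\<lambda>_. 1) x)"
        by (simp add: not_le ennreal_mult_strict_left_mono)
    qed
  qed
qed

end

section \<open>Voronoi cells of finitely many unit vectors\<close>

text \<open>Strict inequalities make the cells of a finite W open and disjoint; ties between
  distinct vectors of W only occur on finitely many hyperplanes.\<close>

definition voronoi_cell :: "'a::real_inner set \<Rightarrow> 'a \<Rightarrow> 'a set" where
  "voronoi_cell W w = {x. x \<bullet> w > 0 \<and> (\<forall>v\<in>W - {w}. x \<bullet> v < x \<bullet> w)}"

lemma unit_inner_less_1: "norm v = 1 \<Longrightarrow> norm w = 1 \<Longrightarrow> v \<noteq> w \<Longrightarrow> v \<bullet> w < (1::real)"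
  using norm_cauchy_schwarz[of v w] norm_cauchy_schwarz_eq[of v w] by (cases "v \<bullet> w = 1") auto

lemma open_voronoi_cell: "finite W \<Longrightarrow> open (voronoi_cell W (w::'a::euclidean_space))"
proof -
  assume W: "finite W"
  have "voronoi_cell W w = {x. x \<bullet> w > 0} \<inter> (\<Inter>v\<in>W - {w}. {x. x \<bullet> v < x \<bullet> w})"
    by (auto simp: voronoi_cell_def)
  then show ?thesis using W by (auto intro!: open_Int open_INT open_Collect_less continuous_intros)
qed

lemma voronoi_cell_disjoint: "v \<in> W \<Longrightarrow> w \<in> W \<Longrightarrow> v \<noteq> w \<Longrightarrow> voronoi_cell W v \<inter> voronoi_cell W w = {}"
proof -
  assume vw: "v \<in> W" "w \<in> W" "v \<noteq> w"
  have False if "x \<in> voronoi_cell W v" "x \<in> voronoi_cell W w" for x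
  proof -
    have "x \<bullet> w < x \<bullet> v" "x \<bullet> v < x \<bullet> w" using that vw by (auto simp: voronoi_cell_def)
    then show False by simp
  qed
  then show ?thesis by blast
qed

lemma voronoi_cell_scaleR: "x \<in> voronoi_cell W w \<Longrightarrow> c > 0 \<Longrightarrow> c *\<^sub>R x \<in> voronoi_cell W w"
  by (auto simp: voronoi_cell_def)

text \<open>For c \<le> 1 the stretch is c x plus a nonnegative multiple of w, and adding a multiple
  of w favours w over v because w \<bullet> v \<le> 1 = w \<bullet> w.\<close>

lemma voronoi_cell_stretch:
  assumes W: "\<And>v. v \<in> W \<Longrightarrow> norm v = 1" and w: "norm w = 1"
    and x: "x \<in> voronoi_cell W w" and c: "0 < c" "c \<le> 1"
  shows "stretch w c x \<in> voronoi_cell W w"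
proof -
  have "stretch w c x \<bullet> v < stretch w c x \<bullet> w" if v: "v \<in> W - {w}" for v
  proof -
    have "c * (x \<bullet> v) < c * (x \<bullet> w)" using x v c by (auto simp: voronoi_cell_def)
    moreover have "w \<bullet> v \<le> 1" using unit_inner_less_1[of w v] W w v by force
    then have "((1 - c) * (x \<bullet> w)) * (w \<bullet> v) \<le> ((1 - c) * (x \<bullet> w)) * 1"
      using x c by (intro mult_left_mono) (auto simp: voronoi_cell_def)
    ultimately show ?thesis unfolding stretch_inner[OF w] by (simp add: stretch_def inner_add_left algebra_simps)
  qed
  then show ?thesis using x by (auto simp: voronoi_cell_def stretch_inner[OF w])
qed

text \<open>Off finitely many hyperplanes the maximiser w of x \<bullet> w over W is unique and x
  \<bullet> w is not 0. It is not negative either: W, and hence 0 in its hull, lies in the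
  half-space of all y with x \<bullet> y \<le> x \<bullet> w.\<close>

lemma AE_voronoi_cover:
  assumes W: "finite W" "\<And>v. v \<in> W \<Longrightarrow> norm v = 1" "0 \<in> convex hull (W::'a::euclidean_space set)"
  shows "AE x in lborel. \<exists>w\<in>W. x \<in> voronoi_cell W w"
proof -
  have W0: "W \<noteq> {}" using W(3) by auto
  have 1: "AE x in lborel. \<forall>w\<in>W. w \<bullet> x \<noteq> 0"
    using W by (intro AE_finite_allI AE_not_hyperplane) force+
  have 2: "AE x in lborel. \<forall>p\<in>{p\<in>W \<times> W. fst p \<noteq> snd p}. (fst p - snd p) \<bullet> x \<noteq> 0"
    using W by (intro AE_finite_allI AE_not_hyperplane) auto
  show ?thesis using 1 2
  proof eventually_elim
    case (elim x)
    have fin: "finite ((\<lambda>w. x \<bullet> w) ` W)" "(\<lambda>w. x \<bullet> w) ` W \<noteq> {}" using W(1) W0 by auto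
    obtain w where w: "w \<in> W" "\<And>v. v \<in> W \<Longrightarrow> x \<bullet> v \<le> x \<bullet> w"
      using Max_in[OF fin] Max_ge[OF fin(1)] by (metis (no_types, lifting) imageE imageI)
    have "x \<bullet> w \<ge> 0"
    proof -
      have "convex hull W \<subseteq> {y. x \<bullet> y \<le> x \<bullet> w}"
        using w(2) by (intro hull_minimal convex_halfspace_le) auto
      then show ?thesis using W(3) by auto
    qed
    moreover have "x \<bullet> w \<noteq> 0" using elim(1) w(1) by (metis inner_commute)
    moreover have "x \<bullet> v < x \<bullet> w" if "v \<in> W - {w}" for v
    proof -
      have "(v, w) \<in> {p\<in>W \<times> W. fst p \<noteq> snd p}" using that w(1) by simp
      with elim(2) have "(v - w) \<bullet> x \<noteq> 0" by fastforce
      then show ?thesis using w(2)[of v] that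
        by (simp add: inner_diff_left inner_commute[of x] order_less_le)
    qed
    ultimately have "x \<in> voronoi_cell W w" unfolding voronoi_cell_def by simp
    then show ?case using w(1) by blast
  qed
qed

context slope_profile
begin

text \<open>Summation of the cell estimates. For strictness one cell suffices: a second vector w2
  other than -w1 cuts orbits of an open set of points in the hemisphere of w1.\<close>

lemma voronoi_bound:
  fixes W :: "(real^'n) set" and F :: "real^'n \<Rightarrow> ennreal"
  assumes n: "CARD('n) = k + 2" and W: "finite W" "\<And>v. v \<in> W \<Longrightarrow> norm v = 1" "0 \<in> convex hull W"
    and F: "\<And>w x. w \<in> W \<Longrightarrow> x \<bullet> w > 0 \<Longrightarrow> ennreal (g (slope w x)) \<le> F x" and [measurable]: "F \<in> borel_measurable borel"
  shows "ennreal (slope_mean k g) * emeasure lborel (cball (0::real^'n) 1) \<le> (\<integral>\<^sup>+x. indicator (cball 0 1) x * F x \<partial>lborel)"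
    and "\<forall>c>0. \<forall>c'>c. g c' < g c \<Longrightarrow> w1 \<in> W \<Longrightarrow> w2 \<in> W \<Longrightarrow> w2 \<noteq> w1 \<Longrightarrow> w2 \<noteq> - w1 \<Longrightarrow>
      ennreal (slope_mean k g) * emeasure lborel (cball (0::real^'n) 1) < (\<integral>\<^sup>+x. indicator (cball 0 1) x * F x \<partial>lborel)"
proof -
  let ?\<Gamma> = "slope_mean k g" and ?B = "cball (0::real^'n) 1"
  define C where "C = voronoi_cell W"
  have [measurable]: "?B \<in> sets borel" by simp
  have Cm[measurable]: "C w \<in> sets borel" for w unfolding C_def using open_voronoi_cell[OF W(1)] by auto
  have BC: "?B \<inter> C w \<in> sets lborel" for w unfolding sets_lborel by (intro sets.Int) measurable
  define e where "e w = emeasure lborel (?B \<inter> C w)" for w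
  define I where "I w = (\<integral>\<^sup>+x. indicator (?B \<inter> C w) x * ennreal (g (slope w x)) \<partial>lborel)" for w
  have Cpos: "x \<bullet> w > 0" if "x \<in> C w" for x w using that by (auto simp: C_def voronoi_cell_def)
  have cover: "AE x in lborel. \<exists>w\<in>W. x \<in> voronoi_cell W w"
    by (rule AE_voronoi_cover) (use W in auto)
  have sum_e: "emeasure lborel ?B = (\<Sum>w\<in>W. e w)"
  proof -
    have "emeasure lborel ?B = (\<integral>\<^sup>+x. indicator ?B x \<partial>lborel)" by simp
    also have "\<dots> = (\<integral>\<^sup>+x. (\<Sum>w\<in>W. indicator (?B \<inter> C w) x) \<partial>lborel)"
    proof (rule nn_integral_cong_AE)
      show "AE x in lborel. indicator ?B x = (\<Sum>w\<in>W. indicator (?B \<inter> C w) x :: ennreal)"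
        using cover
      proof eventually_elim
        case (elim x)
        then obtain w where w: "w \<in> W" "x \<in> C w" by (auto simp: C_def)
        have "(\<Sum>v\<in>W. indicator (?B \<inter> C v) x :: ennreal) = (\<Sum>v\<in>W. if v = w then indicator ?B x else 0)"
        proof (rule sum.cong[OF refl])
          fix v assume v: "v \<in> W"
          show "indicator (?B \<inter> C v) x = (if v = w then indicator ?B x else (0::ennreal))"
            using w voronoi_cell_disjoint[OF v w(1)] by (auto simp: C_def indicator_def)
        qed
        then show ?case using w(1) W(1) by simp
      qed
    qed
    also have "\<dots> = (\<Sum>w\<in>W. \<integral>\<^sup>+x. indicator (?B \<inter> C w) x \<partial>lborel)"
      by (rule nn_integral_sum) (rule borel_measurable_indicator[OF BC])
    also have "\<dots> = (\<Sum>w\<in>W. e w)"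
      unfolding e_def by (intro sum.cong refl nn_integral_indicator BC)
    finally show ?thesis .
  qed
  have sum_I: "(\<Sum>w\<in>W. I w) \<le> (\<integral>\<^sup>+x. indicator ?B x * F x \<partial>lborel)"
  proof -
    have "(\<Sum>w\<in>W. I w) = (\<integral>\<^sup>+x. (\<Sum>w\<in>W. indicator (?B \<inter> C w) x * ennreal (g (slope w x))) \<partial>lborel)"
      unfolding I_def by (rule nn_integral_sum[symmetric]) measurable
    also have "\<dots> \<le> (\<integral>\<^sup>+x. indicator ?B x * F x \<partial>lborel)"
    proof (rule nn_integral_mono)
      fix x
      show "(\<Sum>w\<in>W. indicator (?B \<inter> C w) x * ennreal (g (slope w x))) \<le> indicator ?B x * F x"
      proof (cases "\<exists>w\<in>W. x \<in> C w")
        case True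
        then obtain w where w: "w \<in> W" "x \<in> C w" by blast
        have "(\<Sum>v\<in>W. indicator (?B \<inter> C v) x * ennreal (g (slope v x))) = (\<Sum>v\<in>W. if v = w then indicator ?B x * ennreal (g (slope w x)) else 0)"
        proof (rule sum.cong[OF refl])
          fix v assume v: "v \<in> W"
          show "indicator (?B \<inter> C v) x * ennreal (g (slope v x)) = (if v = w then indicator ?B x * ennreal (g (slope w x)) else 0)"
            using w voronoi_cell_disjoint[OF v w(1)] by (auto simp: C_def indicator_def)
        qed
        also have "\<dots> = indicator ?B x * ennreal (g (slope w x))" using w(1) W(1) by simp
        also have "\<dots> \<le> indicator ?B x * F x" using F[OF w(1) Cpos[OF w(2)]] by (intro mult_left_mono) auto
        finally show ?thesis .
      next
        case False
        then have "(\<Sum>w\<in>W. indicator (?B \<inter> C w) x * ennreal (g (slope w x))) = 0" by (intro sum.neutral) auto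
        then show ?thesis by simp
      qed
    qed
    finally show ?thesis .
  qed
  have cell: "ennreal ?\<Gamma> * e w \<le> I w" if w: "w \<in> W" for w
    unfolding e_def I_def
  proof (rule cell_compare(1)[OF n W(2)[OF w] Cm])
    show "x \<bullet> w > 0" if "x \<in> C w" for x using that by (rule Cpos)
    show "c *\<^sub>R x \<in> C w" if "x \<in> C w" "c > 0" for x c using that voronoi_cell_scaleR unfolding C_def by blast
    show "stretch w c x \<in> C w" if "x \<in> C w" "0 < c" "c \<le> 1" for x c
      using that W(2) w unfolding C_def by (intro voronoi_cell_stretch) auto
  qed
  have "ennreal ?\<Gamma> * emeasure lborel ?B = (\<Sum>w\<in>W. ennreal ?\<Gamma> * e w)" by (simp add: sum_e sum_distrib_left)
  also have "\<dots> \<le> (\<Sum>w\<in>W. I w)" by (rule sum_mono) (rule cell)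
  finally show "ennreal ?\<Gamma> * emeasure lborel ?B \<le> (\<integral>\<^sup>+x. indicator ?B x * F x \<partial>lborel)" using sum_I by simp
  assume st: "\<forall>c>0. \<forall>c'>c. g c' < g c" and w12: "w1 \<in> W" "w2 \<in> W" "w2 \<noteq> w1" "w2 \<noteq> - w1"
  have w1: "norm w1 = 1" and w2: "norm w2 = 1" using W(2) w12 by auto
  define z where "z x = x - (x \<bullet> w1) *\<^sub>R w1" for x
  have ip: "w2 \<bullet> w1 < 1" "- (w2 \<bullet> w1) < 1"
    using unit_inner_less_1[OF w2 w1 w12(3)] unit_inner_less_1[of w2 "- w1"] w1 w2 w12(4) by auto
  have zw2: "z w2 \<bullet> w2 > 0"
  proof -
    have "z w2 \<bullet> w2 = 1 - (w2 \<bullet> w1)\<^sup>2"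
      using w2 by (simp add: z_def inner_diff_left dot_square_norm power2_eq_square inner_commute[of w1])
    moreover have "(w2 \<bullet> w1)\<^sup>2 < 1" using ip by (simp add: abs_square_less_1)
    ultimately show ?thesis by simp
  qed
  have z0: "norm (z w2) > 0" using zw2 by auto
  have zw1: "z w2 \<bullet> w1 = 0" using w1 by (simp add: z_def inner_diff_left dot_square_norm)
  \<comment> \<open>Points whose component across w1 leans towards w2: stretching them far enough
    brings them nearer to w2. The other two conditions give positive
    \<open>cell_weight\<close>.\<close>
  let ?U = "{x. x \<bullet> w1 > 1 \<and> norm (z x) > x \<bullet> w1 \<and> z x \<bullet> w2 > 0}"
  have strict1: "ennreal ?\<Gamma> * e w1 < I w1"
    unfolding e_def I_def
  proof (rule cell_compare(3)[OF n w1 Cm _ _ _ st, where U = ?U])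
    show "x \<bullet> w1 > 0" if "x \<in> C w1" for x using that by (rule Cpos)
    show "c *\<^sub>R x \<in> C w1" if "x \<in> C w1" "c > 0" for x c using that voronoi_cell_scaleR unfolding C_def by blast
    show "stretch w1 c x \<in> C w1" if "x \<in> C w1" "0 < c" "c \<le> 1" for x c
      using that W(2) w1 unfolding C_def by (intro voronoi_cell_stretch) auto
    show "open ?U" unfolding z_def by (intro open_Collect_conj open_Collect_less continuous_intros)
    show "?U \<noteq> {}"
    proof -
      define L where "L = 3 / norm (z w2)"
      let ?x = "2 *\<^sub>R w1 + L *\<^sub>R z w2"
      have L: "L > 0" "norm (L *\<^sub>R z w2) = 3" using z0 by (auto simp: L_def)
      have a: "?x \<bullet> w1 = 2" using w1 zw1 by (simp add: inner_add_left dot_square_norm)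
      have b: "z ?x = L *\<^sub>R z w2" unfolding z_def[of ?x] a by simp
      have "?x \<in> ?U" using L zw2 unfolding mem_Collect_eq a b by simp
      then show ?thesis by blast
    qed
    fix x assume x: "x \<in> ?U"
    then have s: "x \<bullet> w1 > 1" "norm (z x) > x \<bullet> w1" "z x \<bullet> w2 > 0" by auto
    have sl: "slope w1 x \<ge> 1" using s by (simp add: slope_def z_def[symmetric] divide_simps)
    have st_eq: "stretch w1 c x = (x \<bullet> w1) *\<^sub>R w1 + c *\<^sub>R z x" for c
      by (simp add: stretch_def z_def algebra_simps)
    \<comment> \<open>At c = 0 the stretch is a positive multiple of w1, which lies in the open
      cell; hence small c > 0 work too.\<close>
    have ex1: "\<exists>c>0. stretch w1 c x \<in> C w1"
    proof -
      have in0: "stretch w1 0 x \<in> C w1"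
        using s W(2) w1 unit_inner_less_1[OF w1]
        by (auto simp: st_eq C_def voronoi_cell_def dot_square_norm)
      have op: "open ((\<lambda>c. stretch w1 c x) -` C w1)"
        unfolding st_eq C_def by (intro open_vimage open_voronoi_cell W(1) continuous_intros)
      have "0 \<in> (\<lambda>c. stretch w1 c x) -` C w1" using in0 by simp
      then obtain d where d: "d > 0" "ball 0 d \<subseteq> (\<lambda>c. stretch w1 c x) -` C w1"
        using openE[OF op] by blast
      have "d / 2 \<in> (\<lambda>c. stretch w1 c x) -` C w1"
        using d(1) by (intro subsetD[OF d(2)]) (simp add: dist_norm)
      then have "stretch w1 (d / 2) x \<in> C w1" by (rule vimageD)
      then show ?thesis using d(1) half_gt_zero by blast
    qed
    have ex2: "\<exists>c>0. stretch w1 c x \<notin> C w1"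
    proof -
      \<comment> \<open>The stretch factor at which the products with w1 and w2 tie, so that the
        strict inequality of the cell fails.\<close>
      define c where "c = (x \<bullet> w1) * (1 - w1 \<bullet> w2) / (z x \<bullet> w2)"
      have "c > 0" using s ip by (auto simp: c_def inner_commute)
      have "stretch w1 c x \<bullet> w2 = (x \<bullet> w1) * (w1 \<bullet> w2) + c * (z x \<bullet> w2)" by (simp add: st_eq inner_add_left)
      also have "c * (z x \<bullet> w2) = (x \<bullet> w1) * (1 - w1 \<bullet> w2)" using s by (simp add: c_def)
      also have "(x \<bullet> w1) * (w1 \<bullet> w2) + (x \<bullet> w1) * (1 - w1 \<bullet> w2) = x \<bullet> w1" by (simp add: algebra_simps)
      also have "\<dots> = stretch w1 c x \<bullet> w1" by (simp add: stretch_inner[OF w1])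
      finally have "stretch w1 c x \<notin> C w1" using w12
        by (auto simp: C_def voronoi_cell_def intro!: bexI[of _ w2])
      then show ?thesis using \<open>c > 0\<close> by blast
    qed
    show "x \<bullet> w1 \<ge> 1 \<and> slope w1 x \<ge> 1 \<and> (\<exists>c>0. stretch w1 c x \<in> C w1) \<and> (\<exists>c>0. stretch w1 c x \<notin> C w1)"
      using s sl ex1 ex2 by simp
  qed
  have fin: "ennreal ?\<Gamma> * e w \<noteq> \<infinity>" for w
  proof -
    have "e w \<le> emeasure lborel ?B" unfolding e_def by (intro emeasure_mono) auto
    also have "\<dots> < \<infinity>" by (rule emeasure_compact_finite) simp
    finally show ?thesis by (simp add: ennreal_mult_eq_top_iff)
  qed
  \<comment> \<open>Finiteness lets the strict inequality at w1 survive the addition in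
    \<open>ennreal\<close>.\<close>
  have finS: "(\<Sum>w\<in>W - {w1}. ennreal ?\<Gamma> * e w) \<noteq> \<infinity>" using fin W(1) by simp
  have "ennreal ?\<Gamma> * emeasure lborel ?B = (\<Sum>w\<in>W. ennreal ?\<Gamma> * e w)" by (simp add: sum_e sum_distrib_left)
  also have "\<dots> = (\<Sum>w\<in>W - {w1}. ennreal ?\<Gamma> * e w) + ennreal ?\<Gamma> * e w1"
    using W(1) w12(1) by (subst sum.remove[of _ w1]) (auto simp: add.commute)
  also have "\<dots> < (\<Sum>w\<in>W - {w1}. ennreal ?\<Gamma> * e w) + I w1"
    using strict1 finS by (simp add: ennreal_add_left_cancel_less)
  also have "\<dots> \<le> (\<Sum>w\<in>W - {w1}. I w) + I w1" using cell by (intro add_right_mono sum_mono) auto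
  also have "\<dots> = (\<Sum>w\<in>W. I w)" using W(1) w12(1) by (subst sum.remove[of _ w1]) (auto simp: add.commute)
  finally show "ennreal ?\<Gamma> * emeasure lborel ?B < (\<integral>\<^sup>+x. indicator ?B x * F x \<partial>lborel)" using sum_I by simp
qed

text \<open>The two open hemispheres cover the ball up to a null set, and
  \<open>cell_compare\<close> is an equation on each of them. This computes the mean support of a
  spindle.\<close>

lemma antipodal_mean:
  fixes w :: "real^'n" and F :: "real^'n \<Rightarrow> ennreal"
  assumes n: "CARD('n) = k + 2" and w: "norm w = 1"
    and F: "\<And>x. x \<bullet> w > 0 \<Longrightarrow> F x = ennreal (g (slope w x))" "\<And>x. x \<bullet> w < 0 \<Longrightarrow> F x = ennreal (g (slope (-w) x))"
    and [measurable]: "F \<in> borel_measurable borel"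
  shows "(\<integral>\<^sup>+x. indicator (cball 0 1) x * F x \<partial>lborel) = ennreal (slope_mean k g) * emeasure lborel (cball (0::real^'n) 1)"
proof -
  let ?\<Gamma> = "slope_mean k g" and ?B = "cball (0::real^'n) 1"
  have [measurable]: "?B \<in> sets borel" by simp
  define H where "H v = {x. x \<bullet> v > (0::real)}" for v :: "real^'n"
  have [measurable]: "H v \<in> sets borel" for v
    unfolding H_def by (intro borel_open open_Collect_less continuous_intros)
  have BH: "?B \<inter> H v \<in> sets lborel" for v unfolding sets_lborel by (intro sets.Int) measurable
  have half: "ennreal ?\<Gamma> * emeasure lborel (?B \<inter> H v) = (\<integral>\<^sup>+x. indicator (?B \<inter> H v) x * ennreal (g (slope v x)) \<partial>lborel)"
    if v: "norm v = 1" for v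
    by (rule cell_compare(2)[OF n v]) (auto simp: H_def stretch_inner[OF v])
  have "(\<integral>\<^sup>+x. indicator ?B x * F x \<partial>lborel)
    = (\<integral>\<^sup>+x. indicator (?B \<inter> H w) x * ennreal (g (slope w x)) + indicator (?B \<inter> H (-w)) x * ennreal (g (slope (-w) x)) \<partial>lborel)"
  proof (rule nn_integral_cong_AE)
    have "AE x in lborel. w \<bullet> x \<noteq> 0" using w by (intro AE_not_hyperplane) auto
    then show "AE x in lborel. indicator ?B x * F x =
      indicator (?B \<inter> H w) x * ennreal (g (slope w x)) + indicator (?B \<inter> H (-w)) x * ennreal (g (slope (-w) x))"
    proof eventually_elim
      case (elim x)
      then have "x \<bullet> w \<noteq> 0" by (simp add: inner_commute)
      then consider "x \<bullet> w > 0" | "x \<bullet> w < 0" by linarith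
      then show ?case by cases (auto simp: F H_def indicator_def)
    qed
  qed
  also have "\<dots> = (\<integral>\<^sup>+x. indicator (?B \<inter> H w) x * ennreal (g (slope w x)) \<partial>lborel) +
      (\<integral>\<^sup>+x. indicator (?B \<inter> H (-w)) x * ennreal (g (slope (-w) x)) \<partial>lborel)"
    by (rule nn_integral_add) measurable
  also have "\<dots> = ennreal ?\<Gamma> * (emeasure lborel (?B \<inter> H w) + emeasure lborel (?B \<inter> H (-w)))"
    using half[of w] half[of "-w"] w by (simp add: distrib_left)
  also have "emeasure lborel (?B \<inter> H w) + emeasure lborel (?B \<inter> H (-w)) = emeasure lborel ?B"
  proof -
    have "emeasure lborel ?B = (\<integral>\<^sup>+x. indicator (?B \<inter> H w) x + indicator (?B \<inter> H (-w)) x \<partial>lborel)"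
    proof -
      have "AE x in lborel. w \<bullet> x \<noteq> 0" using w by (intro AE_not_hyperplane) auto
      then have "AE x in lborel. indicator ?B x = (indicator (?B \<inter> H w) x + indicator (?B \<inter> H (-w)) x :: ennreal)"
      proof eventually_elim
        case (elim x)
        then have "x \<bullet> w \<noteq> 0" by (simp add: inner_commute)
      then consider "x \<bullet> w > 0" | "x \<bullet> w < 0" by linarith
        then show ?case by cases (auto simp: H_def indicator_def)
      qed
      then have "(\<integral>\<^sup>+x. indicator ?B x \<partial>lborel) = (\<integral>\<^sup>+x. indicator (?B \<inter> H w) x + indicator (?B \<inter> H (-w)) x \<partial>lborel)"
        by (rule nn_integral_cong_AE)
      then show ?thesis by simp
    qed
    also have "\<dots> = emeasure lborel (?B \<inter> H w) + emeasure lborel (?B \<inter> H (-w))"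
      by (subst nn_integral_add) (simp_all only: borel_measurable_indicator nn_integral_indicator BH)
    finally show ?thesis ..
  qed
  finally show ?thesis .
qed

end

section \<open>The first intrinsic volume as a mean of the support function\<close>

definition support_fn :: "'a::real_inner set \<Rightarrow> 'a \<Rightarrow> real" where
  "support_fn K x = (SUP k\<in>K. k \<bullet> x)"

lemma support_fn_ge:
  assumes "compact K" "k \<in> K"
  shows "k \<bullet> x \<le> support_fn K x"
proof -
  have "compact ((\<lambda>k. k \<bullet> x) ` K)" using assms(1) by (intro compact_continuous_image continuous_intros)
  then show ?thesis unfolding support_fn_def using assms(2)
    by (intro cSUP_upper bounded_imp_bdd_above compact_imp_bounded)
qed

lemma support_fn_attained:
  assumes "compact K" "K \<noteq> {}"
  obtains k where "k \<in> K" "k \<bullet> x = support_fn K x"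
proof -
  have "continuous_on K (\<lambda>k. k \<bullet> x)" by (intro continuous_intros)
  then obtain k where k: "k \<in> K" "\<And>y. y \<in> K \<Longrightarrow> y \<bullet> x \<le> k \<bullet> x"
    using continuous_attains_sup[OF assms, of "\<lambda>k. k \<bullet> x"] by blast
  have "support_fn K x = k \<bullet> x" unfolding support_fn_def using k by (intro cSup_eq_maximum) auto
  then show ?thesis using that k by simp
qed

lemma support_fn_le:
  assumes "compact K" "K \<noteq> {}" "\<And>k. k \<in> K \<Longrightarrow> k \<bullet> x \<le> b"
  shows "support_fn K x \<le> b"
  using support_fn_attained[OF assms(1,2), of x] assms(3) by metis

lemma support_fn_scaleR:
  assumes K: "compact K" "K \<noteq> {}" and "c \<ge> 0"
  shows "support_fn K (c *\<^sub>R x) = c * support_fn K x"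
proof (rule antisym)
  show "support_fn K (c *\<^sub>R x) \<le> c * support_fn K x"
    using support_fn_ge[OF K(1)] \<open>c \<ge> 0\<close> by (intro support_fn_le[OF K]) (simp add: mult_left_mono)
  obtain k where k: "k \<in> K" "k \<bullet> x = support_fn K x" using support_fn_attained[OF K] by blast
  show "c * support_fn K x \<le> support_fn K (c *\<^sub>R x)"
    using support_fn_ge[OF K(1) k(1), of "c *\<^sub>R x"] k(2) by simp
qed

lemma support_fn_bound:
  assumes K: "compact K" "K \<noteq> {}" and M: "K \<subseteq> cball 0 M"
  shows "\<bar>support_fn K x\<bar> \<le> M * norm x"
proof -
  obtain k where k: "k \<in> K" "k \<bullet> x = support_fn K x" using support_fn_attained[OF K] by blast
  have "\<bar>k \<bullet> x\<bar> \<le> norm k * norm x" by (rule Cauchy_Schwarz_ineq2)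
  also have "\<dots> \<le> M * norm x" using M k by (intro mult_right_mono) auto
  finally show ?thesis using k by simp
qed

lemma continuous_on_support_fn:
  fixes K :: "'a::euclidean_space set"
  assumes K: "compact K" "K \<noteq> {}"
  shows "continuous_on UNIV (support_fn K)"
proof -
  obtain M where M: "M > 0" "K \<subseteq> cball 0 M"
    using compact_imp_bounded[OF K(1)] by (metis bounded_pos mem_cball_0 subsetI)
  have lip: "support_fn K x - support_fn K y \<le> M * norm (x - y)" for x y
  proof -
    obtain k where k: "k \<in> K" "k \<bullet> x = support_fn K x" using support_fn_attained[OF K] by blast
    have "support_fn K x - support_fn K y \<le> k \<bullet> (x - y)"
      using support_fn_ge[OF K(1) k(1), of y] k(2) by (simp add: inner_diff_right)
    also have "\<dots> \<le> norm k * norm (x - y)" by (rule norm_cauchy_schwarz)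
    also have "\<dots> \<le> M * norm (x - y)" using M k by (intro mult_right_mono) auto
    finally show ?thesis .
  qed
  have "M-lipschitz_on UNIV (support_fn K)"
  proof (rule lipschitz_onI)
    show "dist (support_fn K x) (support_fn K y) \<le> M * dist x y" for x y
      using lip[of x y] lip[of y x] by (simp add: dist_norm norm_minus_commute abs_le_iff)
  qed (use M in simp)
  then show ?thesis by (rule lipschitz_on_continuous_on)
qed

text \<open>The support function at the direction of x, hence constant along rays; the value at 0 is
  0 by division by zero. Integrating it over the unit ball replaces integration of the support
  function over the sphere.\<close>

definition nsupport :: "'a::real_inner set \<Rightarrow> 'a \<Rightarrow> real" where
  "nsupport K x = support_fn K x / norm x"

lemma nsupport_measurable:
  "compact (K::'a::euclidean_space set) \<Longrightarrow> K \<noteq> {} \<Longrightarrow> nsupport K \<in> borel_measurable borel"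
  unfolding nsupport_def
  by (intro borel_measurable_divide borel_measurable_continuous_onI continuous_on_support_fn continuous_intros)

lemma nsupport_scaleR: "compact K \<Longrightarrow> K \<noteq> {} \<Longrightarrow> c > 0 \<Longrightarrow> nsupport K (c *\<^sub>R x) = nsupport K x"
  by (simp add: nsupport_def support_fn_scaleR)

lemma nsupport_bound:
  assumes "compact K" "K \<noteq> {}" "K \<subseteq> cball 0 M" "M \<ge> 0"
  shows "\<bar>nsupport K x\<bar> \<le> M"
  using support_fn_bound[OF assms(1-3), of x] assms(4)
  by (cases "x = 0") (auto simp: nsupport_def divide_le_eq)

section \<open>Radial functions and volumes of star-shaped sets\<close>

text \<open>The dilation flow with weight 1/|x| integrates out the radius. The remaining integral
  represents one over directions, in the same way for every radial function a.\<close>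

lemma nn_integral_polar:
  fixes a :: "'a::euclidean_space \<Rightarrow> real" and \<phi> :: "'a \<Rightarrow> ennreal"
  assumes [measurable]: "a \<in> borel_measurable borel" "\<phi> \<in> borel_measurable borel"
    and a: "\<And>x. a x \<ge> 0" "\<And>x c. c > 0 \<Longrightarrow> a (c *\<^sub>R x) = a x"
    and \<phi>: "\<And>x c. c > 0 \<Longrightarrow> \<phi> (c *\<^sub>R x) = \<phi> x"
  shows "(\<integral>\<^sup>+x. indicator {x. norm x \<le> a x} x * \<phi> x \<partial>lborel)
    = (\<integral>\<^sup>+x. ennreal (if norm x \<ge> 1 then 1 / norm x else 0) * (\<phi> x * ennreal ((a x / norm x) ^ DIM('a) / DIM('a))) \<partial>lborel)"
proof -
  let ?f = "\<lambda>x. indicator {x. norm x \<le> a x} x * \<phi> x"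
  let ?e = "\<lambda>x::'a. ennreal (if norm x \<ge> 1 then 1 / norm x else 0)"
  have D: "Suc (DIM('a) - 1) = DIM('a)" using DIM_positive[where 'a = 'a] by simp
  have "(\<integral>\<^sup>+x. ?f x \<partial>lborel) = (\<integral>\<^sup>+x. ?e x * (\<integral>\<^sup>+c. indicator {0<..} c * (?f (c *\<^sub>R x) * ennreal (c ^ (DIM('a) - 1))) \<partial>lborel) \<partial>lborel)"
  proof (rule nn_integral_flow[where T = "\<lambda>c x. c *\<^sub>R x"])
    show "(\<integral>\<^sup>+x. g x \<partial>lborel) = ennreal (c ^ Suc (DIM('a) - 1)) * (\<integral>\<^sup>+x. g (c *\<^sub>R x) \<partial>lborel)"
      if "c > 0" "g \<in> borel_measurable borel" for c and g :: "'a \<Rightarrow> ennreal"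
      unfolding D by (rule nn_integral_scaleR[OF that])
    have "AE x in lborel. x \<noteq> (0::'a)" by (rule AE_lborel_singleton)
    then show "AE x in lborel. ?f x \<noteq> 0 \<longrightarrow>
      (\<integral>\<^sup>+c. indicator {0<..} c * (?e ((1 / c) *\<^sub>R x) * ennreal (1 / c)) \<partial>lborel) = 1"
    proof eventually_elim
      case (elim x)
      then have "norm x > 0" by simp
      from nn_integral_flow_weight[OF this]
      have "(\<integral>\<^sup>+c. indicator {0<..} c * (ennreal (if norm x / c \<ge> 1 then 1 / (norm x / c) else 0) * ennreal (1 / c)) \<partial>lborel) = 1" .
      moreover have "indicator {0<..} c * (?e ((1 / c) *\<^sub>R x) * ennreal (1 / c))
          = indicator {0<..} c * (ennreal (if norm x / c \<ge> 1 then 1 / (norm x / c) else 0) * ennreal (1 / c))" for c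
        by (cases "c > 0") simp_all
      ultimately show ?case by simp
    qed
    show "?f \<in> borel_measurable borel" by measurable
    show "?e \<in> borel_measurable borel" by measurable
    show "(\<lambda>p::real \<times> 'a. fst p *\<^sub>R snd p) \<in> borel_measurable (borel \<Otimes>\<^sub>M borel)" by measurable
  qed simp
  also have "\<dots> = (\<integral>\<^sup>+x. ?e x * (\<phi> x * ennreal ((a x / norm x) ^ DIM('a) / DIM('a))) \<partial>lborel)"
  proof (rule nn_integral_cong)
    fix x :: 'a
    show "?e x * (\<integral>\<^sup>+c. indicator {0<..} c * (?f (c *\<^sub>R x) * ennreal (c ^ (DIM('a) - 1))) \<partial>lborel)
      = ?e x * (\<phi> x * ennreal ((a x / norm x) ^ DIM('a) / DIM('a)))"
    proof (cases "x = 0")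
      case False
      then have x0: "norm x > 0" by simp
      have "(\<integral>\<^sup>+c. indicator {0<..} c * (?f (c *\<^sub>R x) * ennreal (c ^ (DIM('a) - 1))) \<partial>lborel)
        = (\<integral>\<^sup>+c. \<phi> x * (indicator {0<..} c * (indicator {..a x / norm x} c * ennreal (c ^ (DIM('a) - 1)))) \<partial>lborel)"
      proof (rule nn_integral_cong)
        fix c :: real
        have "c \<le> a x / norm x \<longleftrightarrow> c * norm x \<le> a x" using x0 by (simp add: field_simps)
        then show "indicator {0<..} c * (?f (c *\<^sub>R x) * ennreal (c ^ (DIM('a) - 1)))
          = \<phi> x * (indicator {0<..} c * (indicator {..a x / norm x} c * ennreal (c ^ (DIM('a) - 1))))"
          by (cases "c > 0") (auto simp: indicator_def a \<phi>)
      qed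
      also have "\<dots> = \<phi> x * (\<integral>\<^sup>+c. indicator {0<..} c * (indicator {..a x / norm x} c * ennreal (c ^ (DIM('a) - 1))) \<partial>lborel)"
        by (rule nn_integral_cmult) measurable
      also have "(\<integral>\<^sup>+c. indicator {0<..} c * (indicator {..a x / norm x} c * ennreal (c ^ (DIM('a) - 1))) \<partial>lborel)
        = ennreal ((a x / norm x) ^ Suc (DIM('a) - 1) / Suc (DIM('a) - 1))"
        using x0 a(1) by (intro nn_integral_power_Ioc) simp
      finally show ?thesis unfolding D by simp
    qed simp
  qed
  finally show ?thesis .
qed

text \<open>The polar formula is read in both directions, with radial function a and then with 1, so
  that a moves from the domain of integration to the integrand.\<close>

lemma emeasure_star_set:
  fixes a :: "'a::euclidean_space \<Rightarrow> real"
  assumes [measurable]: "a \<in> borel_measurable borel"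
    and a: "\<And>x. a x \<ge> 0" "\<And>x c. c > 0 \<Longrightarrow> a (c *\<^sub>R x) = a x"
  shows "emeasure lborel {x. norm x \<le> a x} = (\<integral>\<^sup>+x. indicator (cball 0 1) x * ennreal (a x ^ DIM('a)) \<partial>lborel)"
proof -
  have "{x. norm x \<le> a x} \<in> sets lborel" unfolding sets_lborel by measurable
  then have "emeasure lborel {x. norm x \<le> a x} = (\<integral>\<^sup>+x. indicator {x. norm x \<le> a x} x * 1 \<partial>lborel)"
    by (simp only: mult_1_right nn_integral_indicator)
  also have "\<dots> = (\<integral>\<^sup>+x. ennreal (if norm x \<ge> 1 then 1 / norm x else 0) * (1 * ennreal ((a x / norm x) ^ DIM('a) / DIM('a))) \<partial>lborel)"
    by (rule nn_integral_polar) (use a in auto)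
  also have "\<dots> = (\<integral>\<^sup>+x. ennreal (if norm x \<ge> 1 then 1 / norm x else 0) * (ennreal (a x ^ DIM('a)) * ennreal ((1 / norm x) ^ DIM('a) / DIM('a))) \<partial>lborel)"
    by (intro nn_integral_cong) (simp add: ennreal_mult[symmetric] a power_divide)
  also have "\<dots> = (\<integral>\<^sup>+x. indicator {x. norm x \<le> 1} x * ennreal (a x ^ DIM('a)) \<partial>lborel)"
    by (rule nn_integral_polar[symmetric]) (use a in auto)
  also have "\<dots> = (\<integral>\<^sup>+x. indicator (cball 0 1) x * ennreal (a x ^ DIM('a)) \<partial>lborel)"
    by (intro nn_integral_cong) (simp add: indicator_def)
  finally show ?thesis .
qed

text \<open>A second-order counterpart from above to Bernoulli's inequality; 4 ^ n grows fast enough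
  for the induction.\<close>

lemma one_plus_power_le_quadratic:
  assumes "\<bar>a\<bar> \<le> (1::real)"
  shows "(1 + a) ^ n \<le> 1 + n * a + 4 ^ n * a\<^sup>2"
proof (induction n)
  case (Suc n)
  have n: "real n \<le> 4 ^ n"
    using of_nat_le_three_power[of n] power_mono[of 3 "4::real" n] by linarith
  have "(1 + a) ^ Suc n \<le> (1 + a) * (1 + n * a + 4 ^ n * a\<^sup>2)"
    using Suc assms by (simp add: mult_left_mono)
  also have "\<dots> = 1 + real (Suc n) * a + (real n + 4 ^ n + 4 ^ n * a) * a\<^sup>2"
    by (simp add: algebra_simps power2_eq_square)
  also have "\<dots> \<le> 1 + real (Suc n) * a + 4 ^ Suc n * a\<^sup>2"
  proof -
    have "4 ^ n * a \<le> 4 ^ n * (1::real)" using assms by (intro mult_left_mono) auto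
    moreover have "(0::real) \<le> 4 ^ n" by simp
    ultimately have "real n + 4 ^ n + 4 ^ n * a \<le> 4 ^ Suc n" using n unfolding power_Suc by linarith
    then show ?thesis by (simp add: mult_right_mono)
  qed
  finally show ?case .
qed simp

text \<open>The constant term is the right-hand limit at 0, hence 0. After division by t the same
  argument applies to the linear coefficient.\<close>

lemma poly_linear_coeffs_zero:
  fixes p :: "real poly"
  assumes \<delta>: "\<delta> > 0" and p: "\<And>t. 0 < t \<Longrightarrow> t \<le> \<delta> \<Longrightarrow> \<bar>poly p t\<bar> \<le> C * t\<^sup>2"
  shows "coeff p 1 = 0"
proof -
  have ev: "eventually (\<lambda>t. 0 < t \<and> t \<le> \<delta>) (at_right 0)"
    using \<delta> by (auto simp: eventually_at_right_field intro!: exI[of _ \<delta>])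
  have lim: "((\<lambda>t. poly q t) \<longlongrightarrow> poly q 0) (at_right 0)" for q :: "real poly"
    by (rule tendsto_poly) (rule tendsto_ident_at)
  have zero: "poly q 0 = 0" if "\<And>t. 0 < t \<Longrightarrow> t \<le> \<delta> \<Longrightarrow> \<bar>poly q t\<bar> \<le> C * t ^ Suc m" for q :: "real poly" and m
  proof -
    have "((\<lambda>t. C * t ^ Suc m) \<longlongrightarrow> C * 0 ^ Suc m) (at_right 0)" by (intro tendsto_intros)
    then have "((\<lambda>t. C * t ^ Suc m) \<longlongrightarrow> 0) (at_right 0)" by simp
    then have "((\<lambda>t. poly q t) \<longlongrightarrow> 0) (at_right 0)"
    proof (rule Lim_null_comparison[rotated])
      show "eventually (\<lambda>t. norm (poly q t) \<le> C * t ^ Suc m) (at_right 0)"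
        using ev by eventually_elim (use that in auto)
    qed
    then show ?thesis using tendsto_unique[OF _ lim[of q]] by simp
  qed
  obtain a p1 where p1: "p = pCons a p1" by (cases p)
  have "poly p 0 = 0" by (rule zero[of _ 1]) (use p in \<open>simp add: numeral_2_eq_2\<close>)
  then have a: "a = 0" by (simp add: p1)
  have "poly p1 0 = 0"
  proof (rule zero[of _ 0])
    fix t assume t: "0 < t" "t \<le> \<delta>"
    then have "t * \<bar>poly p1 t\<bar> \<le> t * (C * t)" using p[OF t] by (simp add: p1 a abs_mult power2_eq_square mult_ac)
    then show "\<bar>poly p1 t\<bar> \<le> C * t ^ Suc 0" using t by simp
  qed
  then show ?thesis by (simp add: p1 poly_0_coeff_0)
qed

text \<open>The support function of A is 1 + t h in unit directions. A radial function never exceeds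
  the support function, which is the first inclusion. For the second, a boundary point r u is
  exhibited in A; since 0 lies in A by t M \<le> 1, the segment to it does as well.\<close>

lemma scaled_sum_bounds:
  fixes K :: "'a::euclidean_space set"
  assumes K: "convex K" "compact K" "K \<noteq> {}" "K \<subseteq> cball 0 M" and M: "M > 0" and t: "t > 0" "t * M \<le> 1"
  defines "A \<equiv> {b + t *\<^sub>R k | b k. b \<in> cball 0 1 \<and> k \<in> K}"
  shows "A \<subseteq> {x. norm x \<le> 1 + t * nsupport K x}"
    and "{x. norm x \<le> 1 + t * nsupport K x - (t * M)\<^sup>2} \<subseteq> A"
proof -
  show "A \<subseteq> {x. norm x \<le> 1 + t * nsupport K x}"
  proof
    fix x assume "x \<in> A"
    then obtain b k where x: "x = b + t *\<^sub>R k" "norm b \<le> 1" "k \<in> K" by (auto simp: A_def)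
    show "x \<in> {x. norm x \<le> 1 + t * nsupport K x}"
    proof (cases "x = 0")
      case True then show ?thesis by (simp add: nsupport_def)
    next
      case False
      have "norm x * norm x = b \<bullet> x + t * (k \<bullet> x)"
        by (metis inner_add_left inner_scaleR_left power2_eq_square power2_norm_eq_inner x(1))
      also have "b \<bullet> x \<le> norm b * norm x" by (rule norm_cauchy_schwarz)
      also have "norm b * norm x \<le> 1 * norm x" using x by (intro mult_right_mono) auto
      also have "t * (k \<bullet> x) \<le> t * support_fn K x" using t support_fn_ge[OF K(2) x(3)] by (intro mult_left_mono) auto
      also have "support_fn K x = nsupport K x * norm x" using False by (simp add: nsupport_def)
      finally have "norm x * norm x \<le> (1 + t * nsupport K x) * norm x" by (simp add: algebra_simps)
      then show ?thesis using False by simp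
    qed
  qed
  have "A = cball 0 1 + (*\<^sub>R) t ` K" unfolding A_def set_plus_def by blast
  then have cA: "convex A" using convex_set_plus[OF convex_cball convex_scaling[OF K(1)]] by simp
  have zA: "0 \<in> A"
  proof -
    obtain k where k: "k \<in> K" using K(3) by blast
    have "norm k \<le> M" using k K(4) by auto
    then have "t * norm k \<le> t * M" using t by (intro mult_left_mono) auto
    then have "t * norm k \<le> 1" using t by linarith
    then have "- (t *\<^sub>R k) \<in> cball 0 1" using t by simp
    moreover have "0 = - (t *\<^sub>R k) + t *\<^sub>R k" by simp
    ultimately show ?thesis unfolding A_def using k by blast
  qed
  show "{x. norm x \<le> 1 + t * nsupport K x - (t * M)\<^sup>2} \<subseteq> A"
  proof
    fix x assume "x \<in> {x. norm x \<le> 1 + t * nsupport K x - (t * M)\<^sup>2}"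
    then have nx: "norm x \<le> 1 + t * nsupport K x - (t * M)\<^sup>2" by simp
    show "x \<in> A"
    proof (cases "x = 0")
      case False
      define u where "u = x /\<^sub>R norm x"
      have u: "norm u = 1" "x = norm x *\<^sub>R u" using False by (auto simp: u_def)
      \<comment> \<open>The loss (t M)^2 = y pays for the part of t k across u: the square of |r u -
        t k| is at most (1 - y)^2 + y, which is at most 1 for 0 \<le> y \<le> 1.\<close>
      define r where "r = 1 + t * nsupport K x - (t * M)\<^sup>2"
      have nr: "norm x \<le> r" using nx by (simp add: r_def)
      have "norm x > 0" using False by simp
      with nr have r: "r > 0" "norm x \<le> r" by linarith+
      obtain k where k: "k \<in> K" "k \<bullet> u = support_fn K u" using support_fn_attained[OF K(2,3)] by blast
      have h: "k \<bullet> u = nsupport K x"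
        using k(2) False by (simp add: u_def support_fn_scaleR[OF K(2,3)] nsupport_def divide_inverse_commute)
      have nk: "norm k \<le> M" using k K(4) by auto
      define y where "y = (t * M)\<^sup>2"
      have y: "0 \<le> y" "y \<le> 1" using t M by (auto simp: y_def power_le_one)
      have "(norm (r *\<^sub>R u - t *\<^sub>R k))\<^sup>2 = (norm (r *\<^sub>R u))\<^sup>2 - 2 * (r *\<^sub>R u \<bullet> t *\<^sub>R k) + (norm (t *\<^sub>R k))\<^sup>2"
        unfolding power2_norm_eq_inner by (simp add: inner_diff_left inner_diff_right inner_commute)
      also have "\<dots> = r\<^sup>2 - 2 * r * (t * nsupport K x) + (t * norm k)\<^sup>2"
        using u(1) h by (simp add: inner_commute[of u k] power_mult_distrib)
      also have "\<dots> = (r - t * nsupport K x)\<^sup>2 - (t * nsupport K x)\<^sup>2 + (t * norm k)\<^sup>2"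
        by (simp add: power2_eq_square algebra_simps)
      also have "\<dots> \<le> (1 - y)\<^sup>2 + y"
      proof -
        have "(t * norm k)\<^sup>2 \<le> y" unfolding y_def using t nk by (intro power_mono mult_left_mono) auto
        moreover have "r - t * nsupport K x = 1 - y" by (simp add: r_def y_def)
        moreover have "0 \<le> (t * nsupport K x)\<^sup>2" by simp
        ultimately show ?thesis by (simp only:)
      qed
      also have "\<dots> = 1 - y * (1 - y)" by (simp add: power2_eq_square algebra_simps)
      also have "\<dots> \<le> 1" using y by simp
      finally have "norm (r *\<^sub>R u - t *\<^sub>R k) \<le> 1" by (simp add: power2_le_imp_le abs_square_le_1)
      then have "(r *\<^sub>R u - t *\<^sub>R k) \<in> cball 0 1" by simp
      moreover have "r *\<^sub>R u = (r *\<^sub>R u - t *\<^sub>R k) + t *\<^sub>R k" by simp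
      ultimately have rA: "r *\<^sub>R u \<in> A" unfolding A_def using k(1) by blast
      have "(norm x / r) *\<^sub>R (r *\<^sub>R u) + (1 - norm x / r) *\<^sub>R 0 \<in> A"
        using cA rA zA r by (intro convexD) auto
      moreover have "(norm x / r) *\<^sub>R (r *\<^sub>R u) = x" using r u(2) by simp
      ultimately show ?thesis by simp
    qed (use zA in simp)
  qed
qed

lemma integral_cball_bound_integrable:
  fixes f :: "'a::euclidean_space \<Rightarrow> real"
  assumes [measurable]: "f \<in> borel_measurable borel" and M: "\<And>x. \<bar>f x\<bar> \<le> M"
  shows "integrable lborel (\<lambda>x. indicator (cball 0 1) x * f x)"
proof (rule Bochner_Integration.integrable_bound)
  have [measurable]: "cball (0::'a) 1 \<in> sets borel" by simp
  show "integrable lborel (\<lambda>x::'a. indicator (cball 0 1) x * M)"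
    using borel_integrable_compact[of "cball (0::'a) 1" "\<lambda>_. M"] by simp
  show "(\<lambda>x. indicator (cball 0 1) x * f x) \<in> borel_measurable lborel" by measurable
  show "AE x in lborel. norm (indicator (cball 0 1) x * f x) \<le> norm (indicator (cball 0 1) x * M)"
  proof (intro always_eventually allI)
    fix x show "norm (indicator (cball 0 1) x * f x) \<le> norm (indicator (cball 0 1) x * M)"
      using M[of x] by (auto simp: indicator_def)
  qed
qed

lemma measure_star_set:
  fixes a :: "'a::euclidean_space \<Rightarrow> real"
  assumes a: "a \<in> borel_measurable borel" "\<And>x. a x \<ge> 0" "\<And>x c. c > 0 \<Longrightarrow> a (c *\<^sub>R x) = a x" "\<And>x. a x \<le> M"
  shows "emeasure lborel {x. norm x \<le> a x} = ennreal (\<integral>x. indicator (cball 0 1) x * a x ^ DIM('a) \<partial>lborel)"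
proof -
  have i: "integrable lborel (\<lambda>x. indicator (cball 0 1) x * a x ^ DIM('a))"
  proof (rule integral_cball_bound_integrable)
    show "(\<lambda>x. a x ^ DIM('a)) \<in> borel_measurable borel" using a(1) by measurable
    show "\<bar>a x ^ DIM('a)\<bar> \<le> M ^ DIM('a)" for x using a by (simp add: power_mono)
  qed
  have "emeasure lborel {x. norm x \<le> a x} = (\<integral>\<^sup>+x. indicator (cball 0 1) x * ennreal (a x ^ DIM('a)) \<partial>lborel)"
    by (rule emeasure_star_set) (use a in auto)
  also have "\<dots> = (\<integral>\<^sup>+x. ennreal (indicator (cball 0 1) x * a x ^ DIM('a)) \<partial>lborel)"
    by (intro nn_integral_cong) (simp add: indicator_def)
  also have "\<dots> = ennreal (\<integral>x. indicator (cball 0 1) x * a x ^ DIM('a) \<partial>lborel)"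
    by (rule nn_integral_eq_integral[OF i]) (use a(2) in simp)
  finally show ?thesis .
qed

theorem intrinsic_volume_1_eq:
  fixes K :: "(real^'n) set"
  assumes K: "convex K" "compact K" "K \<noteq> {}"
  shows "unit_ball_vol (real (CARD('n) - 1)) * intrinsic_volumes K 1
    = CARD('n) * (\<integral>x. indicator (cball 0 1) x * nsupport K x \<partial>lborel)"
proof -
  let ?n = "CARD('n)" and ?B = "cball (0::real^'n) 1"
  have n: "?n \<ge> 1" by (simp add: Suc_leI)
  obtain M where M: "M > 0" "K \<subseteq> cball 0 M"
    using compact_imp_bounded[OF K(2)] by (metis bounded_pos mem_cball_0 subsetI)
  define \<kappa> where "\<kappa> = vol ?B"
  have k0: "\<kappa> \<ge> 0" by (simp add: \<kappa>_def)
  have \<kappa>: "\<kappa> = unit_ball_vol ?n" unfolding \<kappa>_def using vol_scale_cball[of 1, where 'a = "real^'n"] by simp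
  define I where "I = (\<integral>x. indicator ?B x * nsupport K x \<partial>lborel)"
  have F[measurable]: "nsupport K \<in> borel_measurable borel" by (rule nsupport_measurable[OF K(2,3)])
  have Fb: "\<bar>nsupport K x\<bar> \<le> M" for x using nsupport_bound[OF K(2,3) M(2)] M(1) by simp
  have Fs: "nsupport K (c *\<^sub>R x) = nsupport K x" if "c > 0" for c x using nsupport_scaleR[OF K(2,3) that] .
  have iF: "integrable lborel (\<lambda>x. indicator ?B x * nsupport K x)" by (rule integral_cball_bound_integrable[OF F Fb])
  have iB: "integrable lborel (indicator ?B :: _ \<Rightarrow> real)"
    using integral_cball_bound_integrable[of "\<lambda>_. 1" 1] by simp
  have intB: "(\<integral>x. indicator ?B x * (a + b * nsupport K x) \<partial>lborel) = a * \<kappa> + b * I" for a b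
  proof -
    have "indicator ?B x * (a + b * nsupport K x) = a * indicator ?B x + b * (indicator ?B x * nsupport K x)" for x
      by (simp add: algebra_simps)
    then have "(\<integral>x. indicator ?B x * (a + b * nsupport K x) \<partial>lborel) = (\<integral>x. a * indicator ?B x + b * (indicator ?B x * nsupport K x) \<partial>lborel)"
      by simp
    also have "\<dots> = (\<integral>x. a * indicator ?B x \<partial>lborel) + (\<integral>x. b * (indicator ?B x * nsupport K x) \<partial>lborel)"
      by (intro Bochner_Integration.integral_add integrable_mult_right iB iF)
    finally show ?thesis by (simp add: I_def \<kappa>_def)
  qed
  \<comment> \<open>Steiner's polynomial in t = 1/e after multiplication by t^n: the coefficients
    appear in reverse order, so V_1 now belongs to t.\<close>
  define p where "p = (\<Sum>j = 0..?n. monom (unit_ball_vol (real (?n - j)) * intrinsic_volumes K j) j)"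
  define A where "A t = {b + t *\<^sub>R k | b k. b \<in> ?B \<and> k \<in> K}" for t
  have A_eq: "A t = ?B + (*\<^sub>R) t ` K" for t unfolding A_def set_plus_def by blast
  have cA: "compact (A t)" for t unfolding A_eq by (intro compact_set_plus compact_scaling K) simp
  have volA: "vol (A t) = poly p t" if t: "t > 0" for t
  proof -
    have "A t = (*\<^sub>R) t ` parallel_body K (1 / t)"
    proof (intro equalityI subsetI)
      fix x assume "x \<in> A t"
      then obtain b k where "b \<in> ?B" "k \<in> K" "x = b + t *\<^sub>R k" by (auto simp: A_def)
      then have "x = t *\<^sub>R (k + (1 / t) *\<^sub>R b)" "k + (1 / t) *\<^sub>R b \<in> parallel_body K (1 / t)"
        using t unfolding parallel_body_def by (auto simp: scaleR_add_right)
      then show "x \<in> (*\<^sub>R) t ` parallel_body K (1 / t)" by blast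
    next
      fix x assume "x \<in> (*\<^sub>R) t ` parallel_body K (1 / t)"
      then obtain b k where "b \<in> ?B" "k \<in> K" "x = t *\<^sub>R (k + (1 / t) *\<^sub>R b)" by (auto simp: parallel_body_def)
      then have "x = b + t *\<^sub>R k" "b \<in> ?B" "k \<in> K" using t by (auto simp: scaleR_add_right)
      then show "x \<in> A t" unfolding A_def by blast
    qed
    then have "vol (A t) = t ^ ?n * vol (parallel_body K (1 / t))"
      using t vol_scaleR_image[OF compact_parallel_body[OF K(2)], of t "1 / t"] by simp
    also have "\<dots> = (\<Sum>j = 0..?n. t ^ ?n * (unit_ball_vol (real (?n - j)) * intrinsic_volumes K j * (1 / t) ^ (?n - j)))"
      using t by (subst steiner_formula[OF K]) (auto simp: sum_distrib_left)
    also have "\<dots> = (\<Sum>j = 0..?n. unit_ball_vol (real (?n - j)) * intrinsic_volumes K j * t ^ j)"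
    proof (rule sum.cong[OF refl])
      fix j assume "j \<in> {0..?n}"
      then have "t ^ ?n = t ^ j * t ^ (?n - j)" by (simp flip: power_add)
      then show "t ^ ?n * (unit_ball_vol (real (?n - j)) * intrinsic_volumes K j * (1 / t) ^ (?n - j))
        = unit_ball_vol (real (?n - j)) * intrinsic_volumes K j * t ^ j"
        using t by (simp add: power_one_over)
    qed
    finally show ?thesis by (simp add: p_def poly_sum poly_monom)
  qed
  \<comment> \<open>For t \<le> 1 / (2 M) the lower radial function 1 + t h - (t M)^2 is
    nonnegative. In the error constant below, 4 ^ n comes from the upper expansion and n from
    Bernoulli's inequality.\<close>
  define \<delta> where "\<delta> = 1 / (2 * M)"
  have d0: "\<delta> > 0" using M by (simp add: \<delta>_def)
  let ?C = "(4 ^ ?n + ?n) * M\<^sup>2 * \<kappa>"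
  have main: "\<bar>poly (p - [:\<kappa>, ?n * I:]) t\<bar> \<le> ?C * t\<^sup>2" if t: "0 < t" "t \<le> \<delta>" for t
  proof -
    have tM: "t * M \<le> 1/2" using t M by (simp add: \<delta>_def field_simps)
    have tM0: "t * M \<ge> 0" using t M by simp
    have tF: "\<bar>t * nsupport K x\<bar> \<le> t * M" for x using Fb[of x] t by (simp add: abs_mult)
    have tM2: "(t * M)\<^sup>2 \<le> 1/4" using power_mono[OF tM tM0, of 2] by (simp add: power2_eq_square)
    note sb = scaled_sum_bounds[OF K M(2) M(1) t(1), folded A_def]
    have "emeasure lborel (A t) \<le> emeasure lborel {x. norm x \<le> 1 + t * nsupport K x}"
      using sb(1) tM by (intro emeasure_mono) auto
    also have "\<dots> = ennreal (\<integral>x. indicator ?B x * (1 + t * nsupport K x) ^ DIM(real^'n) \<partial>lborel)"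
    proof (rule measure_star_set)
      show "0 \<le> 1 + t * nsupport K x" "1 + t * nsupport K x \<le> 2" for x using tF[of x] tM by linarith+
    qed (measurable, simp add: Fs)
    finally have up: "vol (A t) \<le> (\<integral>x. indicator ?B x * (1 + t * nsupport K x) ^ ?n \<partial>lborel)"
    proof -
      assume le: "emeasure lborel (A t) \<le> ennreal (\<integral>x. indicator ?B x * (1 + t * nsupport K x) ^ DIM(real^'n) \<partial>lborel)"
      have nn: "(\<integral>x. indicator ?B x * (1 + t * nsupport K x) ^ ?n \<partial>lborel) \<ge> 0"
      proof (intro integral_nonneg_AE always_eventually allI)
        fix x have "0 \<le> 1 + t * nsupport K x" using tF[of x] tM by linarith
        then show "0 \<le> indicator ?B x * (1 + t * nsupport K x) ^ ?n" by simp
      qed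
      have "emeasure lborel (A t) = ennreal (vol (A t))"
        using emeasure_compact_finite[OF cA] by (intro emeasure_eq_ennreal_measure) (simp add: less_top)
      then show ?thesis using le nn by simp
    qed
    have "ennreal (\<integral>x. indicator ?B x * (1 + t * nsupport K x - (t * M)\<^sup>2) ^ DIM(real^'n) \<partial>lborel)
      = emeasure lborel {x. norm x \<le> 1 + t * nsupport K x - (t * M)\<^sup>2}"
    proof (rule measure_star_set[symmetric])
      show "0 \<le> 1 + t * nsupport K x - (t * M)\<^sup>2" "1 + t * nsupport K x - (t * M)\<^sup>2 \<le> 2" for x
        using tF[of x] tM tM2 zero_le_power2[of "t * M"] by linarith+
    qed (measurable, simp add: Fs)
    also have "\<dots> \<le> emeasure lborel (A t)"
      using sb(2) tM cA by (intro emeasure_mono) (auto simp: borel_compact)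
    also have "\<dots> = ennreal (vol (A t))"
      using emeasure_compact_finite[OF cA] by (intro emeasure_eq_ennreal_measure) (simp add: less_top)
    finally have lo: "(\<integral>x. indicator ?B x * (1 + t * nsupport K x - (t * M)\<^sup>2) ^ ?n \<partial>lborel) \<le> vol (A t)"
      by simp
    have "(\<integral>x. indicator ?B x * (1 + t * nsupport K x) ^ ?n \<partial>lborel)
      \<le> (\<integral>x. indicator ?B x * ((1 + 4 ^ ?n * (t * M)\<^sup>2) + (?n * t) * nsupport K x) \<partial>lborel)"
    proof (rule integral_mono)
      show "integrable lborel (\<lambda>x. indicator ?B x * (1 + t * nsupport K x) ^ ?n)"
      proof (rule integral_cball_bound_integrable)
        fix x have "0 \<le> 1 + t * nsupport K x" "1 + t * nsupport K x \<le> 2" using tF[of x] tM by linarith+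
        then show "\<bar>(1 + t * nsupport K x) ^ ?n\<bar> \<le> 2 ^ ?n" by (simp add: power_mono)
      qed measurable
      show "integrable lborel (\<lambda>x. indicator ?B x * ((1 + 4 ^ ?n * (t * M)\<^sup>2) + (?n * t) * nsupport K x))"
      proof (rule integral_cball_bound_integrable)
        fix x
        have "\<bar>(?n * t) * nsupport K x\<bar> \<le> ?n * t * M" using Fb[of x] t by (simp add: abs_mult mult_left_mono)
        moreover have "(0::real) \<le> 4 ^ ?n * (t * M)\<^sup>2" by simp
        ultimately show "\<bar>(1 + 4 ^ ?n * (t * M)\<^sup>2) + (?n * t) * nsupport K x\<bar> \<le> (1 + 4 ^ ?n * (t * M)\<^sup>2) + ?n * t * M" by linarith
      qed measurable
      fix x
      have "(1 + t * nsupport K x) ^ ?n \<le> 1 + ?n * (t * nsupport K x) + 4 ^ ?n * (t * nsupport K x)\<^sup>2"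
        using tF[of x] tM by (intro one_plus_power_le_quadratic) linarith
      also have "(t * nsupport K x)\<^sup>2 \<le> (t * M)\<^sup>2" using tF[of x] tM0 by (simp add: abs_le_square_iff[symmetric])
      finally have "(1 + t * nsupport K x) ^ ?n \<le> (1 + 4 ^ ?n * (t * M)\<^sup>2) + (?n * t) * nsupport K x"
        by (simp add: mult_left_mono)
      then show "indicator ?B x * (1 + t * nsupport K x) ^ ?n \<le> indicator ?B x * ((1 + 4 ^ ?n * (t * M)\<^sup>2) + (?n * t) * nsupport K x)"
        by (intro mult_left_mono) auto
    qed
    also have "\<dots> = (1 + 4 ^ ?n * (t * M)\<^sup>2) * \<kappa> + (?n * t) * I" by (rule intB)
    finally have U: "vol (A t) \<le> (1 + 4 ^ ?n * (t * M)\<^sup>2) * \<kappa> + (?n * t) * I" using up by simp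
    have "(1 - ?n * (t * M)\<^sup>2) * \<kappa> + (?n * t) * I = (\<integral>x. indicator ?B x * ((1 - ?n * (t * M)\<^sup>2) + (?n * t) * nsupport K x) \<partial>lborel)"
      by (rule intB[symmetric])
    also have "\<dots> \<le> (\<integral>x. indicator ?B x * (1 + t * nsupport K x - (t * M)\<^sup>2) ^ ?n \<partial>lborel)"
    proof (rule integral_mono)
      show "integrable lborel (\<lambda>x. indicator ?B x * (1 + t * nsupport K x - (t * M)\<^sup>2) ^ ?n)"
      proof (rule integral_cball_bound_integrable)
        fix x have "0 \<le> 1 + t * nsupport K x - (t * M)\<^sup>2" "1 + t * nsupport K x - (t * M)\<^sup>2 \<le> 2"
          using tF[of x] tM tM2 zero_le_power2[of "t * M"] by linarith+
        then show "\<bar>(1 + t * nsupport K x - (t * M)\<^sup>2) ^ ?n\<bar> \<le> 2 ^ ?n" by (simp add: power_mono)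
      qed measurable
      show "integrable lborel (\<lambda>x. indicator ?B x * ((1 - ?n * (t * M)\<^sup>2) + (?n * t) * nsupport K x))"
      proof (rule integral_cball_bound_integrable)
        fix x
        have "\<bar>(?n * t) * nsupport K x\<bar> \<le> ?n * t * M" using Fb[of x] t by (simp add: abs_mult mult_left_mono)
        then show "\<bar>(1 - ?n * (t * M)\<^sup>2) + (?n * t) * nsupport K x\<bar> \<le> \<bar>1 - ?n * (t * M)\<^sup>2\<bar> + ?n * t * M" by linarith
      qed measurable
      fix x
      have "1 + real ?n * (t * nsupport K x - (t * M)\<^sup>2) \<le> (1 + (t * nsupport K x - (t * M)\<^sup>2)) ^ ?n"
        using tF[of x] tM tM2 by (intro Bernoulli_inequality) linarith
      then have "(1 - ?n * (t * M)\<^sup>2) + (?n * t) * nsupport K x \<le> (1 + t * nsupport K x - (t * M)\<^sup>2) ^ ?n"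
        by (simp add: algebra_simps)
      then show "indicator ?B x * ((1 - ?n * (t * M)\<^sup>2) + (?n * t) * nsupport K x) \<le> indicator ?B x * (1 + t * nsupport K x - (t * M)\<^sup>2) ^ ?n"
        by (intro mult_left_mono) auto
    qed
    finally have Lo: "(1 - ?n * (t * M)\<^sup>2) * \<kappa> + (?n * t) * I \<le> vol (A t)" using lo by simp
    have sandwich: "\<bar>v - k - l\<bar> \<le> e + f" if "v \<le> k + e + l" "k - f + l \<le> v" "0 \<le> e" "0 \<le> f" for v k l e f :: real
      using that by linarith
    have "\<bar>vol (A t) - \<kappa> - ?n * t * I\<bar> \<le> 4 ^ ?n * (t * M)\<^sup>2 * \<kappa> + ?n * (t * M)\<^sup>2 * \<kappa>"
    proof (rule sandwich)
      have "(1 + 4 ^ ?n * (t * M)\<^sup>2) * \<kappa> = \<kappa> + 4 ^ ?n * (t * M)\<^sup>2 * \<kappa>" by (simp add: algebra_simps)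
      then show "vol (A t) \<le> \<kappa> + 4 ^ ?n * (t * M)\<^sup>2 * \<kappa> + ?n * t * I" using U by (simp only:)
      have "(1 - ?n * (t * M)\<^sup>2) * \<kappa> = \<kappa> - ?n * (t * M)\<^sup>2 * \<kappa>" by (simp add: algebra_simps)
      then show "\<kappa> - ?n * (t * M)\<^sup>2 * \<kappa> + ?n * t * I \<le> vol (A t)" using Lo by (simp only:)
    qed (use k0 in auto)
    also have "\<dots> = ?C * t\<^sup>2" by (simp add: power_mult_distrib algebra_simps)
    also have "vol (A t) - \<kappa> - ?n * t * I = poly (p - [:\<kappa>, ?n * I:]) t" using volA[OF t(1)] by simp
    finally show ?thesis .
  qed
  have "coeff (p - [:\<kappa>, ?n * I:]) 1 = 0" by (rule poly_linear_coeffs_zero[OF d0 main])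
  moreover have "coeff p 1 = unit_ball_vol (real (?n - 1)) * intrinsic_volumes K 1"
    using n by (simp add: p_def coeff_sum)
  ultimately show ?thesis by (simp add: I_def)
qed

section \<open>Blaschke's rolling theorem\<close>

text \<open>
  The points x with |x|^2 + 2 h |x'| \<le> l^2, where x' is the component across the axis e, form a
  spindle with vertices \<plusminus>l e that is generated by circular arcs of radius sqrt (h^2 + l^2) > L.
  Were it not contained in the interior of K, the flattest arc reaching a
  point outside of the interior would touch the boundary of K from inside there, which is impossible because
  K lies locally in a ball of the smaller radius L.
\<close>

lemma lens_in_interior:
  fixes K :: "'a::euclidean_space set" and e o' :: 'a
  assumes K: "convex K" "closed K"
    and loc: "\<And>p. p \<in> frontier K \<Longrightarrow> \<exists>U c. open U \<and> p \<in> U \<and> p \<in> sphere c L \<and> U \<inter> K \<subseteq> cball c L"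
    and L: "L > 0" and e: "norm e = 1" and l: "l > 0"
    and ends: "o' - l *\<^sub>R e \<in> interior K" "o' + l *\<^sub>R e \<in> interior K"
    and h: "h \<ge> 0" "L\<^sup>2 < h\<^sup>2 + l\<^sup>2"
    and y: "(norm y)\<^sup>2 + 2 * h * norm (y - (y \<bullet> e) *\<^sub>R e) \<le> l\<^sup>2"
  shows "o' + y \<in> interior K"
proof (rule ccontr)
  assume notin: "o' + y \<notin> interior K"
  define P where "P y = y - (y \<bullet> e) *\<^sub>R e" for y
  define Z where "Z = {y. (norm y)\<^sup>2 + 2 * h * norm (P y) \<le> l\<^sup>2 \<and> o' + y \<notin> interior K}"
  have ee: "e \<bullet> e = 1" using e by (simp add: dot_square_norm)
  have Pscale: "P (c *\<^sub>R y) = c *\<^sub>R P y" for c y by (simp add: P_def algebra_simps)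
  have contP: "continuous_on A P" for A unfolding P_def by (intro continuous_intros)
  have yZ: "y \<in> Z" using y notin by (simp add: Z_def P_def)
  have Zbd: "norm y \<le> l" if "y \<in> Z" for y
  proof -
    have "0 \<le> 2 * h * norm (P y)" using h by simp
    then have "(norm y)\<^sup>2 \<le> l\<^sup>2" using that unfolding Z_def by (simp; linarith)
    then show ?thesis using power2_le_imp_le[of "norm y" l] l by simp
  qed
  have "compact Z"
  proof -
    have "closed {y. (norm y)\<^sup>2 + 2 * h * norm (P y) \<le> l\<^sup>2}"
      by (intro closed_Collect_le continuous_intros contP)
    moreover have "closed {y. o' + y \<notin> interior K}"
    proof -
      have "{y. o' + y \<notin> interior K} = (\<lambda>y. o' + y) -` (- interior K)" by auto
      then show ?thesis by (simp only:) (intro closed_vimage continuous_intros, auto)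
    qed
    ultimately have "closed Z" unfolding Z_def by (rule closed_Collect_conj)
    moreover have "bounded Z" using Zbd by (auto simp: bounded_iff)
    ultimately show ?thesis by (simp add: compact_eq_bounded_closed)
  qed
  \<comment> \<open>Points of the axis in question lie on the segment between the two ends, which
    are interior, so Z stays off the axis and the quotient below is continuous on Z.\<close>
  have PZ: "norm (P y) > 0" if "y \<in> Z" for y
  proof (rule ccontr)
    assume "\<not> norm (P y) > 0"
    then have ye: "y = (y \<bullet> e) *\<^sub>R e" by (simp add: P_def)
    define s where "s = y \<bullet> e"
    have "\<bar>s\<bar> \<le> l" using Zbd[OF that] ye e by (metis norm_scaleR mult_1_right s_def)
    have "((1 - s / l) / 2) *\<^sub>R (o' - l *\<^sub>R e) + ((1 + s / l) / 2) *\<^sub>R (o' + l *\<^sub>R e) \<in> interior K"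
    proof (rule convexD[OF convex_interior[OF K(1)] ends])
      show "0 \<le> (1 - s / l) / 2" "0 \<le> (1 + s / l) / 2"
        using \<open>\<bar>s\<bar> \<le> l\<close> l by (simp_all add: field_simps abs_le_iff)
    qed (simp add: field_simps)
    moreover have "((1 - s / l) / 2) *\<^sub>R (o' - l *\<^sub>R e) + ((1 + s / l) / 2) *\<^sub>R (o' + l *\<^sub>R e)
      = ((1 - s / l) / 2 + (1 + s / l) / 2) *\<^sub>R o' + (((1 + s / l) / 2 - (1 - s / l) / 2) * l) *\<^sub>R e"
      by (simp add: algebra_simps)
    moreover have "(1 - s / l) / 2 + (1 + s / l) / 2 = 1" "((1 + s / l) / 2 - (1 - s / l) / 2) * l = s"
      using l by (simp_all add: field_simps)
    ultimately have "o' + s *\<^sub>R e \<in> interior K" by simp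
    then show False using that ye by (simp add: Z_def s_def)
  qed
  \<comment> \<open>The parameter of the arc through y; larger values belong to smaller lenses. At
    the maximum over Z the lens touches the complement of the interior of K in y1, while points
    strictly inside it are not in Z.\<close>
  define \<eta> where "\<eta> y = (l\<^sup>2 - (norm y)\<^sup>2) / (2 * norm (P y))" for y
  have "continuous_on Z \<eta>"
    unfolding \<eta>_def using PZ by (intro continuous_intros contP) force
  then obtain y1 where y1: "y1 \<in> Z" "\<And>y. y \<in> Z \<Longrightarrow> \<eta> y \<le> \<eta> y1"
    using continuous_attains_sup[OF \<open>compact Z\<close>] yZ by (metis empty_iff)
  define h1 where "h1 = \<eta> y1"
  have P1: "norm (P y1) > 0" by (rule PZ[OF y1(1)])
  have h1h: "h1 \<ge> h" using y1(1) P1 by (simp add: h1_def \<eta>_def Z_def le_divide_eq)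
  have h10: "h1 \<ge> 0" using h1h h by simp
  have psi1: "(norm y1)\<^sup>2 + 2 * h1 * norm (P y1) = l\<^sup>2" 
  proof -
    have "2 * h1 * norm (P y1) = l\<^sup>2 - (norm y1)\<^sup>2" using P1 by (simp add: h1_def \<eta>_def)
    then show ?thesis by linarith
  qed
  \<comment> \<open>For s < 1 the point s y satisfies the inequality strictly, so its parameter
    exceeds the maximum h1 and it cannot belong to Z. Closedness of K then allows s to tend to
    1.\<close>
  have inK: "o' + y \<in> K" if Py: "norm (P y) > 0" and ps: "(norm y)\<^sup>2 + 2 * h1 * norm (P y) \<le> l\<^sup>2" for y
  proof -
    have int: "o' + s *\<^sub>R y \<in> interior K" if s: "0 < s" "s < 1" for s
    proof (rule ccontr)
      assume ni: "o' + s *\<^sub>R y \<notin> interior K"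
      have y0: "norm y > 0" using Py by (auto simp: P_def)
      have s2: "s\<^sup>2 < s" using s by (simp add: power2_eq_square)
      have n1: "(norm (s *\<^sub>R y))\<^sup>2 < s * (norm y)\<^sup>2"
        using s2 y0 by (simp add: power_mult_distrib)
      have n2: "2 * h1 * norm (P (s *\<^sub>R y)) = s * (2 * h1 * norm (P y))" using s by (simp add: Pscale)
      have "s * ((norm y)\<^sup>2 + 2 * h1 * norm (P y)) \<le> s * l\<^sup>2" using ps s by (intro mult_left_mono) auto
      moreover have "s * l\<^sup>2 < l\<^sup>2" using s l by simp
      ultimately have lt: "(norm (s *\<^sub>R y))\<^sup>2 + 2 * h1 * norm (P (s *\<^sub>R y)) < l\<^sup>2"
        using n1 n2 by (simp only: distrib_left)
      have "2 * h * norm (P (s *\<^sub>R y)) \<le> 2 * h1 * norm (P (s *\<^sub>R y))"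
        using h1h by (intro mult_right_mono) auto
      then have sZ: "s *\<^sub>R y \<in> Z" using lt ni unfolding Z_def by (simp; linarith)
      have "norm (P (s *\<^sub>R y)) > 0" using Py s by (simp add: Pscale)
      then have "\<eta> (s *\<^sub>R y) > h1" using lt by (simp add: \<eta>_def less_divide_eq)
      then show False using y1(2)[OF sZ] by (simp add: h1_def)
    qed
    have lim: "((\<lambda>s. o' + s *\<^sub>R y) \<longlongrightarrow> o' + 1 *\<^sub>R y) (at_left 1)" by (intro tendsto_intros)
    have "eventually (\<lambda>s::real. 0 < s \<and> s < 1) (at_left 1)"
      unfolding eventually_at_left_field by (intro exI[of _ 0]) auto
    then have "eventually (\<lambda>s. o' + s *\<^sub>R y \<in> K) (at_left 1)"
      by eventually_elim (use int interior_subset in blast)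
    then show ?thesis using Lim_in_closed_set[OF K(2) _ _ lim] by simp
  qed
  define p where "p = o' + y1"
  have "p \<in> K" unfolding p_def using inK[OF P1] psi1 by simp
  moreover have "p \<notin> interior K" using y1(1) by (simp add: Z_def p_def)
  ultimately have "p \<in> frontier K" using K(2) by (simp add: frontier_def)
  then obtain U c where U: "open U" "p \<in> U" "p \<in> sphere c L" "U \<inter> K \<subseteq> cball c L" using loc by blast
  define \<nu> where "\<nu> = P y1 /\<^sub>R norm (P y1)"
  have nn: "\<nu> \<bullet> \<nu> = 1" using P1 by (simp add: \<nu>_def dot_square_norm[symmetric] power2_norm_eq_inner[symmetric] power2_eq_square)
  have ne: "\<nu> \<bullet> e = 0" using ee by (simp add: \<nu>_def P_def inner_diff_left)
  \<comment> \<open>The equation of y1 says that p lies on the circle with centre m and radius r > L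
    in the plane of e and \<nu>. The unit vector \<omega> points from m to p, \<omega>' is tangent
    there, and z runs along the arc.\<close>
  define m where "m = o' - h1 *\<^sub>R \<nu>"
  define r where "r = sqrt (h1\<^sup>2 + l\<^sup>2)"
  have r: "r > 0" "r\<^sup>2 = h1\<^sup>2 + l\<^sup>2" using l by (auto simp: r_def add_nonneg_pos)
  have rL: "L\<^sup>2 < r\<^sup>2" using h h1h power_mono[OF h1h h(1), of 2] r(2) by linarith
  define \<alpha> where "\<alpha> = (y1 \<bullet> e) / r"
  define \<beta> where "\<beta> = (norm (P y1) + h1) / r"
  have y1_eq: "y1 = (y1 \<bullet> e) *\<^sub>R e + norm (P y1) *\<^sub>R \<nu>"
    using P1 by (simp add: \<nu>_def) (simp add: P_def)
  have ab: "\<alpha>\<^sup>2 + \<beta>\<^sup>2 = 1"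
  proof -
    have "(norm y1)\<^sup>2 = (y1 \<bullet> e)\<^sup>2 + (norm (P y1))\<^sup>2"
    proof -
      have "y1 \<bullet> y1 = ((y1 \<bullet> e) *\<^sub>R e + norm (P y1) *\<^sub>R \<nu>) \<bullet> ((y1 \<bullet> e) *\<^sub>R e + norm (P y1) *\<^sub>R \<nu>)"
        using y1_eq by simp
      also have "\<dots> = (y1 \<bullet> e)\<^sup>2 + (norm (P y1))\<^sup>2"
        using ee nn ne by (simp add: inner_add_left inner_add_right inner_commute[of e \<nu>] power2_eq_square)
      finally show ?thesis by (simp add: power2_norm_eq_inner)
    qed
    then have "(y1 \<bullet> e)\<^sup>2 + (norm (P y1) + h1)\<^sup>2 = r\<^sup>2"
      using psi1 r(2) by (simp add: power2_sum mult.commute[of _ h1])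
    then show ?thesis unfolding \<alpha>_def \<beta>_def using r(1) by (simp add: power_divide add_divide_distrib[symmetric])
  qed
  define \<omega> where "\<omega> = \<alpha> *\<^sub>R e + \<beta> *\<^sub>R \<nu>"
  define \<omega>' where "\<omega>' = \<alpha> *\<^sub>R \<nu> - \<beta> *\<^sub>R e"
  define z where "z t = m + r *\<^sub>R (cos t *\<^sub>R \<omega> + sin t *\<^sub>R \<omega>')" for t
  define co where "co t = r * (cos t * \<beta> + sin t * \<alpha>) - h1" for t
  have p_eq: "p = m + r *\<^sub>R \<omega>"
  proof -
    have "r *\<^sub>R \<omega> = (y1 \<bullet> e) *\<^sub>R e + (norm (P y1) + h1) *\<^sub>R \<nu>"
      using r(1) by (simp add: \<omega>_def \<alpha>_def \<beta>_def scaleR_add_right)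
    then show ?thesis unfolding p_def m_def by (subst y1_eq) (simp add: algebra_simps)
  qed
  have zy: "z t = o' + ((r * (cos t * \<alpha> - sin t * \<beta>)) *\<^sub>R e + co t *\<^sub>R \<nu>)" for t
    by (simp add: z_def m_def \<omega>_def \<omega>'_def co_def algebra_simps)
  have zK: "z t \<in> K" if "co t > 0" for t
    unfolding zy
  proof (rule inK)
    let ?y = "(r * (cos t * \<alpha> - sin t * \<beta>)) *\<^sub>R e + co t *\<^sub>R \<nu>"
    have "?y \<bullet> e = r * (cos t * \<alpha> - sin t * \<beta>)" using ee ne by (simp add: inner_add_left)
    then have Py: "P ?y = co t *\<^sub>R \<nu>" by (simp add: P_def)
    have n\<nu>: "norm \<nu> = 1" using nn by (simp add: norm_eq_sqrt_inner)
    then have nPy: "norm (P ?y) = co t" using that by (simp add: Py)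
    then show "norm (P ?y) > 0" using that by simp
    have "(norm ?y)\<^sup>2 = (r * (cos t * \<alpha> - sin t * \<beta>))\<^sup>2 + (co t)\<^sup>2"
      unfolding power2_norm_eq_inner using ee nn ne
      by (simp add: inner_add_left inner_add_right inner_commute[of e \<nu>] power2_eq_square)
    then have "(norm ?y)\<^sup>2 + 2 * h1 * norm (P ?y) = (r * (cos t * \<alpha> - sin t * \<beta>))\<^sup>2 + (co t + h1)\<^sup>2 - h1\<^sup>2"
      by (simp add: nPy power2_sum)
    also have "\<dots> = r\<^sup>2 * ((cos t * \<alpha> - sin t * \<beta>)\<^sup>2 + (cos t * \<beta> + sin t * \<alpha>)\<^sup>2) - h1\<^sup>2"
    proof -
      have "(r * X)\<^sup>2 + (r * Y)\<^sup>2 = r\<^sup>2 * (X\<^sup>2 + Y\<^sup>2)" for X Y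
        by (simp add: power_mult_distrib distrib_left)
      moreover have "co t + h1 = r * (cos t * \<beta> + sin t * \<alpha>)" by (simp add: co_def)
      ultimately show ?thesis by simp
    qed
    also have "(cos t * \<alpha> - sin t * \<beta>)\<^sup>2 + (cos t * \<beta> + sin t * \<alpha>)\<^sup>2 = ((cos t)\<^sup>2 + (sin t)\<^sup>2) * (\<alpha>\<^sup>2 + \<beta>\<^sup>2)"
    proof -
      have "(C * \<alpha> - S * \<beta>)\<^sup>2 + (C * \<beta> + S * \<alpha>)\<^sup>2 = (C\<^sup>2 + S\<^sup>2) * (\<alpha>\<^sup>2 + \<beta>\<^sup>2)" for C S
        by (simp add: power2_eq_square algebra_simps)
      then show ?thesis .
    qed
    also have "\<dots> = 1" by (simp add: ab)
    finally show "(norm ?y)\<^sup>2 + 2 * h1 * norm (P ?y) \<le> l\<^sup>2" using r(2) by simp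
  qed
  have "\<exists>t. 0 < t \<and> t \<le> 1 \<and> co t > 0 \<and> co (-t) > 0 \<and> z t \<in> U \<and> z (-t) \<in> U"
  proof -
    let ?O = "{t. co t > 0} \<inter> {t. co (-t) > 0} \<inter> z -` U \<inter> (\<lambda>t. z (-t)) -` U"
    have "open ?O" unfolding co_def z_def
      by (intro open_Int open_Collect_less open_vimage U(1) continuous_intros)
    moreover have "0 \<in> ?O" using U(2) P1 r(1) p_eq by (simp add: co_def \<beta>_def z_def)
    ultimately obtain d where d: "d > 0" "ball 0 d \<subseteq> ?O" using openE by blast
    define t where "t = min (d / 2) 1"
    have "t \<in> ?O" using d by (intro subsetD[OF d(2)]) (simp add: t_def dist_norm)
    then show ?thesis using d(1) by (intro exI[of _ t]) (auto simp: t_def)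
  qed
  then obtain t where t: "0 < t" "t \<le> 1" "co t > 0" "co (-t) > 0" "z t \<in> U" "z (-t) \<in> U" by blast
  define D where "D = m - c"
  have ww: "\<omega> \<bullet> \<omega> = 1" "\<omega>' \<bullet> \<omega>' = 1" "\<omega> \<bullet> \<omega>' = 0"
    using ab ee nn ne unfolding \<omega>_def \<omega>'_def
    by (simp_all add: inner_add_left inner_add_right inner_diff_left inner_diff_right inner_commute[of e \<nu>] power2_eq_square)
  have dz: "(norm (z t - c))\<^sup>2 = D \<bullet> D + r\<^sup>2 + 2 * r * (cos t * (D \<bullet> \<omega>) + sin t * (D \<bullet> \<omega>'))" for t
  proof -
    let ?w = "cos t *\<^sub>R \<omega> + sin t *\<^sub>R \<omega>'"
    have "?w \<bullet> ?w = (cos t)\<^sup>2 + (sin t)\<^sup>2"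
      using ww by (simp add: inner_add_left inner_add_right inner_commute[of \<omega>' \<omega>] power2_eq_square)
    then have w1: "?w \<bullet> ?w = 1" by simp
    have "z t - c = D + r *\<^sub>R ?w" by (simp add: z_def D_def)
    moreover have "(norm (D + r *\<^sub>R w))\<^sup>2 = D \<bullet> D + 2 * r * (D \<bullet> w) + r * r * (w \<bullet> w)" for w
      unfolding power2_norm_eq_inner by (simp add: inner_add_left inner_add_right inner_commute[of w D] algebra_simps)
    ultimately have "(norm (z t - c))\<^sup>2 = D \<bullet> D + 2 * r * (D \<bullet> ?w) + r * r * (?w \<bullet> ?w)" by simp
    then show ?thesis unfolding w1 by (simp add: inner_add_right power2_eq_square)
  qed
  have le: "(norm (z s - c))\<^sup>2 \<le> L\<^sup>2" if "co s > 0" "z s \<in> U" for s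
  proof -
    have "z s \<in> cball c L" using U(4) zK[OF that(1)] that(2) by blast
    then show ?thesis by (intro power_mono) (auto simp: dist_norm norm_minus_commute)
  qed
  have eq: "D \<bullet> D + r\<^sup>2 + 2 * r * (D \<bullet> \<omega>) = L\<^sup>2"
  proof -
    have "norm (z 0 - c) = L" using U(3) p_eq by (simp add: z_def dist_norm norm_minus_commute)
    then show ?thesis using dz[of 0] by simp
  qed
  \<comment> \<open>Adding the bounds at t and -t cancels the sine terms, and comparison with the
    equation at 0 forces D \<bullet> \<omega> \<ge> 0. Then the left side of that equation is at
    least r^2 > L^2.\<close>
  have "cos t < 1" using cos_monotone_0_pi[of 0 t] t(1,2) pi_gt3 by simp
  have "D \<bullet> D + r\<^sup>2 + 2 * r * (cos t * (D \<bullet> \<omega>)) \<le> L\<^sup>2"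
    using le[OF t(3,5)] le[OF t(4,6)] unfolding dz by (simp add: distrib_left right_diff_distrib)
  with eq have "r * (cos t * (D \<bullet> \<omega>)) \<le> r * (D \<bullet> \<omega>)" by linarith
  then have "cos t * (D \<bullet> \<omega>) \<le> D \<bullet> \<omega>" using r(1) by simp
  then have "(1 - cos t) * (D \<bullet> \<omega>) \<ge> 0" by (simp add: algebra_simps)
  then have "D \<bullet> \<omega> \<ge> 0" using \<open>cos t < 1\<close> by (simp add: zero_le_mult_iff)
  then have "r * (D \<bullet> \<omega>) \<ge> 0" using r(1) by simp
  then show False using eq rL inner_ge_zero[of D] by linarith
qed

text \<open>Here 2 l is the distance from q to a point b of K, and s is the depth of b below the
  support hyperplane at q; s L < 2 l^2 says that b is outside the touching ball. The radius sqrt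
  (h^2 + l^2) must exceed L, and the bound on h' makes the arc leave q upwards. For s > 0 the
  critical value H has H^2 + l^2 = (2 l^2 / s)^2 > L^2, so there is room for both.\<close>

lemma lens_parameter:
  assumes L: "L > 0" and l: "l > 0" and s: "0 \<le> s" "s * L < 2 * l\<^sup>2" "s < 2 * l"
  obtains h h' where "0 \<le> h" "h < h'" "L\<^sup>2 < h\<^sup>2 + l\<^sup>2" "h' * s < 2 * l\<^sup>2 * sqrt (1 - s\<^sup>2 / (4 * l\<^sup>2))"
proof -
  define \<rho> where "\<rho> = sqrt (1 - s\<^sup>2 / (4 * l\<^sup>2))"
  have "s\<^sup>2 < (2 * l)\<^sup>2" using s by (intro power_strict_mono) auto
  then have r1: "0 < 1 - s\<^sup>2 / (4 * l\<^sup>2)" using l by (simp add: power_mult_distrib)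
  then have r0: "\<rho> > 0" "\<rho>\<^sup>2 = 1 - s\<^sup>2 / (4 * l\<^sup>2)" by (simp_all add: \<rho>_def)
  define h0 where "h0 = sqrt (max 0 (L\<^sup>2 - l\<^sup>2))"
  have h0: "h0 \<ge> 0" "h0\<^sup>2 \<ge> L\<^sup>2 - l\<^sup>2" by (simp_all add: h0_def)
  obtain H where H: "h0 < H" "H * s \<le> 2 * l\<^sup>2 * \<rho>"
  proof (cases "s = 0")
    case True
    then show ?thesis using r0 by (intro that[of "h0 + 1"]) auto
  next
    case False
    then have s0: "s > 0" using s by simp
    define H where "H = 2 * l\<^sup>2 * \<rho> / s"
    have Hp: "H > 0" using s0 r0 l by (simp add: H_def)
    have "H\<^sup>2 = 4 * (l\<^sup>2)\<^sup>2 * (1 - s\<^sup>2 / (4 * l\<^sup>2)) / s\<^sup>2"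
      by (simp add: H_def power_divide power_mult_distrib r0(2))
    also have "\<dots> = (2 * l\<^sup>2 / s)\<^sup>2 - l\<^sup>2"
      using s0 l by (simp add: field_simps power2_eq_square)
    finally have H2: "H\<^sup>2 = (2 * l\<^sup>2 / s)\<^sup>2 - l\<^sup>2" .
    have "L < 2 * l\<^sup>2 / s" using s(2) s0 by (simp add: less_divide_eq mult.commute)
    then have "L\<^sup>2 < (2 * l\<^sup>2 / s)\<^sup>2" using L by (intro power_strict_mono) auto
    then have "L\<^sup>2 - l\<^sup>2 < H\<^sup>2" using H2 by linarith
    moreover have "0 < H\<^sup>2" using Hp by simp
    ultimately have "max 0 (L\<^sup>2 - l\<^sup>2) < H\<^sup>2" by (simp only: max_less_iff_conj)
    then have "h0 < H" using Hp unfolding h0_def by (intro real_less_lsqrt) auto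
    then show ?thesis using s0 by (intro that[of H]) (auto simp: H_def)
  qed
  define h where "h = (h0 + H) / 2"
  define h' where "h' = (h + H) / 2"
  have hh: "h0 < h" "h < h'" "h' < H" using H(1) by (auto simp: h_def h'_def field_simps)
  have "h0\<^sup>2 < h\<^sup>2" using hh h0 by (intro power_strict_mono) auto
  then have 1: "L\<^sup>2 < h\<^sup>2 + l\<^sup>2" using h0 by linarith
  have 2: "h' * s < 2 * l\<^sup>2 * \<rho>"
  proof (cases "s = 0")
    case True then show ?thesis using r0 l by simp
  next
    case False
    then have "h' * s < H * s" using hh s by (intro mult_strict_right_mono) auto
    then show ?thesis using H(2) by simp
  qed
  show ?thesis using that[of h h'] hh h0 1 2 unfolding \<rho>_def by simp
qed

text \<open>
  If b in K is outside of the ball, then some arc from q to b as in the previous lemma starts at q in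
  a direction with positive u-component, and this contradicts the maximality of q.
\<close>

lemma subset_normal_ball:
  fixes K :: "'a::euclidean_space set"
  assumes dim: "DIM('a) \<ge> 2" and K: "convex K" "closed K" "interior K \<noteq> {}"
    and loc: "\<And>p. p \<in> frontier K \<Longrightarrow> \<exists>U c. open U \<and> p \<in> U \<and> p \<in> sphere c L \<and> U \<inter> K \<subseteq> cball c L"
    and L: "L > 0" and u: "norm u = 1" and q: "q \<in> K" "\<And>k. k \<in> K \<Longrightarrow> k \<bullet> u \<le> q \<bullet> u"
  shows "K \<subseteq> cball (q - L *\<^sub>R u) L"
proof (rule ccontr)
  assume "\<not> K \<subseteq> cball (q - L *\<^sub>R u) L"
  then obtain b0 where b0: "b0 \<in> K" "b0 \<notin> cball (q - L *\<^sub>R u) L" by blast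
  let ?O = "interior K \<inter> - cball (q - L *\<^sub>R u) L"
  have "open ?O" by auto
  have "closure (interior K) = K" using convex_closure_interior[OF K(1,3)] K(2) by simp
  moreover have "open (- cball (q - L *\<^sub>R u) L)" by (simp add: open_Compl)
  ultimately have "- cball (q - L *\<^sub>R u) L \<inter> interior K \<noteq> {}"
    using b0 open_Int_closure_eq_empty[of "- cball (q - L *\<^sub>R u) L" "interior K"] by auto
  then obtain b1 where b1: "b1 \<in> ?O" by blast
  \<comment> \<open>Moving b off the normal line at q makes the Cauchy-Schwarz inequality for b - q
    and u strict, hence s < 2 l and \<rho> > 0.\<close>
  obtain b where b: "b \<in> ?O" "\<And>s. b - q \<noteq> s *\<^sub>R u"
  proof (cases "\<exists>s. b1 - q = s *\<^sub>R u")
    case False then show ?thesis using b1 that by blast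
  next
    case True
    then obtain s1 where s1: "b1 - q = s1 *\<^sub>R u" by blast
    obtain v where v: "v \<noteq> 0" "orthogonal u v" using orthogonal_to_vector_exists[OF dim] by blast
    obtain d where d: "d > 0" "ball b1 d \<subseteq> ?O" using openE[OF \<open>open ?O\<close> b1] by blast
    define \<delta> where "\<delta> = d / (2 * norm v)"
    have dv: "\<delta> > 0" "norm (\<delta> *\<^sub>R v) = d / 2" using d v by (auto simp: \<delta>_def)
    have "b1 + \<delta> *\<^sub>R v \<in> ?O" using d dv by (intro subsetD[OF d(2)]) (simp add: dist_norm)
    moreover have "b1 + \<delta> *\<^sub>R v - q \<noteq> s *\<^sub>R u" for s
    proof
      assume "b1 + \<delta> *\<^sub>R v - q = s *\<^sub>R u"
      then have "\<delta> *\<^sub>R v = (s - s1) *\<^sub>R u" using s1 by (simp add: algebra_simps)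
      then have "\<delta> * (v \<bullet> v) = (s - s1) * (u \<bullet> v)" by (metis inner_scaleR_left)
      then show False using v dv by (simp add: orthogonal_def)
    qed
    ultimately show ?thesis using that by blast
  qed
  define v where "v = b - q"
  have bint: "b \<in> interior K" using b(1) by simp
  have v0: "v \<noteq> 0" using b(2)[of 0] by (simp add: v_def)
  define l where "l = norm v / 2"
  have l: "l > 0" using v0 by (simp add: l_def)
  have vv: "v \<bullet> v = 4 * l\<^sup>2" by (simp add: l_def power_divide power2_norm_eq_inner)
  define s where "s = - (v \<bullet> u)"
  have uu: "u \<bullet> u = 1" using u by (simp add: dot_square_norm)
  have s0: "s \<ge> 0" using q(2)[of b] interior_subset bint by (auto simp: s_def v_def inner_diff_left)
  have s1: "s * L < 2 * l\<^sup>2"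
  proof -
    have "norm (v + L *\<^sub>R u) > L" using b(1) by (simp add: v_def dist_norm norm_minus_commute algebra_simps)
    then have "(norm (v + L *\<^sub>R u))\<^sup>2 > L\<^sup>2" using L by (intro power_strict_mono) auto
    moreover have "(norm (v + L *\<^sub>R u))\<^sup>2 = 4 * l\<^sup>2 - 2 * L * s + L\<^sup>2"
      unfolding power2_norm_eq_inner
      by (simp add: inner_add_left inner_add_right vv uu s_def inner_commute[of u v] power2_eq_square algebra_simps)
    ultimately show ?thesis by (simp add: mult.commute)
  qed
  have s2: "s < 2 * l"
  proof -
    have "\<bar>v \<bullet> u\<bar> \<noteq> norm v * norm u"
    proof
      assume "\<bar>v \<bullet> u\<bar> = norm v * norm u"
      then have "norm v *\<^sub>R u = norm u *\<^sub>R v \<or> norm v *\<^sub>R u = - norm u *\<^sub>R v" using norm_cauchy_schwarz_abs_eq by metis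
      then have "v = norm v *\<^sub>R u \<or> v = (- norm v) *\<^sub>R u" using u by auto
      then show False using b(2) unfolding v_def by blast
    qed
    then have "\<bar>v \<bullet> u\<bar> < 2 * l" using Cauchy_Schwarz_ineq2[of v u] u by (simp add: l_def)
    then show ?thesis by (simp add: s_def)
  qed
  define \<rho> where "\<rho> = sqrt (1 - s\<^sup>2 / (4 * l\<^sup>2))"
  obtain h h' where h: "0 \<le> h" "h < h'" "L\<^sup>2 < h\<^sup>2 + l\<^sup>2" "h' * s < 2 * l\<^sup>2 * \<rho>"
    using lens_parameter[OF L l s0 s1 s2] unfolding \<rho>_def by blast
  have "s\<^sup>2 < (2 * l)\<^sup>2" using s0 s2 by (intro power_strict_mono) auto
  then have "0 < 1 - s\<^sup>2 / (4 * l\<^sup>2)" using l by (simp add: power_mult_distrib)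
  then have r0: "\<rho> > 0" "\<rho>\<^sup>2 = 1 - s\<^sup>2 / (4 * l\<^sup>2)" by (simp_all add: \<rho>_def)
  define e where "e = (1 / (2 * l)) *\<^sub>R v"
  have ee: "e \<bullet> e = 1" using l by (simp add: e_def vv power2_eq_square)
  have ne: "norm e = 1" using ee by (simp add: norm_eq_sqrt_inner)
  have ve: "v = (2 * l) *\<^sub>R e" using l by (simp add: e_def)
  have eu: "e \<bullet> u = - s / (2 * l)" by (simp add: e_def s_def)
  define \<nu> where "\<nu> = (1 / \<rho>) *\<^sub>R (u - (e \<bullet> u) *\<^sub>R e)"
  have ue2: "(u - (e \<bullet> u) *\<^sub>R e) \<bullet> (u - (e \<bullet> u) *\<^sub>R e) = \<rho>\<^sup>2" "(u - (e \<bullet> u) *\<^sub>R e) \<bullet> u = \<rho>\<^sup>2"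
    "(u - (e \<bullet> u) *\<^sub>R e) \<bullet> e = 0"
  proof -
    have "(e \<bullet> u)\<^sup>2 = s\<^sup>2 / (4 * l\<^sup>2)" by (simp add: eu power_divide power_mult_distrib)
    then have *: "1 - (e \<bullet> u) * (e \<bullet> u) = \<rho>\<^sup>2" using r0(2) by (simp add: power2_eq_square)
    show "(u - (e \<bullet> u) *\<^sub>R e) \<bullet> (u - (e \<bullet> u) *\<^sub>R e) = \<rho>\<^sup>2" "(u - (e \<bullet> u) *\<^sub>R e) \<bullet> u = \<rho>\<^sup>2"
      unfolding *[symmetric] by (simp_all add: inner_diff_left inner_diff_right uu ee inner_commute[of u e])
    show "(u - (e \<bullet> u) *\<^sub>R e) \<bullet> e = 0" by (simp add: inner_diff_left ee inner_commute[of u e])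
  qed
  have nu: "\<nu> \<bullet> \<nu> = 1" "\<nu> \<bullet> u = \<rho>" "\<nu> \<bullet> e = 0"
    using r0(1) ue2 by (simp_all add: \<nu>_def power2_eq_square)
  \<comment> \<open>The tangent at q of the arc with parameter h'. It points strictly into the
    fatter lens with parameter h < h', and w \<bullet> u > 0 is what the bound on h' was chosen
    for.\<close>
  define w where "w = h' *\<^sub>R e + l *\<^sub>R \<nu>"
  have wu: "w \<bullet> u > 0"
  proof -
    have "w \<bullet> u = (2 * l\<^sup>2 * \<rho> - h' * s) / (2 * l)"
      using l by (simp add: w_def inner_add_left eu nu field_simps power2_eq_square)
    then show ?thesis using h(4) l by simp
  qed
  define W where "W = w \<bullet> w"
  have W: "W > 0" using wu by (auto simp: W_def)
  have we: "w \<bullet> e = h'" by (simp add: w_def inner_add_left ee nu)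
  \<comment> \<open>Half of the longest step along w that stays in the lens with parameter h from q
    to b; the other half is slack for the next change.\<close>
  define \<tau> where "\<tau> = l * (h' - h) / W"
  have tau: "\<tau> > 0" "\<tau> * W = l * (h' - h)" using l h W by (auto simp: \<tau>_def)
  define \<gamma> where "\<gamma> = h\<^sup>2 + l\<^sup>2 - L\<^sup>2"
  \<comment> \<open>The point q is not interior, so the lens is shortened to run from q + \<delta>
    (b - q) to b. The second bound on \<delta> keeps q + \<tau> w inside the shortened lens, the
    third keeps its radius above L.\<close>
  define \<delta> where "\<delta> = min (1 / 2) (min (\<tau> * (h' - h) / (4 * l)) (\<gamma> / (4 * l\<^sup>2)))"
  have g: "\<gamma> > 0" using h(3) by (simp add: \<gamma>_def)
  have d: "0 < \<delta>" "\<delta> < 1" "\<delta> * (4 * l) \<le> \<tau> * (h' - h)" "\<delta> * (4 * l\<^sup>2) \<le> \<gamma>"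
  proof -
    show "0 < \<delta>" using tau h l g by (simp add: \<delta>_def)
    show "\<delta> < 1" by (simp add: \<delta>_def)
    have "\<delta> \<le> \<tau> * (h' - h) / (4 * l)" "\<delta> \<le> \<gamma> / (4 * l\<^sup>2)" by (simp_all add: \<delta>_def)
    then show "\<delta> * (4 * l) \<le> \<tau> * (h' - h)" "\<delta> * (4 * l\<^sup>2) \<le> \<gamma>" using l by (simp_all only: le_divide_eq) (simp_all add: le_divide_eq)
  qed
  define la where "la = (1 - \<delta>) * l"
  define o' where "o' = q + ((1 + \<delta>) * l) *\<^sub>R e"
  define y where "y = \<tau> *\<^sub>R w - ((1 + \<delta>) * l) *\<^sub>R e"
  have "o' + y \<in> interior K"
  proof (rule lens_in_interior[OF K(1,2) loc L ne])
    show "la > 0" using d l by (simp add: la_def)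
    have "o' - la *\<^sub>R e = q + ((1 + \<delta>) * l - (1 - \<delta>) * l) *\<^sub>R e"
      by (simp add: o'_def la_def scaleR_left_diff_distrib)
    also have "(1 + \<delta>) * l - (1 - \<delta>) * l = \<delta> * (2 * l)" by (simp add: algebra_simps)
    also have "q + (\<delta> * (2 * l)) *\<^sub>R e = q - \<delta> *\<^sub>R (q - b)" 
    proof -
      have "(\<delta> * (2 * l)) *\<^sub>R e = \<delta> *\<^sub>R v" by (simp add: ve)
      then show ?thesis by (simp add: v_def scaleR_diff_right)
    qed
    also have "\<dots> \<in> interior K" using d q(1) bint by (intro mem_interior_convex_shrink K(1)) auto
    finally show "o' - la *\<^sub>R e \<in> interior K" .
    have "o' + la *\<^sub>R e = q + ((1 + \<delta>) * l + (1 - \<delta>) * l) *\<^sub>R e"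
      by (simp add: o'_def la_def scaleR_left_distrib)
    also have "(1 + \<delta>) * l + (1 - \<delta>) * l = 2 * l" by (simp add: algebra_simps)
    finally have "o' + la *\<^sub>R e = q + v" by (simp add: ve)
    then show "o' + la *\<^sub>R e \<in> interior K" using bint by (simp add: v_def)
    show "h \<ge> 0" by (rule h)
    have "la\<^sup>2 \<ge> l\<^sup>2 - 2 * \<delta> * l\<^sup>2"
    proof -
      have "la\<^sup>2 = l\<^sup>2 - 2 * \<delta> * l\<^sup>2 + \<delta>\<^sup>2 * l\<^sup>2" by (simp add: la_def power2_eq_square algebra_simps)
      then show ?thesis by simp
    qed
    then show "L\<^sup>2 < h\<^sup>2 + la\<^sup>2" using d(4) g by (simp add: \<gamma>_def)
    have ye: "y - (y \<bullet> e) *\<^sub>R e = (\<tau> * l) *\<^sub>R \<nu>"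
    proof -
      have "y \<bullet> e = \<tau> * h' - (1 + \<delta>) * l" by (simp add: y_def inner_diff_left we ee)
      moreover have "y = (\<tau> * h' - (1 + \<delta>) * l) *\<^sub>R e + (\<tau> * l) *\<^sub>R \<nu>"
        by (simp add: y_def w_def scaleR_add_right scaleR_left_diff_distrib)
      ultimately show ?thesis by simp
    qed
    have nnu: "norm \<nu> = 1" using nu by (simp add: norm_eq_sqrt_inner)
    have np: "norm (y - (y \<bullet> e) *\<^sub>R e) = \<tau> * l" unfolding ye using nnu tau l by simp
    have ny: "(norm y)\<^sup>2 = \<tau>\<^sup>2 * W - 2 * \<tau> * ((1 + \<delta>) * l) * h' + ((1 + \<delta>) * l)\<^sup>2"
      unfolding power2_norm_eq_inner
      by (simp add: y_def inner_diff_left inner_diff_right W_def[symmetric] we ee inner_commute[of e w])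
         (simp add: power2_eq_square algebra_simps)
    have "(norm y)\<^sup>2 + 2 * h * (\<tau> * l) - la\<^sup>2 = \<tau> * (\<tau> * W) - 2 * \<tau> * l * (h' - h) - 2 * \<tau> * \<delta> * l * h' + 4 * \<delta> * l\<^sup>2"
      unfolding ny la_def by (simp add: power2_eq_square algebra_simps)
    also have "\<dots> = - l * (\<tau> * (h' - h) - \<delta> * (4 * l)) - 2 * \<tau> * \<delta> * l * h'"
      unfolding tau(2) by (simp add: power2_eq_square algebra_simps)
    also have "\<dots> \<le> 0"
    proof -
      have "0 \<le> l * (\<tau> * (h' - h) - \<delta> * (4 * l))" using l d(3) by simp
      moreover have "0 \<le> 2 * \<tau> * \<delta> * l * h'" using tau d l h by simp
      ultimately show ?thesis unfolding mult_minus_left by linarith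
    qed
    finally show "(norm y)\<^sup>2 + 2 * h * norm (y - (y \<bullet> e) *\<^sub>R e) \<le> la\<^sup>2" unfolding np by simp
  qed
  then have "(o' + y) \<bullet> u \<le> q \<bullet> u" using q(2) interior_subset by blast
  moreover have "o' + y = q + \<tau> *\<^sub>R w" by (simp add: o'_def y_def)
  ultimately have "\<tau> * (w \<bullet> u) \<le> 0" by (simp add: inner_add_left)
  then show False using tau(1) wu by (simp add: mult_le_0_iff)
qed

section \<open>Circumscribed balls and spindles\<close>

lemma power2_norm_diff: "(norm (a - b))\<^sup>2 = (norm a)\<^sup>2 - 2 * (a \<bullet> b) + (norm (b::'a::real_inner))\<^sup>2"
  unfolding power2_norm_eq_inner by (simp add: inner_diff_left inner_diff_right inner_commute)

lemma power2_norm_add: "(norm (a + b))\<^sup>2 = (norm a)\<^sup>2 + 2 * (a \<bullet> b) + (norm (b::'a::real_inner))\<^sup>2"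
  unfolding power2_norm_eq_inner by (simp add: inner_add_left inner_add_right inner_commute)

text \<open>\<open>LEAST\<close> over the reals is only meaningful if the minimum exists. The
  admissible pairs of a centre and a radius at most r1 form a compact set.\<close>

lemma circumradius_attained:
  fixes K :: "(real^'n) set"
  assumes K: "compact K" "K \<noteq> {}"
  obtains c where "K \<subseteq> cball c (circumradius K)" "0 \<le> circumradius K"
    "\<And>c' r. 0 \<le> r \<Longrightarrow> K \<subseteq> cball c' r \<Longrightarrow> circumradius K \<le> r"
proof -
  obtain k0 where k0: "k0 \<in> K" using K by blast
  obtain r1 where r1: "r1 > 0" "K \<subseteq> cball 0 r1"
    using compact_imp_bounded[OF K(1)] by (metis bounded_pos mem_cball_0 subsetI)
  define Z where "Z = {p :: (real^'n) \<times> real. 0 \<le> snd p} \<inter> {p. snd p \<le> r1} \<inter> (\<Inter>k\<in>K. {p. dist (fst p) k \<le> snd p})"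
  have "closed Z" unfolding Z_def
    by (intro closed_Int closed_INT ballI closed_Collect_le continuous_intros)
  moreover have "bounded Z"
  proof (rule bounded_subset)
    show "bounded (cball k0 r1 \<times> cball (0::real) r1)" by (intro bounded_Times) auto
    show "Z \<subseteq> cball k0 r1 \<times> cball 0 r1" using k0 by (force simp: Z_def dist_commute)
  qed
  ultimately have "compact Z" by (simp add: compact_eq_bounded_closed)
  moreover have "(0, r1) \<in> Z" using r1 by (auto simp: Z_def)
  moreover have "continuous_on Z snd" by (intro continuous_intros)
  ultimately obtain z where z: "z \<in> Z" "\<And>y. y \<in> Z \<Longrightarrow> snd z \<le> snd y"
    using continuous_attains_inf[of Z snd] by blast
  have sub: "0 \<le> snd z" "K \<subseteq> cball (fst z) (snd z)" using z(1) by (auto simp: Z_def)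
  have min: "snd z \<le> r" if "0 \<le> r" "K \<subseteq> cball c r" for c r
  proof (cases "r \<le> r1")
    case True
    then have "(c, r) \<in> Z" using that by (auto simp: Z_def)
    then show ?thesis using z(2)[of "(c, r)"] by simp
  next
    case False then show ?thesis using z(1) by (auto simp: Z_def)
  qed
  have "circumradius K = snd z"
    unfolding circumradius_def by (rule Least_equality) (use sub min in blast)+
  then show ?thesis using that[of "fst z"] sub min by simp
qed

text \<open>Otherwise a hyperplane separates the centre from the contact points, and a small shift
  of the centre towards them brings all of K to a distance below R: points beyond the hyperplane
  come nearer, and the others had a distance bounded away from R.\<close>

lemma circumcenter_in_hull:
  fixes K :: "'a::euclidean_space set"
  assumes K: "compact K" "K \<noteq> {}" and sub: "K \<subseteq> cball c R"
    and min: "\<And>c' r. 0 \<le> r \<Longrightarrow> K \<subseteq> cball c' r \<Longrightarrow> R \<le> r"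
  shows "c \<in> convex hull (K \<inter> sphere c R)"
proof (rule ccontr)
  let ?P = "K \<inter> sphere c R"
  assume "c \<notin> convex hull ?P"
  moreover have "closed (convex hull ?P)" using K(1) by (intro compact_imp_closed compact_convex_hull) auto
  ultimately obtain a b where ab: "a \<bullet> c < b" "\<And>x. x \<in> convex hull ?P \<Longrightarrow> a \<bullet> x > b"
    using separating_hyperplane_closed_point[OF convex_convex_hull] by blast
  define \<delta> where "\<delta> = b - a \<bullet> c"
  have \<delta>: "\<delta> > 0" using ab by (simp add: \<delta>_def)
  define K1 where "K1 = K \<inter> {k. a \<bullet> k \<le> b}"
  have "compact K1" unfolding K1_def using K(1) by (intro compact_Int_closed closed_halfspace_le)
  have lt: "dist c k < R" if "k \<in> K1" for k
  proof -
    have "k \<notin> ?P" using that ab(2)[of k] hull_inc[of k ?P convex] by (auto simp: K1_def)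
    then show ?thesis using that sub by (auto simp: K1_def)
  qed
  obtain \<rho> where \<rho>: "\<rho> < R" "\<And>k. k \<in> K1 \<Longrightarrow> dist c k \<le> \<rho>"
  proof (cases "K1 = {}")
    case True then show ?thesis using that[of "R - 1"] by simp
  next
    case False
    have "continuous_on K1 (dist c)" by (intro continuous_intros)
    then obtain k where "k \<in> K1" "\<And>y. y \<in> K1 \<Longrightarrow> dist c y \<le> dist c k"
      using continuous_attains_sup[OF \<open>compact K1\<close> False, of "dist c"] by blast
    then show ?thesis using that[of "dist c k"] lt by blast
  qed
  \<comment> \<open>The first bound keeps the quadratic term of the shift below the gain for points
    beyond the hyperplane; the second keeps the length of the shift below the gap R - \<rho> for the
    others.\<close>
  define \<epsilon> where "\<epsilon> = min (\<delta> / ((norm a)\<^sup>2 + 1)) ((R - \<rho>) / (2 * (norm a + 1)))"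
  have e0: "\<epsilon> > 0" using \<delta> \<rho> by (simp add: \<epsilon>_def add_nonneg_pos)
  have e1: "\<epsilon> * (norm a)\<^sup>2 \<le> \<delta>"
  proof -
    have "\<epsilon> * ((norm a)\<^sup>2 + 1) \<le> \<delta>" using min.cobounded1[of "\<delta> / ((norm a)\<^sup>2 + 1)"]
      unfolding \<epsilon>_def by (simp add: le_divide_eq add_nonneg_pos)
    then show ?thesis using e0 by (simp add: distrib_left)
  qed
  have e2: "\<epsilon> * norm a < R - \<rho>"
  proof -
    have "\<epsilon> \<le> (R - \<rho>) / (2 * (norm a + 1))" by (simp add: \<epsilon>_def)
    then have "\<epsilon> * (2 * (norm a + 1)) \<le> R - \<rho>" by (simp add: le_divide_eq add_nonneg_pos)
    moreover have "norm a < 2 * (norm a + 1)" using add_nonneg_pos[of "norm a" 2] by simp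
    then have "\<epsilon> * norm a < \<epsilon> * (2 * (norm a + 1))" using e0 by (rule mult_strict_left_mono)
    ultimately show ?thesis by linarith
  qed
  have near: "dist (c + \<epsilon> *\<^sub>R a) k < R" if k: "k \<in> K" for k
  proof (cases "k \<in> K1")
    case True
    have "dist (c + \<epsilon> *\<^sub>R a) k \<le> dist (c + \<epsilon> *\<^sub>R a) c + dist c k" by (rule dist_triangle)
    also have "dist (c + \<epsilon> *\<^sub>R a) c = \<epsilon> * norm a" using e0 by (simp add: dist_norm)
    finally show ?thesis using \<rho>(2)[OF True] e2 by linarith
  next
    case False
    have R0: "0 \<le> dist c k" "dist c k \<le> R" using k sub by auto
    have ak: "a \<bullet> (k - c) > \<delta>" using False k by (simp add: K1_def \<delta>_def inner_diff_right)
    have "(dist (c + \<epsilon> *\<^sub>R a) k)\<^sup>2 = (norm ((c - k) + \<epsilon> *\<^sub>R a))\<^sup>2"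
      by (simp add: dist_norm algebra_simps)
    also have "\<dots> = (dist c k)\<^sup>2 - 2 * \<epsilon> * (a \<bullet> (k - c)) + \<epsilon> * (\<epsilon> * (norm a)\<^sup>2)"
      unfolding power2_norm_add dist_norm
      by (simp add: inner_diff_left inner_diff_right inner_commute[of a] power_mult_distrib power2_eq_square algebra_simps)
    also have "\<dots> < R\<^sup>2"
    proof -
      have "(dist c k)\<^sup>2 \<le> R\<^sup>2" using R0 by (intro power_mono) auto
      moreover have "\<epsilon> * (\<epsilon> * (norm a)\<^sup>2) \<le> \<epsilon> * \<delta>" using e0 e1 by (intro mult_left_mono) auto
      moreover have "\<epsilon> * \<delta> < \<epsilon> * (a \<bullet> (k - c))" using e0 ak by simp
      moreover have "0 < \<epsilon> * \<delta>" using e0 \<delta> by simp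
      ultimately show ?thesis by linarith
    qed
    finally show ?thesis using R0 by (meson order_trans power_less_imp_less_base)
  qed
  have "continuous_on K (dist (c + \<epsilon> *\<^sub>R a))" by (intro continuous_intros)
  then obtain k where k: "k \<in> K" "\<And>y. y \<in> K \<Longrightarrow> dist (c + \<epsilon> *\<^sub>R a) y \<le> dist (c + \<epsilon> *\<^sub>R a) k"
    using continuous_attains_sup[OF K, of "dist (c + \<epsilon> *\<^sub>R a)"] by blast
  have "K \<subseteq> cball (c + \<epsilon> *\<^sub>R a) (dist (c + \<epsilon> *\<^sub>R a) k)" using k(2) by auto
  then have "R \<le> dist (c + \<epsilon> *\<^sub>R a) k" by (intro min) auto
  then show False using near[OF k(1)] by simp
qed

text \<open>
  The support function of the spindle with vertices \<plusminus>R w in a direction u with t = u \<bullet> w \<ge> 0: the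
  first case consists of the normal directions at the vertex R w.
\<close>

definition spindle_support :: "real \<Rightarrow> real \<Rightarrow> real \<Rightarrow> real" where
  "spindle_support L R t = (if R \<le> t * L then R * t else L - sqrt (L\<^sup>2 - R\<^sup>2) * sqrt (1 - t\<^sup>2))"

text \<open>As |p| = R is fixed, squaring |y - p| \<le> L leaves an inequality affine in p. It
  passes to the convex hull, where it is evaluated at 0.\<close>

lemma contact_center_bound:
  fixes P :: "'a::euclidean_space set"
  assumes P: "P \<subseteq> sphere 0 R" "0 \<in> convex hull P" and y: "P \<subseteq> cball y L" and L: "L > 0" and R: "R > 0"
  shows "(norm y)\<^sup>2 \<le> L\<^sup>2 - R\<^sup>2"
proof -
  have "P \<subseteq> {x. 2 * (y \<bullet> x) \<ge> (norm y)\<^sup>2 + R\<^sup>2 - L\<^sup>2}"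
  proof
    fix p assume p: "p \<in> P"
    have "norm p = R" using p P by auto
    have "norm (y - p) \<le> L" using p y by (auto simp: dist_norm)
    then have "(norm (y - p))\<^sup>2 \<le> L\<^sup>2" by (intro power_mono) auto
    moreover have "(norm (y - p))\<^sup>2 = (norm y)\<^sup>2 - 2 * (y \<bullet> p) + (norm p)\<^sup>2"
      unfolding power2_norm_eq_inner by (simp add: inner_diff_left inner_diff_right inner_commute)
    ultimately show "p \<in> {x. 2 * (y \<bullet> x) \<ge> (norm y)\<^sup>2 + R\<^sup>2 - L\<^sup>2}" using \<open>norm p = R\<close> by simp
  qed
  then have "convex hull P \<subseteq> {x. (2 *\<^sub>R y) \<bullet> x \<ge> (norm y)\<^sup>2 + R\<^sup>2 - L\<^sup>2}"
    by (intro hull_minimal convex_halfspace_ge) auto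
  then show ?thesis using P(2) by auto
qed

text \<open>If R \<le> t L, the contact point R w alone gives the bound. Otherwise h(u) = L + y
  \<bullet> u for the centre y of the ball touching in direction u, and it remains to show y
  \<bullet> u \<ge> - d s, where s is the sine of the angle between u and w.\<close>

lemma support_ge_spindle_support:
  fixes K :: "'a::euclidean_space set"
  assumes K: "compact K" "K \<noteq> {}" and L: "L > 0"
    and normal: "\<And>u q. norm u = 1 \<Longrightarrow> q \<in> K \<Longrightarrow> (\<And>k. k \<in> K \<Longrightarrow> k \<bullet> u \<le> q \<bullet> u) \<Longrightarrow> K \<subseteq> cball (q - L *\<^sub>R u) L"
    and R: "R > 0" "R \<le> L" and P: "P \<subseteq> K \<inter> sphere 0 R" "0 \<in> convex hull P"
    and w: "R *\<^sub>R w \<in> P" and u: "norm u = 1" "u \<bullet> w \<ge> 0"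
  shows "spindle_support L R (u \<bullet> w) \<le> support_fn K u"
proof -
  define t where "t = u \<bullet> w"
  define d where "d = sqrt (L\<^sup>2 - R\<^sup>2)"
  have nw: "norm w = 1" using w P(1) R by auto
  have ww: "w \<bullet> w = 1" "u \<bullet> u = 1" using nw u by (simp_all add: dot_square_norm)
  have RL: "R\<^sup>2 \<le> L\<^sup>2" using R by (intro power_mono) auto
  then have d: "d \<ge> 0" "d\<^sup>2 = L\<^sup>2 - R\<^sup>2" by (simp_all add: d_def)
  have t: "0 \<le> t" "t \<le> 1" using u(2) norm_cauchy_schwarz[of u w] u(1) nw by (simp_all add: t_def)
  have t2: "t\<^sup>2 \<le> 1" using t by (simp add: power_le_one)
  define s where "s = sqrt (1 - t\<^sup>2)"
  have s: "s \<ge> 0" "s\<^sup>2 = 1 - t\<^sup>2" using t2 by (simp_all add: s_def)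
  show ?thesis
  proof (cases "R \<le> t * L")
    case True
    have "(R *\<^sub>R w) \<bullet> u \<le> support_fn K u" using w P(1) by (intro support_fn_ge[OF K(1)]) auto
    then show ?thesis using True by (simp add: spindle_support_def t_def inner_commute)
  next
    case False
    obtain q where q: "q \<in> K" "q \<bullet> u = support_fn K u" using support_fn_attained[OF K] by blast
    define y where "y = q - L *\<^sub>R u"
    have "K \<subseteq> cball y L" unfolding y_def
      using support_fn_ge[OF K(1)] q(2) by (intro normal[OF u(1) q(1)]) auto
    then have PL: "P \<subseteq> cball y L" using P(1) by blast
    have hy: "support_fn K u = L + y \<bullet> u" using q(2) ww by (simp add: y_def inner_diff_left)
    have yd: "(norm y)\<^sup>2 \<le> d\<^sup>2" using contact_center_bound[OF _ P(2) PL L R(1)] P(1) d(2) by auto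
    then have ynd: "norm y \<le> d" using d(1) by (rule power2_le_imp_le)
    have uw: "norm (u - t *\<^sub>R w) = s"
    proof -
      have "(norm (u - t *\<^sub>R w))\<^sup>2 = s\<^sup>2"
        unfolding power2_norm_diff s(2) using u(1) nw by (simp add: t_def[symmetric] power2_eq_square)
      then show ?thesis using s(1) by (simp add: power2_eq_iff_nonneg)
    qed
    have "- (d * s) \<le> y \<bullet> u"
    proof (cases "y \<bullet> w \<ge> 0")
      case True
      have "y \<bullet> u = t * (y \<bullet> w) + y \<bullet> (u - t *\<^sub>R w)" by (simp add: inner_diff_right)
      moreover have "0 \<le> t * (y \<bullet> w)" using True t by simp
      moreover have "\<bar>y \<bullet> (u - t *\<^sub>R w)\<bar> \<le> norm y * s" using Cauchy_Schwarz_ineq2[of y "u - t *\<^sub>R w"] uw by simp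
      moreover have "norm y * s \<le> d * s" using ynd s by (intro mult_right_mono) auto
      ultimately show ?thesis by linarith
    next
      \<comment> \<open>The component -x of y along w now costs x t. In return the ball contains R
        w, which sharpens the bound to |y|^2 \<le> d^2 - 2 R x; the part z of y orthogonal to w then
        has norm at most d - (R / d) x. The gain (R / d) x s covers the cost because t L < R implies
        t d \<le> s R.\<close>
      case neg: False
      define x where "x = - (y \<bullet> w)"
      have x: "x > 0" using neg by (simp add: x_def)
      have "norm (y - R *\<^sub>R w) \<le> L" using PL w by (auto simp: dist_norm)
      then have "(norm (y - R *\<^sub>R w))\<^sup>2 \<le> L\<^sup>2" by (intro power_mono) auto
      moreover have "(norm (y - R *\<^sub>R w))\<^sup>2 = (norm y)\<^sup>2 + 2 * R * x + R\<^sup>2"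
        unfolding power2_norm_diff using nw by (simp add: x_def power_mult_distrib)
      ultimately have yx: "(norm y)\<^sup>2 \<le> d\<^sup>2 - 2 * R * x" using d(2) by simp
      have "2 * R * x > 0" using R x by simp
      then have dpos: "d > 0" using yx d(1) zero_le_power2[of "norm y"] by (cases "d = 0") auto
      define z where "z = y + x *\<^sub>R w"
      have zw: "z \<bullet> w = 0" using ww by (simp add: z_def inner_add_left inner_diff_left x_def)
      have ny: "(norm y)\<^sup>2 = (norm z)\<^sup>2 + x\<^sup>2"
      proof -
        have "y = z - x *\<^sub>R w" by (simp add: z_def)
        then have "(norm y)\<^sup>2 = (norm z)\<^sup>2 - 2 * (z \<bullet> (x *\<^sub>R w)) + (norm (x *\<^sub>R w))\<^sup>2"
          by (simp only: power2_norm_diff)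
        then show ?thesis using zw nw by simp
      qed
      have nz: "norm z \<le> d - (R / d) * x"
      proof -
        have zz: "(norm z)\<^sup>2 \<le> d\<^sup>2 - 2 * R * x" using ny yx zero_le_power2[of x] by linarith
        then have "2 * R * x \<le> d\<^sup>2" using zero_le_power2[of "norm z"] by linarith
        then have "R * x \<le> d * d" using \<open>2 * R * x > 0\<close> unfolding power2_eq_square by linarith
        then have "(R / d) * x \<le> d" using dpos by (simp add: divide_le_eq)
        then have nn: "0 \<le> d - (R / d) * x" by simp
        have "d\<^sup>2 - 2 * R * x \<le> (d - (R / d) * x)\<^sup>2"
          using dpos by (simp add: power2_diff)
        with zz have "(norm z)\<^sup>2 \<le> (d - (R / d) * x)\<^sup>2" by (rule order_trans)
        then show ?thesis by (rule power2_le_imp_le[OF _ nn])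
      qed
      have ts: "t * d \<le> s * R"
      proof -
        have "t * L < R" using False by simp
        then have "(t * L)\<^sup>2 \<le> R\<^sup>2" using t L by (intro power_mono) auto
        then have "(t * d)\<^sup>2 \<le> (s * R)\<^sup>2" by (simp add: power_mult_distrib d(2) s(2) algebra_simps)
        moreover have "0 \<le> s * R" using s R by simp
        ultimately show ?thesis by (rule power2_le_imp_le)
      qed
      have "y \<bullet> u = z \<bullet> (u - t *\<^sub>R w) - x * t"
        using zw by (simp add: z_def inner_diff_right inner_add_left t_def inner_commute[of w u])
      moreover have "\<bar>z \<bullet> (u - t *\<^sub>R w)\<bar> \<le> norm z * s" using Cauchy_Schwarz_ineq2[of z "u - t *\<^sub>R w"] uw by simp
      moreover have "norm z * s \<le> (d - (R / d) * x) * s" using nz s by (intro mult_right_mono) auto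
      moreover have "x * t \<le> (R / d) * x * s"
      proof -
        have "t \<le> s * R / d" using ts dpos by (simp add: le_divide_eq)
        then have "x * t \<le> x * (s * R / d)" using x by (intro mult_left_mono) auto
        then show ?thesis by (simp add: mult_ac)
      qed
      moreover have "(d - (R / d) * x) * s = d * s - (R / d) * x * s" by (simp add: left_diff_distrib)
      ultimately show ?thesis by linarith
    qed
    then show ?thesis using False hy by (simp add: spindle_support_def t_def[symmetric] d_def s_def)
  qed
qed

text \<open>Both branches increase and meet at t = R / L with the common value R^2 / L. For R = L
  the second branch is constant, hence the hypothesis R < L for strictness.\<close>

lemma spindle_support_mono:
  assumes R: "0 < R" "R \<le> L" and t: "0 \<le> t" "t \<le> t'" "t' \<le> 1"
  shows "spindle_support L R t \<le> spindle_support L R t'"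
    and "R < L \<Longrightarrow> t < t' \<Longrightarrow> spindle_support L R t < spindle_support L R t'"
proof -
  define d where "d = sqrt (L\<^sup>2 - R\<^sup>2)"
  have L: "L > 0" using R by simp
  have "R\<^sup>2 \<le> L\<^sup>2" using R by (intro power_mono) auto
  then have d: "d \<ge> 0" "d\<^sup>2 = L\<^sup>2 - R\<^sup>2" by (simp_all add: d_def)
  have tt: "t\<^sup>2 \<le> t'\<^sup>2" using t by (intro power_mono) auto
  have cross: "L - d * sqrt (1 - t\<^sup>2) \<le> R\<^sup>2 / L" "d > 0 \<Longrightarrow> L - d * sqrt (1 - t\<^sup>2) < R\<^sup>2 / L"
    if "t * L < R" "0 \<le> t" for t :: real
  proof -
    have dL: "R\<^sup>2 / L = L - d * (d / L)" using L d(2) by (simp add: field_simps power2_eq_square)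
    have "t\<^sup>2 * L\<^sup>2 < R\<^sup>2"
      using power_strict_mono[OF that(1), of 2] that(2) L by (simp add: power_mult_distrib)
    then have "(d / L)\<^sup>2 < 1 - t\<^sup>2" using L d(2) by (simp add: power_divide field_simps)
    then have lt: "d / L < sqrt (1 - t\<^sup>2)" using d L by (intro real_less_rsqrt) auto
    then show "L - d * sqrt (1 - t\<^sup>2) \<le> R\<^sup>2 / L" using d(1) unfolding dL by (simp add: mult_left_mono del: times_divide_eq_right)
    show "L - d * sqrt (1 - t\<^sup>2) < R\<^sup>2 / L" if "d > 0"
      unfolding dL using lt that by (simp add: mult_strict_left_mono del: times_divide_eq_right)
  qed
  have after: "R\<^sup>2 / L \<le> R * t" if "R \<le> t * L" for t
  proof -
    have "R * R \<le> R * (t * L)" using that R by (intro mult_left_mono) auto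
    then show ?thesis using L by (simp add: divide_le_eq power2_eq_square mult.assoc)
  qed
  have tL: "t * L \<le> t' * L" using t L by (intro mult_right_mono) auto
  consider "R \<le> t * L" | "t * L < R" "R \<le> t' * L" | "t' * L < R" using tL by linarith
  then show "spindle_support L R t \<le> spindle_support L R t'"
  proof cases
    case 1
    then have "R \<le> t' * L" using tL by linarith
    then show ?thesis using 1 R t by (simp add: spindle_support_def)
  next
    case 2
    have "L - d * sqrt (1 - t\<^sup>2) \<le> R * t'" using cross(1)[OF 2(1) t(1)] after[OF 2(2)] by linarith
    then show ?thesis using 2 by (simp add: spindle_support_def d_def)
  next
    case 3
    then have "t * L < R" using tL by linarith
    moreover have "d * sqrt (1 - t'\<^sup>2) \<le> d * sqrt (1 - t\<^sup>2)" using tt d by (intro mult_left_mono) auto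
    ultimately show ?thesis using 3 by (simp add: spindle_support_def d_def)
  qed
  assume RL: "R < L" and tlt: "t < t'"
  have "R\<^sup>2 < L\<^sup>2" using R RL by (intro power_strict_mono) auto
  then have d0: "d > 0" by (simp add: d_def)
  have ttlt: "t\<^sup>2 < t'\<^sup>2" using t tlt by (intro power_strict_mono) auto
  consider "R \<le> t * L" | "t * L < R" "R \<le> t' * L" | "t' * L < R" using tL by linarith
  then show "spindle_support L R t < spindle_support L R t'"
  proof cases
    case 1
    then have "R \<le> t' * L" using tL by linarith
    then show ?thesis using 1 R tlt by (simp add: spindle_support_def)
  next
    case 2
    have "L - d * sqrt (1 - t\<^sup>2) < R * t'" using cross(2)[OF 2(1) t(1) d0] after[OF 2(2)] by linarith
    then show ?thesis using 2 by (simp add: spindle_support_def d_def)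
  next
    case 3
    then have "t * L < R" using tL by linarith
    moreover have "d * sqrt (1 - t'\<^sup>2) < d * sqrt (1 - t\<^sup>2)" using ttlt d0 by (intro mult_strict_left_mono) auto
    ultimately show ?thesis using 3 by (simp add: spindle_support_def d_def)
  qed
qed

lemma spindle_support_range:
  assumes R: "0 < R" "R \<le> L" and t: "0 \<le> t" "t \<le> 1"
  shows "0 \<le> spindle_support L R t" "spindle_support L R t \<le> R"
proof -
  have "spindle_support L R t \<le> spindle_support L R 1" by (rule spindle_support_mono(1)[OF R t(1,2)]) simp
  then show "spindle_support L R t \<le> R" using R by (simp add: spindle_support_def)
  have "0 \<le> spindle_support L R 0"
  proof -
    have "sqrt (L\<^sup>2 - R\<^sup>2) \<le> sqrt (L\<^sup>2)" by (intro real_sqrt_le_mono) simp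
    then show ?thesis using R by (simp add: spindle_support_def)
  qed
  also have "\<dots> \<le> spindle_support L R t" using t by (intro spindle_support_mono(1)[OF R]) auto
  finally show "0 \<le> spindle_support L R t" .
qed

text \<open>1 / sqrt (1 + c^2) is the cosine of the angle with tangent c, so this is G as a function
  of the slope.\<close>

definition spindle_profile :: "real \<Rightarrow> real \<Rightarrow> real \<Rightarrow> real" where
  "spindle_profile L R c = spindle_support L R (1 / sqrt (1 + c\<^sup>2))"

lemma inverse_sqrt_range: "0 \<le> 1 / sqrt (1 + c\<^sup>2)" "1 / sqrt (1 + c\<^sup>2) \<le> (1::real)"
proof -
  have "sqrt 1 \<le> sqrt (1 + c\<^sup>2)" by (intro real_sqrt_le_mono) simp
  then have "1 / sqrt (1 + c\<^sup>2) \<le> 1 / sqrt 1" by (intro divide_left_mono) (auto simp: add_pos_nonneg)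
  then show "1 / sqrt (1 + c\<^sup>2) \<le> 1" by simp
qed simp

lemma slope_profile_spindle:
  assumes R: "0 < R" "R \<le> L"
  shows "slope_profile (spindle_profile L R) R"
proof
  show "spindle_profile L R \<in> borel_measurable borel"
    unfolding spindle_profile_def spindle_support_def by measurable
  show "spindle_profile L R c' \<le> spindle_profile L R c" if "0 < c" "c \<le> c'" for c c'
  proof -
    have "c\<^sup>2 \<le> c'\<^sup>2" using that by (intro power_mono) auto
    then have "sqrt (1 + c\<^sup>2) \<le> sqrt (1 + c'\<^sup>2)" by (intro real_sqrt_le_mono) simp
    then have "1 / sqrt (1 + c'\<^sup>2) \<le> 1 / sqrt (1 + c\<^sup>2)" using sqrt_one_plus_pos by (intro divide_left_mono) auto
    then show ?thesis unfolding spindle_profile_def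
      by (intro spindle_support_mono(1)[OF R] inverse_sqrt_range)
  qed
  show "0 \<le> spindle_profile L R c" "spindle_profile L R c \<le> R" for c
    unfolding spindle_profile_def using spindle_support_range[OF R inverse_sqrt_range] by auto
qed

lemma spindle_profile_strict:
  assumes R: "0 < R" "R < L"
  shows "\<forall>c>0. \<forall>c'>c. spindle_profile L R c' < spindle_profile L R c"
proof (intro allI impI)
  fix c c' :: real assume c: "0 < c" "c < c'"
  have "c\<^sup>2 < c'\<^sup>2" using c by (intro power_strict_mono) auto
  then have "sqrt (1 + c\<^sup>2) < sqrt (1 + c'\<^sup>2)" by simp
  then have lt: "1 / sqrt (1 + c'\<^sup>2) < 1 / sqrt (1 + c\<^sup>2)" using sqrt_one_plus_pos[of c] by (intro divide_strict_left_mono) auto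
  have "R \<le> L" using R by simp
  show "spindle_profile L R c' < spindle_profile L R c"
    unfolding spindle_profile_def
    by (rule spindle_support_mono(2)[OF R(1) \<open>R \<le> L\<close> inverse_sqrt_range(1) less_imp_le[OF lt] inverse_sqrt_range(2) R(2) lt])
qed

section \<open>Spindles with midpoint at the origin\<close>

text \<open>The spindle with vertices \<plusminus>p if p is not 0 and |p| \<le> L; c runs through
  the centres of the balls of radius L that contain both vertices.\<close>

definition centred_spindle :: "real \<Rightarrow> 'a::real_normed_vector \<Rightarrow> 'a set" where
  "centred_spindle L p = {z. \<forall>c. norm (c - p) \<le> L \<and> norm (c + p) \<le> L \<longrightarrow> norm (z - c) \<le> L}"

lemma centred_spindle_uminus: "centred_spindle L (- p) = centred_spindle L p"
  by (auto simp: centred_spindle_def)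

lemma centred_spindle_mem: "p \<in> centred_spindle L p" "- p \<in> centred_spindle L p"
  by (auto simp: centred_spindle_def norm_minus_commute)

lemma compact_centred_spindle:
  fixes p :: "'a::euclidean_space"
  assumes "norm p \<le> L"
  shows "compact (centred_spindle L p)"
proof -
  have "centred_spindle L p = (\<Inter>c\<in>{c. norm (c - p) \<le> L \<and> norm (c + p) \<le> L}. cball c L)"
    by (auto simp: centred_spindle_def dist_norm norm_minus_commute)
  then have "closed (centred_spindle L p)" by auto
  moreover have "centred_spindle L p \<subseteq> cball 0 L" using assms by (auto simp: centred_spindle_def dest: spec[of _ 0])
  then have "bounded (centred_spindle L p)" by (rule bounded_subset[OF bounded_cball])
  ultimately show ?thesis by (simp add: compact_eq_bounded_closed)
qed

lemma convex_centred_spindle: "convex (centred_spindle L (p :: 'a::euclidean_space))"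
proof -
  have "centred_spindle L p = (\<Inter>c\<in>{c. norm (c - p) \<le> L \<and> norm (c + p) \<le> L}. cball c L)"
    by (auto simp: centred_spindle_def dist_norm norm_minus_commute)
  then show ?thesis by (auto intro!: convex_INT)
qed

text \<open>Each upper bound comes from a single ball: the one touching at R w with normal u if R
  \<le> t L, and otherwise the one with centre - d \<nu> in the plane of u and w, whose boundary
  passes through both vertices. The vertex R w and the point L u - d \<nu> attain them.\<close>

lemma support_centred_spindle:
  fixes w u :: "'a::euclidean_space"
  assumes R: "0 < R" "R \<le> L" and w: "norm w = 1" and u: "norm u = 1" "u \<bullet> w \<ge> 0"
  shows "support_fn (centred_spindle L (R *\<^sub>R w)) u = spindle_support L R (u \<bullet> w)"
proof -
  let ?S = "centred_spindle L (R *\<^sub>R w)"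
  define t where "t = u \<bullet> w"
  define d where "d = sqrt (L\<^sup>2 - R\<^sup>2)"
  define s where "s = sqrt (1 - t\<^sup>2)"
  have L: "L > 0" using R by simp
  have S: "compact ?S" "?S \<noteq> {}"
    using compact_centred_spindle[of "R *\<^sub>R w" L] R w centred_spindle_mem(1)[of "R *\<^sub>R w" L] by (simp, blast)
  have "R\<^sup>2 \<le> L\<^sup>2" using R by (intro power_mono) auto
  then have d: "d \<ge> 0" "d\<^sup>2 = L\<^sup>2 - R\<^sup>2" by (simp_all add: d_def)
  have t: "0 \<le> t" "t \<le> 1" using u(2) norm_cauchy_schwarz[of u w] u(1) w by (simp_all add: t_def)
  have ww: "w \<bullet> w = 1" "u \<bullet> u = 1" using w u by (simp_all add: dot_square_norm)
  show ?thesis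
  proof (cases "R \<le> t * L")
    case True
    have "support_fn ?S u \<le> R * t"
    proof (rule support_fn_le[OF S])
      fix z assume z: "z \<in> ?S"
      let ?c = "R *\<^sub>R w - L *\<^sub>R u"
      have "norm (?c - R *\<^sub>R w) \<le> L" using u L by simp
      moreover have "norm (?c + R *\<^sub>R w) \<le> L"
      proof -
        have "R *\<^sub>R w + R *\<^sub>R w = (2 * R) *\<^sub>R w" by (simp only: mult_2 scaleR_left_distrib)
        then have e: "?c + R *\<^sub>R w = (2 * R) *\<^sub>R w - L *\<^sub>R u" by (simp add: algebra_simps)
        have "(norm (?c + R *\<^sub>R w))\<^sup>2 = (norm ((2 * R) *\<^sub>R w))\<^sup>2 - 2 * ((2 * R) *\<^sub>R w \<bullet> L *\<^sub>R u) + (norm (L *\<^sub>R u))\<^sup>2"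
          by (simp only: e power2_norm_diff)
        also have "\<dots> = 4 * R\<^sup>2 - 4 * R * (t * L) + L\<^sup>2"
          using w u by (simp add: power_mult_distrib t_def inner_commute mult_ac)
        also have "\<dots> \<le> L\<^sup>2" using mult_left_mono[OF True, of "4 * R"] R by (simp add: power2_eq_square)
        finally show ?thesis using L by (simp add: power2_le_iff_abs_le)
      qed
      ultimately have "norm (z - ?c) \<le> L" using z by (auto simp: centred_spindle_def)
      then have "(norm ((z - R *\<^sub>R w) + L *\<^sub>R u))\<^sup>2 \<le> L\<^sup>2" by (intro power_mono) (auto simp: algebra_simps)
      then have "(norm (z - R *\<^sub>R w))\<^sup>2 + 2 * L * ((z - R *\<^sub>R w) \<bullet> u) \<le> 0"
        unfolding power2_norm_add using u by (simp add: power_mult_distrib)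
      then have "2 * L * ((z - R *\<^sub>R w) \<bullet> u) \<le> 0" using zero_le_power2[of "norm (z - R *\<^sub>R w)"] by linarith
      then have "(z - R *\<^sub>R w) \<bullet> u \<le> 0" using L by (simp add: mult_le_0_iff)
      then show "z \<bullet> u \<le> R * t" by (simp add: inner_diff_left t_def inner_commute[of w u])
    qed
    moreover have "R * t \<le> support_fn ?S u"
      using support_fn_ge[OF S(1) centred_spindle_mem(1), of u] by (simp add: t_def inner_commute)
    ultimately show ?thesis using True by (simp add: spindle_support_def t_def)
  next
    case False
    then have tL: "t * L < R" by simp
    have "t < 1" using tL R t L by (metis less_le_trans mult_cancel_right1 not_less order.order_iff_strict)
    then have t2: "t\<^sup>2 < 1" using t by (simp add: power_less_one_iff)
    have s: "s > 0" "s\<^sup>2 = 1 - t\<^sup>2" using t2 by (simp_all add: s_def)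
    have dL: "d \<le> L * s"
    proof -
      have "(t * L)\<^sup>2 \<le> R\<^sup>2" using tL t L by (intro power_mono) auto
      then have "d\<^sup>2 \<le> (L * s)\<^sup>2" by (simp add: power_mult_distrib d(2) s(2) algebra_simps)
      moreover have "0 \<le> L * s" using L s by simp
      ultimately show ?thesis by (rule power2_le_imp_le)
    qed
    define \<nu> where "\<nu> = (1 / s) *\<^sub>R (u - t *\<^sub>R w)"
    have nw: "\<nu> \<bullet> w = 0" using ww by (simp add: \<nu>_def inner_diff_left t_def)
    have us: "u = t *\<^sub>R w + s *\<^sub>R \<nu>" using s by (simp add: \<nu>_def)
    have nu: "\<nu> \<bullet> u = s"
      using s ww by (simp add: \<nu>_def inner_diff_left inner_commute[of w u] t_def[symmetric] field_simps power2_eq_square)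
    have "\<nu> \<bullet> u = s * (\<nu> \<bullet> \<nu>)" by (subst us) (simp add: inner_add_right nw)
    then have nn: "\<nu> \<bullet> \<nu> = 1" using nu s by simp
    then have nnorm: "norm \<nu> = 1" by (simp add: norm_eq_sqrt_inner)
    have "support_fn ?S u \<le> L - d * s"
    proof (rule support_fn_le[OF S])
      fix z assume z: "z \<in> ?S"
      let ?c = "- (d *\<^sub>R \<nu>)"
      have "(norm (?c - R *\<^sub>R w))\<^sup>2 = L\<^sup>2" "(norm (?c + R *\<^sub>R w))\<^sup>2 = L\<^sup>2"
        unfolding power2_norm_diff power2_norm_add using nw nnorm w d by (simp_all add: power_mult_distrib)
      then have "norm (?c - R *\<^sub>R w) \<le> L" "norm (?c + R *\<^sub>R w) \<le> L" using L by (simp_all add: power2_eq_iff_nonneg)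
      then have "norm (z - ?c) \<le> L" using z by (auto simp: centred_spindle_def)
      moreover have "(z - ?c) \<bullet> u \<le> norm (z - ?c) * norm u" by (rule norm_cauchy_schwarz)
      ultimately have "(z + d *\<^sub>R \<nu>) \<bullet> u \<le> L" using u by simp
      then show "z \<bullet> u \<le> L - d * s" using nu by (simp add: inner_add_left)
    qed
    moreover have "L - d * s \<le> support_fn ?S u"
    proof -
      \<comment> \<open>The point with normal u on the sphere around - d \<nu>. Every admissible
        centre c satisfies |c|^2 \<le> d^2 - 2 R |c \<bullet> w| by its two vertex conditions, and
        this slack absorbs the part of x along w since t L < R.\<close>
      define x where "x = L *\<^sub>R u - d *\<^sub>R \<nu>"
      have "x \<in> ?S" unfolding centred_spindle_def
      proof (intro CollectI allI impI, elim conjE)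
        fix c assume c: "norm (c - R *\<^sub>R w) \<le> L" "norm (c + R *\<^sub>R w) \<le> L"
        define a where "a = \<bar>c \<bullet> w\<bar>"
        have "(norm (c - R *\<^sub>R w))\<^sup>2 \<le> L\<^sup>2" "(norm (c + R *\<^sub>R w))\<^sup>2 \<le> L\<^sup>2" using c by (auto intro!: power_mono)
        then have "(norm c)\<^sup>2 - 2 * R * (c \<bullet> w) + R\<^sup>2 \<le> L\<^sup>2" "(norm c)\<^sup>2 + 2 * R * (c \<bullet> w) + R\<^sup>2 \<le> L\<^sup>2"
          unfolding power2_norm_diff power2_norm_add using w by (simp_all add: power_mult_distrib)
        then have ca: "(norm c)\<^sup>2 \<le> d\<^sup>2 - 2 * R * a" unfolding a_def d(2) by (cases "c \<bullet> w \<ge> 0") auto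
        have Ra: "0 \<le> 2 * R * a" using R by (simp add: a_def)
        then have "(norm c)\<^sup>2 \<le> d\<^sup>2" using ca by linarith
        then have cd: "norm c \<le> d" using d(1) by (rule power2_le_imp_le)
        have x_eq: "x = (L * t) *\<^sub>R w + (L * s - d) *\<^sub>R \<nu>"
          unfolding x_def by (subst us) (simp add: algebra_simps)
        have nx: "(norm x)\<^sup>2 = L\<^sup>2 - 2 * L * s * d + d\<^sup>2"
          unfolding x_def power2_norm_diff using u nnorm nu
          by (simp add: power_mult_distrib inner_commute[of u \<nu>])
        have cx: "- (x \<bullet> c) \<le> L * t * a + (L * s - d) * d"
        proof -
          have "- (\<nu> \<bullet> c) \<le> norm \<nu> * norm c" using Cauchy_Schwarz_ineq2[of \<nu> c] by linarith
          then have "- (\<nu> \<bullet> c) \<le> d" using nnorm cd by simp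
          then have "(L * s - d) * - (\<nu> \<bullet> c) \<le> (L * s - d) * d" using dL by (intro mult_left_mono) auto
          moreover have "(L * t) * - (w \<bullet> c) \<le> (L * t) * a" using L t by (intro mult_left_mono) (auto simp: a_def inner_commute)
          ultimately show ?thesis unfolding x_eq by (simp add: inner_add_left)
        qed
        have "(norm (x - c))\<^sup>2 \<le> L\<^sup>2 - 2 * L * s * d + d\<^sup>2 + 2 * (L * t * a + (L * s - d) * d) + (d\<^sup>2 - 2 * R * a)"
        proof -
          have "E - 2 * y + m \<le> E + 2 * A + B" if "- y \<le> A" "m \<le> B" for E y m A B :: real
            using that by linarith
          then show ?thesis unfolding power2_norm_diff nx using cx ca by blast
        qed
        also have "\<dots> = L\<^sup>2 - 2 * a * (R - t * L)" by (simp add: power2_eq_square algebra_simps)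
        also have "\<dots> \<le> L\<^sup>2" using tL by (simp add: a_def)
        finally show "norm (x - c) \<le> L" using L by (simp add: power2_le_iff_abs_le)
      qed
      then have "x \<bullet> u \<le> support_fn ?S u" by (rule support_fn_ge[OF S(1)])
      then show ?thesis using nu ww by (simp add: x_def inner_diff_left)
    qed
    ultimately show ?thesis using False by (simp add: spindle_support_def t_def[symmetric] d_def s_def)
  qed
qed

text \<open>In the direction of z itself the support function of the spindle is at most R;
  exchanging w and -w puts that direction into the hemisphere where the formula applies.\<close>

lemma centred_spindle_subset_cball:
  fixes w :: "'a::euclidean_space"
  assumes R: "0 < R" "R \<le> L" and w: "norm w = 1"
  shows "centred_spindle L (R *\<^sub>R w) \<subseteq> cball 0 R"
proof
  fix z assume z: "z \<in> centred_spindle L (R *\<^sub>R w)"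
  have S: "compact (centred_spindle L (R *\<^sub>R w))" using compact_centred_spindle[of "R *\<^sub>R w" L] R w by auto
  show "z \<in> cball 0 R"
  proof (cases "z = 0")
    case False
    define u where "u = z /\<^sub>R norm z"
    have u: "norm u = 1" using False by (simp add: u_def)
    have zu: "z \<bullet> u = norm z" using False by (simp add: u_def power2_norm_eq_inner[symmetric] power2_eq_square)
    have "\<exists>v. norm v = 1 \<and> centred_spindle L (R *\<^sub>R v) = centred_spindle L (R *\<^sub>R w) \<and> u \<bullet> v \<ge> 0"
    proof (cases "u \<bullet> w \<ge> 0")
      case True then show ?thesis using w by blast
    next
      case False
      then show ?thesis using w centred_spindle_uminus[of L "R *\<^sub>R w"] by (intro exI[of _ "- w"]) auto
    qed
    then obtain v where v: "norm v = 1" "centred_spindle L (R *\<^sub>R v) = centred_spindle L (R *\<^sub>R w)" "u \<bullet> v \<ge> 0" by blast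
    have "u \<bullet> v \<le> 1" using norm_cauchy_schwarz[of u v] u v by simp
    have "norm z \<le> support_fn (centred_spindle L (R *\<^sub>R w)) u" using support_fn_ge[OF S z, of u] zu by simp
    also have "\<dots> = spindle_support L R (u \<bullet> v)" using support_centred_spindle[OF R v(1) u v(3)] v(2) by simp
    also have "\<dots> \<le> R" by (rule spindle_support_range(2)[OF R v(3) \<open>u \<bullet> v \<le> 1\<close>])
    finally show ?thesis by simp
  qed (use R in simp)
qed

lemma lambda_convex_spindle_iff:
  fixes S :: "(real^'n) set"
  assumes "lam > 0"
  shows "lambda_convex_spindle lam S \<longleftrightarrow>
    (\<exists>c w R. norm w = 1 \<and> 0 < R \<and> R \<le> 1 / lam \<and> S = (+) c ` centred_spindle (1 / lam) (R *\<^sub>R w))"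
proof -
  have tr: "\<Inter> {cball b (1 / lam) | b. {c - p, c + p} \<subseteq> cball b (1 / lam)} = (+) c ` centred_spindle (1 / lam) p" (is "?A = ?B")
    for c p :: "real^'n"
  proof (intro equalityI subsetI)
    fix z assume z: "z \<in> ?A"
    have "z - c \<in> centred_spindle (1 / lam) p" unfolding centred_spindle_def
    proof (intro CollectI allI impI, elim conjE)
      fix b assume b: "norm (b - p) \<le> 1 / lam" "norm (b + p) \<le> 1 / lam"
      have "c + b - (c - p) = b + p" "c + b - (c + p) = b - p" by simp_all
      then have "{c - p, c + p} \<subseteq> cball (c + b) (1 / lam)" using b by (simp add: dist_norm)
      then have "z \<in> cball (c + b) (1 / lam)" using z by blast
      then show "norm (z - c - b) \<le> 1 / lam" by (simp add: dist_norm norm_minus_commute algebra_simps)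
    qed
    then show "z \<in> ?B" by (intro image_eqI[of _ _ "z - c"]) auto
  next
    fix z assume "z \<in> ?B"
    then obtain y where y: "z = c + y" "y \<in> centred_spindle (1 / lam) p" by blast
    show "z \<in> ?A"
    proof (intro InterI, elim CollectE exE conjE)
      fix X b assume X: "X = cball b (1 / lam)" "{c - p, c + p} \<subseteq> cball b (1 / lam)"
      have "dist b (c - p) = norm ((b - c) + p)" "dist b (c + p) = norm ((b - c) - p)"
        by (simp_all add: dist_norm algebra_simps)
      then have "norm ((b - c) - p) \<le> 1 / lam" "norm ((b - c) + p) \<le> 1 / lam" using X(2) by simp_all
      then have "norm (y - (b - c)) \<le> 1 / lam" using y(2) by (simp add: centred_spindle_def)
      then show "z \<in> X" unfolding X(1) y(1) by (simp add: dist_norm norm_minus_commute algebra_simps)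
    qed
  qed
  show ?thesis
  proof
    assume "lambda_convex_spindle lam S"
    then obtain x y where xy: "x \<noteq> y" "dist x y \<le> 2 / lam"
      "S = \<Inter> {cball c (1 / lam) | c. {x, y} \<subseteq> cball c (1 / lam)}" unfolding lambda_convex_spindle_def by blast
    define c where "c = (1/2) *\<^sub>R (x + y)"
    define p where "p = (1/2) *\<^sub>R (y - x)"
    have "c - p = x" "c + p = y" unfolding c_def p_def
      by (simp_all add: scaleR_add_right scaleR_diff_right flip: scaleR_left_distrib)
    then have S: "S = (+) c ` centred_spindle (1 / lam) p" using tr[of c p] xy(3) by simp
    have np: "norm p = dist x y / 2" by (simp add: p_def dist_norm norm_minus_commute)
    have p0: "norm p > 0" "norm p \<le> 1 / lam" using xy np by auto
    show "\<exists>c w R. norm w = 1 \<and> 0 < R \<and> R \<le> 1 / lam \<and> S = (+) c ` centred_spindle (1 / lam) (R *\<^sub>R w)"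
      using p0 S by (intro exI[of _ c] exI[of _ "p /\<^sub>R norm p"] exI[of _ "norm p"]) auto
  next
    assume "\<exists>c w R. norm w = 1 \<and> 0 < R \<and> R \<le> 1 / lam \<and> S = (+) c ` centred_spindle (1 / lam) (R *\<^sub>R w)"
    then obtain c w R where w: "norm w = 1" "0 < R" "R \<le> 1 / lam" "S = (+) c ` centred_spindle (1 / lam) (R *\<^sub>R w)" by blast
    have "dist (c - R *\<^sub>R w) (c + R *\<^sub>R w) = norm ((2 * R) *\<^sub>R w)"
    proof -
      have "R *\<^sub>R w + R *\<^sub>R w = (2 * R) *\<^sub>R w" by (simp only: mult_2 scaleR_left_distrib)
      moreover have "dist (c - R *\<^sub>R w) (c + R *\<^sub>R w) = norm (- (R *\<^sub>R w + R *\<^sub>R w))"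
        unfolding dist_norm by (rule arg_cong[of _ _ norm]) simp
      ultimately show ?thesis by (simp only: norm_minus_cancel)
    qed
    then have "dist (c - R *\<^sub>R w) (c + R *\<^sub>R w) = 2 * R" using w by simp
    then have "0 < dist (c - R *\<^sub>R w) (c + R *\<^sub>R w)" "dist (c - R *\<^sub>R w) (c + R *\<^sub>R w) \<le> 2 / lam" using w by simp_all
    then have "c - R *\<^sub>R w \<noteq> c + R *\<^sub>R w" "dist (c - R *\<^sub>R w) (c + R *\<^sub>R w) \<le> 2 / lam"
      by (simp_all only: zero_less_dist_iff not_False_eq_True)
    then show "lambda_convex_spindle lam S" unfolding lambda_convex_spindle_def w(4) tr[symmetric] by blast
  qed
qed

text \<open>The vertices are 2 R apart, so no smaller ball contains both, and the ball of radius R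
  around the midpoint contains the spindle.\<close>

lemma circumradius_centred_spindle:
  fixes w :: "real^'n"
  assumes R: "0 < R" "R \<le> L" and w: "norm w = 1"
  shows "circumradius ((+) c ` centred_spindle L (R *\<^sub>R w)) = R"
  unfolding circumradius_def
proof (rule Least_equality)
  have "(+) c ` centred_spindle L (R *\<^sub>R w) \<subseteq> cball c R" using centred_spindle_subset_cball[OF R w] by (auto simp: dist_norm)
  then show "0 \<le> R \<and> (\<exists>b. (+) c ` centred_spindle L (R *\<^sub>R w) \<subseteq> cball b R)" using R by auto
  fix r assume "0 \<le> r \<and> (\<exists>b. (+) c ` centred_spindle L (R *\<^sub>R w) \<subseteq> cball b r)"
  then obtain b where b: "(+) c ` centred_spindle L (R *\<^sub>R w) \<subseteq> cball b r" by blast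
  have "c + R *\<^sub>R w \<in> cball b r" "c + - (R *\<^sub>R w) \<in> cball b r"
    using b centred_spindle_mem[of "R *\<^sub>R w" L] by blast+
  then have "dist (c + R *\<^sub>R w) (c + - (R *\<^sub>R w)) \<le> 2 * r"
    using dist_triangle[of "c + R *\<^sub>R w" "c + - (R *\<^sub>R w)" b] by (simp add: dist_commute)
  moreover have "dist (c + R *\<^sub>R w) (c + - (R *\<^sub>R w)) = norm ((2 * R) *\<^sub>R w)"
  proof -
    have "R *\<^sub>R w + R *\<^sub>R w = (2 * R) *\<^sub>R w" by (simp only: mult_2 scaleR_left_distrib)
    moreover have "dist (c + R *\<^sub>R w) (c + - (R *\<^sub>R w)) = norm (R *\<^sub>R w + R *\<^sub>R w)"
      unfolding dist_norm by (rule arg_cong[of _ _ norm]) simp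
    ultimately show ?thesis by simp
  qed
  ultimately show "R \<le> r" using w R by simp
qed

section \<open>Comparison of mean supports\<close>

text \<open>A multiple of the mean of the support function over directions; the volume of the ball
  has not been divided out.\<close>

definition mean_support :: "(real^'n) set \<Rightarrow> real" where
  "mean_support K = (\<integral>x. indicator (cball 0 1) x * nsupport K x \<partial>lborel)"

lemma nsupport_unit:
  assumes "compact K" "K \<noteq> {}"
  shows "nsupport K x = support_fn K (x /\<^sub>R norm x)"
  using support_fn_scaleR[OF assms, of "inverse (norm x)" x] by (simp add: nsupport_def divide_inverse_commute)

lemma inner_sgn_eq_slope:
  assumes "norm w = 1" "x \<bullet> w > 0"
  shows "(x /\<^sub>R norm x) \<bullet> w = 1 / sqrt (1 + (slope w x)\<^sup>2)"
  using norm_eq_slope[OF assms] assms(2) by (simp add: divide_inverse)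

lemma mean_support_ennreal:
  fixes K :: "(real^'n) set"
  assumes K: "compact K" "K \<noteq> {}" and nn: "\<And>x. 0 \<le> nsupport K x"
  shows "ennreal (mean_support K) = (\<integral>\<^sup>+x. indicator (cball 0 1) x * ennreal (nsupport K x) \<partial>lborel)"
    and "integrable lborel (\<lambda>x. indicator (cball 0 1) x * nsupport K x)"
    and "0 \<le> mean_support K"
proof -
  obtain M where M: "M > 0" "K \<subseteq> cball 0 M"
    using compact_imp_bounded[OF K(1)] by (metis bounded_pos mem_cball_0 subsetI)
  have "\<bar>nsupport K x\<bar> \<le> M" for x using nsupport_bound[OF K M(2)] M(1) by simp
  then show i: "integrable lborel (\<lambda>x. indicator (cball 0 1) x * nsupport K x)"
    by (rule integral_cball_bound_integrable[OF nsupport_measurable[OF K]])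
  have "(\<integral>\<^sup>+x. indicator (cball 0 1) x * ennreal (nsupport K x) \<partial>lborel) = (\<integral>\<^sup>+x. ennreal (indicator (cball 0 1) x * nsupport K x) \<partial>lborel)"
    by (intro nn_integral_cong) (simp add: indicator_def)
  also have "\<dots> = ennreal (mean_support K)"
    unfolding mean_support_def by (rule nn_integral_eq_integral[OF i]) (use nn in simp)
  finally show "ennreal (mean_support K) = (\<integral>\<^sup>+x. indicator (cball 0 1) x * ennreal (nsupport K x) \<partial>lborel)" ..
  show "0 \<le> mean_support K" unfolding mean_support_def
    by (intro integral_nonneg_AE always_eventually allI) (simp add: nn)
qed

lemma nsupport_centred_spindle:
  fixes w :: "real^'n"
  assumes R: "0 < R" "R \<le> L" and w: "norm w = 1" and x: "x \<bullet> w > 0"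
  shows "nsupport (centred_spindle L (R *\<^sub>R w)) x = spindle_profile L R (slope w x)"
proof -
  let ?S = "centred_spindle L (R *\<^sub>R w)"
  have S: "compact ?S" "?S \<noteq> {}"
    using compact_centred_spindle[of "R *\<^sub>R w" L] R w centred_spindle_mem(1)[of "R *\<^sub>R w" L] by (simp, blast)
  have "x \<noteq> 0" using x by auto
  then have u: "norm (x /\<^sub>R norm x) = 1" by simp
  have "(x /\<^sub>R norm x) \<bullet> w \<ge> 0" using x by simp
  from support_centred_spindle[OF R w u this] show ?thesis
    unfolding nsupport_unit[OF S] spindle_profile_def inner_sgn_eq_slope[OF w x] .
qed

lemma nsupport_centred_spindle_nonneg:
  fixes w :: "real^'n"
  assumes R: "0 < R" "R \<le> L" and w: "norm w = 1"
  shows "0 \<le> nsupport (centred_spindle L (R *\<^sub>R w)) x"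
proof -
  let ?p = "R *\<^sub>R w"
  have S: "compact (centred_spindle L ?p)" using compact_centred_spindle[of ?p L] R w by simp
  have "?p \<bullet> x \<le> support_fn (centred_spindle L ?p) x" "(- ?p) \<bullet> x \<le> support_fn (centred_spindle L ?p) x"
    by (intro support_fn_ge[OF S] centred_spindle_mem)+
  then have "0 \<le> support_fn (centred_spindle L ?p) x" by simp
  then show ?thesis by (simp add: nsupport_def)
qed

lemma mean_support_centred_spindle:
  fixes w :: "real^'n"
  assumes n: "CARD('n) = k + 2" and R: "0 < R" "R \<le> L" and w: "norm w = 1"
  shows "mean_support (centred_spindle L (R *\<^sub>R w)) = slope_mean k (spindle_profile L R) * vol (cball (0::real^'n) 1)"
proof -
  interpret slope_profile "spindle_profile L R" R by (rule slope_profile_spindle[OF R])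
  let ?S = "centred_spindle L (R *\<^sub>R w)"
  have S: "compact ?S" "?S \<noteq> {}"
    using compact_centred_spindle[of "R *\<^sub>R w" L] R w centred_spindle_mem(1)[of "R *\<^sub>R w" L] by (simp, blast)
  have "ennreal (mean_support ?S) = (\<integral>\<^sup>+x. indicator (cball 0 1) x * ennreal (nsupport ?S x) \<partial>lborel)"
    by (rule mean_support_ennreal(1)[OF S nsupport_centred_spindle_nonneg[OF R w]])
  also have "\<dots> = ennreal (slope_mean k (spindle_profile L R)) * emeasure lborel (cball (0::real^'n) 1)"
  proof (rule antipodal_mean[OF n w])
    show "ennreal (nsupport ?S x) = ennreal (spindle_profile L R (slope w x))" if "x \<bullet> w > 0" for x
      by (simp only: nsupport_centred_spindle[OF R w that])
    show "ennreal (nsupport ?S x) = ennreal (spindle_profile L R (slope (- w) x))" if "x \<bullet> w < 0" for x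
      using nsupport_centred_spindle[OF R, of "- w" x] w that centred_spindle_uminus[of L "R *\<^sub>R w"] by simp
    show "(\<lambda>x. ennreal (nsupport ?S x)) \<in> borel_measurable borel"
      using nsupport_measurable[OF S] by measurable
  qed
  also have "\<dots> = ennreal (slope_mean k (spindle_profile L R) * vol (cball (0::real^'n) 1))"
    using slope_mean_nonneg emeasure_compact_finite[of "cball (0::real^'n) 1"]
    by (subst emeasure_eq_ennreal_measure) (auto simp: ennreal_mult)
  finally show ?thesis
    using mean_support_ennreal(3)[OF S nsupport_centred_spindle_nonneg[OF R w]] slope_mean_nonneg by simp
qed

text \<open>Every ball touching K along a support direction contains \<plusminus>p and hence the
  spindle. A point outside K is separated from it in some direction u, where the touching ball does
  not extend beyond the support hyperplane.\<close>

lemma centred_spindle_subset_if_normal: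
  fixes K :: "'a::euclidean_space set"
  assumes K: "convex K" "compact K" "K \<noteq> {}"
    and normal: "\<And>u q. norm u = 1 \<Longrightarrow> q \<in> K \<Longrightarrow> (\<And>k. k \<in> K \<Longrightarrow> k \<bullet> u \<le> q \<bullet> u) \<Longrightarrow> K \<subseteq> cball (q - L *\<^sub>R u) L"
    and L: "L > 0" and p: "p \<in> K" "- p \<in> K"
  shows "centred_spindle L p \<subseteq> K"
proof
  fix z assume z: "z \<in> centred_spindle L p"
  show "z \<in> K"
  proof (rule ccontr)
    assume "z \<notin> K"
    then obtain a b where ab: "a \<bullet> z < b" "\<And>x. x \<in> K \<Longrightarrow> a \<bullet> x > b"
      using separating_hyperplane_closed_point[OF K(1) compact_imp_closed[OF K(2)]] by blast
    have "a \<bullet> z < a \<bullet> p" using ab(1) ab(2)[OF p(1)] by linarith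
    then have a0: "a \<noteq> 0" by auto
    define u where "u = - (a /\<^sub>R norm a)"
    have u: "norm u = 1" using a0 by (simp add: u_def)
    obtain q where q: "q \<in> K" "q \<bullet> u = support_fn K u" using support_fn_attained[OF K(2,3)] by blast
    have qz: "q \<bullet> u < z \<bullet> u"
    proof -
      have "a \<bullet> z < a \<bullet> q" using ab(1) ab(2)[OF q(1)] by linarith
      then have "inverse (norm a) * (a \<bullet> z) < inverse (norm a) * (a \<bullet> q)" using a0 by (intro mult_strict_left_mono) auto
      then show ?thesis by (simp add: u_def inner_commute)
    qed
    have "K \<subseteq> cball (q - L *\<^sub>R u) L"
      using support_fn_ge[OF K(2)] q(2) by (intro normal[OF u q(1)]) auto
    then have "p \<in> cball (q - L *\<^sub>R u) L" "- p \<in> cball (q - L *\<^sub>R u) L" using p by blast+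
    then have "norm ((q - L *\<^sub>R u) - p) \<le> L" "norm ((q - L *\<^sub>R u) + p) \<le> L" by (simp_all add: dist_norm)
    then have "norm (z - (q - L *\<^sub>R u)) \<le> L" using z by (simp add: centred_spindle_def)
    then have "norm ((z - q) + L *\<^sub>R u) \<le> L" by (simp add: algebra_simps)
    then have "(norm ((z - q) + L *\<^sub>R u))\<^sup>2 \<le> L\<^sup>2" by (intro power_mono) auto
    then have "(norm (z - q))\<^sup>2 + 2 * L * ((z - q) \<bullet> u) \<le> 0"
      unfolding power2_norm_add using u by (simp add: power_mult_distrib)
    then have "2 * L * ((z - q) \<bullet> u) \<le> 0" using zero_le_power2[of "norm (z - q)"] by linarith
    then have "(z - q) \<bullet> u \<le> 0" using L by (simp add: mult_le_0_iff)
    then show False using qz by (simp add: inner_diff_left)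
  qed
qed

text \<open>Support functions are continuous and positively homogeneous, so a strict inequality in
  one direction persists on a nonempty open part of the unit ball.\<close>

lemma mean_support_strict_mono:
  fixes K S :: "(real^'n) set"
  assumes K: "compact K" "K \<noteq> {}" and S: "compact S" "S \<noteq> {}" and sub: "S \<subseteq> K"
    and nn: "\<And>x. 0 \<le> nsupport S x" "\<And>x. 0 \<le> nsupport K x" and u: "support_fn S u < support_fn K u"
  shows "mean_support S < mean_support K"
proof -
  let ?B = "cball (0::real^'n) 1"
  have le: "support_fn S x \<le> support_fn K x" for x
    using support_fn_ge[OF K(1)] sub by (intro support_fn_le[OF S]) blast
  define f where "f x = indicator ?B x * nsupport K x - indicator ?B x * nsupport S x" for x
  have iK: "integrable lborel (\<lambda>x. indicator ?B x * nsupport K x)" by (rule mean_support_ennreal(2)[OF K nn(2)])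
  have iS: "integrable lborel (\<lambda>x. indicator ?B x * nsupport S x)" by (rule mean_support_ennreal(2)[OF S nn(1)])
  let ?U = "{x. support_fn S x < support_fn K x} \<inter> ball 0 1"
  have s0: "support_fn A (0::real^'n) = 0" if "compact A" "A \<noteq> {}" for A
    using support_fn_scaleR[OF that, of 0 0] by simp
  have "integral\<^sup>L lborel f > 0"
  proof (rule integral_pos_open[where U = ?U])
    show "integrable lborel f" unfolding f_def by (intro Bochner_Integration.integrable_diff iK iS)
    show "0 \<le> f x" for x using le[of x] by (simp add: f_def nsupport_def divide_right_mono indicator_def)
    show "open ?U"
      by (intro open_Int open_Collect_less continuous_on_support_fn K S) auto
    show "?U \<noteq> {}"
    proof -
      have u0: "norm u > 0" using u s0[OF K] s0[OF S] by auto
      define c where "c = 1 / (2 * norm u)"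
      have c: "c > 0" using u0 by (simp add: c_def)
      have "support_fn S (c *\<^sub>R u) < support_fn K (c *\<^sub>R u)"
        using c u support_fn_scaleR[OF K, of c u] support_fn_scaleR[OF S, of c u] by simp
      moreover have "c *\<^sub>R u \<in> ball 0 1" using u0 by (simp add: c_def)
      ultimately show ?thesis by blast
    qed
    show "f x > 0" if "x \<in> ?U" for x
    proof -
      have "norm x > 0" using that s0[OF K] s0[OF S] by auto
      then show ?thesis using that by (simp add: f_def nsupport_def divide_strict_right_mono)
    qed
  qed
  also have "integral\<^sup>L lborel f = mean_support K - mean_support S"
    unfolding f_def mean_support_def by (rule Bochner_Integration.integral_diff[OF iK iS])
  finally show ?thesis by simp
qed

lemma mean_support_centered:
  fixes K :: "(real^'n) set"
  assumes n: "CARD('n) = k + 2" and K: "convex K" "compact K" "K \<noteq> {}" and L: "L > 0"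
    and normal: "\<And>u q. norm u = 1 \<Longrightarrow> q \<in> K \<Longrightarrow> (\<And>k. k \<in> K \<Longrightarrow> k \<bullet> u \<le> q \<bullet> u) \<Longrightarrow> K \<subseteq> cball (q - L *\<^sub>R u) L"
    and R: "0 < R" "R \<le> L" and sub: "K \<subseteq> cball 0 R" and hull: "0 \<in> convex hull (K \<inter> sphere 0 R)"
  defines "\<mu> \<equiv> slope_mean k (spindle_profile L R) * vol (cball (0::real^'n) 1)"
  shows "\<mu> \<le> mean_support K"
    and "mean_support K = \<mu> \<Longrightarrow> \<exists>w. norm w = 1 \<and> K = centred_spindle L (R *\<^sub>R w)"
proof -
  interpret slope_profile "spindle_profile L R" R by (rule slope_profile_spindle[OF R])
  let ?P = "K \<inter> sphere 0 R" and ?B = "cball (0::real^'n) 1"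
  have eB: "ennreal (slope_mean k (spindle_profile L R)) * emeasure lborel ?B = ennreal \<mu>"
    unfolding \<mu>_def using slope_mean_nonneg emeasure_compact_finite[of ?B]
    by (subst emeasure_eq_ennreal_measure) (auto simp: ennreal_mult)
  have \<mu>0: "\<mu> \<ge> 0" unfolding \<mu>_def using slope_mean_nonneg by simp
  have zK: "0 \<in> K" using hull hull_minimal[of ?P K convex] K(1) by auto
  have nn: "0 \<le> nsupport K x" for x
    using support_fn_ge[OF K(2) zK, of x] by (simp add: nsupport_def)
  note ms = mean_support_ennreal[OF K(2,3) nn]
  have ge: "ennreal (spindle_profile L R (slope w x)) \<le> ennreal (nsupport K x)"
    if w: "R *\<^sub>R w \<in> ?P" and x: "x \<bullet> w > 0" for w x
  proof (rule ennreal_leI)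
    have nw: "norm w = 1" using w R by auto
    have "x \<noteq> 0" using x by auto
    then have u: "norm (x /\<^sub>R norm x) = 1" by simp
    have "(x /\<^sub>R norm x) \<bullet> w \<ge> 0" using x by simp
    from support_ge_spindle_support[OF K(2,3) L normal R subset_refl hull w u this]
    show "spindle_profile L R (slope w x) \<le> nsupport K x"
      unfolding nsupport_unit[OF K(2,3)] spindle_profile_def inner_sgn_eq_slope[OF nw x] .
  qed
  have meas: "(\<lambda>x. ennreal (nsupport K x)) \<in> borel_measurable borel"
    using nsupport_measurable[OF K(2,3)] by measurable
  \<comment> \<open>Caratheodory's theorem leaves finitely many contact points with 0 in their hull,
    so that the sums over Voronoi cells are finite.\<close>
  obtain F where F: "finite F" "F \<subseteq> ?P" "0 \<in> convex hull F"
    using hull unfolding caratheodory[of ?P] by blast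
  define W where "W = (*\<^sub>R) (1 / R) ` F"
  have W: "finite W" "0 \<in> convex hull W"
  proof -
    show "finite W" using F(1) by (simp add: W_def)
    have "(*\<^sub>R) (1 / R) 0 \<in> (*\<^sub>R) (1 / R) ` (convex hull F)" using F(3) by (rule imageI)
    then show "0 \<in> convex hull W" unfolding W_def by (simp add: convex_hull_scaling)
  qed
  have WP: "R *\<^sub>R w \<in> ?P" if "w \<in> W" for w using that F(2) R by (auto simp: W_def)
  have W1: "norm w = 1" if "w \<in> W" for w using WP[OF that] R by auto
  have "ennreal \<mu> \<le> ennreal (mean_support K)"
    unfolding eB[symmetric] ms(1)
  proof (rule voronoi_bound(1)[OF n W(1) _ W(2) _ meas])
    show "norm v = 1" if "v \<in> W" for v using that by (rule W1)
    show "ennreal (spindle_profile L R (slope w x)) \<le> ennreal (nsupport K x)" if "w \<in> W" "x \<bullet> w > 0" for w x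
      using WP[OF that(1)] that(2) by (rule ge)
  qed
  then show "\<mu> \<le> mean_support K" using ms(3) by simp
  assume eq: "mean_support K = \<mu>"
  have "\<exists>w. R *\<^sub>R w \<in> ?P \<and> R *\<^sub>R (- w) \<in> ?P"
  proof (rule ccontr)
    assume none: "\<nexists>w. R *\<^sub>R w \<in> ?P \<and> R *\<^sub>R (- w) \<in> ?P"
    have "W \<noteq> {}" using W(2) by auto
    then obtain w1 where w1: "w1 \<in> W" by blast
    have "W \<noteq> {w1}" using W(2) W1[OF w1] by auto
    then obtain w2 where w2: "w2 \<in> W" "w2 \<noteq> w1" using w1 by blast
    have w12: "w2 \<noteq> - w1" using none WP[OF w1] WP[OF w2(1)] by blast
    \<comment> \<open>If R = L, every touching ball has its centre at 0 by
      \<open>contact_center_bound\<close>. Hence K contains L u for all unit vectors u, among them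
      an antipodal pair of contact points.\<close>
    have RL: "R < L"
    proof (rule ccontr)
      assume "\<not> R < L"
      then have RL: "R = L" using R by simp
      have "L *\<^sub>R u \<in> K" if u: "norm u = 1" for u
      proof -
        obtain q where q: "q \<in> K" "q \<bullet> u = support_fn K u" using support_fn_attained[OF K(2,3)] by blast
        have "K \<subseteq> cball (q - L *\<^sub>R u) L"
          using support_fn_ge[OF K(2)] q(2) by (intro normal[OF u q(1)]) auto
        then have "(norm (q - L *\<^sub>R u))\<^sup>2 \<le> L\<^sup>2 - R\<^sup>2"
          by (intro contact_center_bound[OF _ hull _ L R(1)]) auto
        then have "q = L *\<^sub>R u" using RL by simp
        then show ?thesis using q(1) by simp
      qed
      from this[of "w1"] this[of "- w1"] have "R *\<^sub>R w1 \<in> ?P" "R *\<^sub>R (- w1) \<in> ?P"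
        using W1[OF w1] RL R by simp_all
      then show False using none by blast
    qed
    have "ennreal \<mu> < ennreal (mean_support K)"
      unfolding eB[symmetric] ms(1)
    proof (rule voronoi_bound(2)[OF n W(1) _ W(2) _ meas spindle_profile_strict[OF R(1) RL] w1 w2 w12])
      show "norm v = 1" if "v \<in> W" for v using that by (rule W1)
      show "ennreal (spindle_profile L R (slope w x)) \<le> ennreal (nsupport K x)" if "w \<in> W" "x \<bullet> w > 0" for w x
        using WP[OF that(1)] that(2) by (rule ge)
    qed
    then show False using eq by simp
  qed
  then obtain w where w: "R *\<^sub>R w \<in> ?P" "R *\<^sub>R (- w) \<in> ?P" by blast
  have nw: "norm w = 1" using w R by auto
  let ?S = "centred_spindle L (R *\<^sub>R w)"
  have S: "compact ?S" "?S \<noteq> {}"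
    using compact_centred_spindle[of "R *\<^sub>R w" L] R nw centred_spindle_mem(1)[of "R *\<^sub>R w" L] by (simp, blast)
  have SK: "?S \<subseteq> K"
    using w by (intro centred_spindle_subset_if_normal[OF K normal L]) auto
  have "K \<subseteq> ?S"
  proof (rule ccontr)
    assume "\<not> K \<subseteq> ?S"
    then obtain x where "x \<in> K" "x \<notin> ?S" by blast
    then obtain c where "x \<in> K" "norm (c - R *\<^sub>R w) \<le> L" "norm (c + R *\<^sub>R w) \<le> L" "\<not> norm (x - c) \<le> L"
      unfolding centred_spindle_def by blast
    then have x: "x \<in> K" "norm (c - R *\<^sub>R w) \<le> L" "norm (c + R *\<^sub>R w) \<le> L" "norm (x - c) > L"
      by (simp_all only: not_le)
    \<comment> \<open>The direction from the centre of a ball that contains the spindle to a point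
      of K outside that ball: there the support function of K is strictly larger.\<close>
    define u where "u = (x - c) /\<^sub>R norm (x - c)"
    have xc: "norm (x - c) > 0" using x(4) L by linarith
    have u: "norm u = 1" "(x - c) \<bullet> u = norm (x - c)"
      using xc by (simp_all add: u_def power2_norm_eq_inner[symmetric] power2_eq_square)
    have "support_fn ?S u \<le> c \<bullet> u + L"
    proof (rule support_fn_le[OF S])
      fix z assume "z \<in> ?S"
      then have "norm (z - c) \<le> L" using x(2,3) by (simp add: centred_spindle_def)
      moreover have "(z - c) \<bullet> u \<le> norm (z - c) * norm u" by (rule norm_cauchy_schwarz)
      ultimately show "z \<bullet> u \<le> c \<bullet> u + L" using u(1) by (simp add: inner_diff_left)
    qed
    also have "c \<bullet> u + L < x \<bullet> u" using u(2) x(4) by (simp add: inner_diff_left)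
    also have "x \<bullet> u \<le> support_fn K u" by (rule support_fn_ge[OF K(2) x(1)])
    finally have "mean_support ?S < mean_support K"
      by (rule mean_support_strict_mono[OF K(2,3) S SK nsupport_centred_spindle_nonneg[OF R nw] nn])
    then show False using eq mean_support_centred_spindle[OF n R nw] by (simp add: \<mu>_def)
  qed
  then show "\<exists>w. norm w = 1 \<and> K = centred_spindle L (R *\<^sub>R w)" using SK nw by blast
qed

section \<open>From \<lambda>-convex bodies to the first intrinsic volume\<close>

text \<open>\<open>subset_normal_ball\<close> turns the local condition on the boundary into global
  touching balls, and a translation moves the circumcentre to 0. Touching balls also give R \<le> L.
  The bound \<mu> depends on K through its circumradius only.\<close>

lemma lambda_convex_body_mean_support:
  fixes K :: "(real^'n) set"
  assumes n: "CARD('n) = k + 2" and lam: "lam > 0" and K: "lambda_convex_body lam K"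
  defines "R \<equiv> circumradius K" and "L \<equiv> 1 / lam"
  defines "\<mu> \<equiv> slope_mean k (spindle_profile L R) * vol (cball (0::real^'n) 1)"
  obtains c where "convex K" "compact K" "K \<noteq> {}" "\<mu> \<le> mean_support ((+) (- c) ` K)"
    "mean_support ((+) (- c) ` K) = \<mu> \<Longrightarrow> lambda_convex_spindle lam K"
proof -
  have Kc: "convex K" "compact K" "interior K \<noteq> {}" using K by (auto simp: lambda_convex_body_def convex_body_def)
  have K0: "K \<noteq> {}" using Kc(3) interior_subset by blast
  have L: "L > 0" using lam by (simp add: L_def)
  have dim: "DIM(real^'n) \<ge> 2" using n by simp
  obtain c where c: "K \<subseteq> cball c R" "0 \<le> R" "\<And>c' r. 0 \<le> r \<Longrightarrow> K \<subseteq> cball c' r \<Longrightarrow> R \<le> r"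
    using circumradius_attained[OF Kc(2) K0] unfolding R_def by blast
  have normalK: "K \<subseteq> cball (q - L *\<^sub>R u) L" if "norm u = 1" "q \<in> K" "\<And>k. k \<in> K \<Longrightarrow> k \<bullet> u \<le> q \<bullet> u" for u q
  proof (rule subset_normal_ball[OF dim Kc(1) compact_imp_closed[OF Kc(2)] Kc(3) _ L that])
    show "\<exists>U c. open U \<and> p \<in> U \<and> p \<in> sphere c L \<and> U \<inter> K \<subseteq> cball c L" if "p \<in> frontier K" for p
      using K that unfolding lambda_convex_body_def L_def by blast
  qed
  have R0: "R > 0"
  proof (rule ccontr)
    assume "\<not> R > 0"
    then have "K \<subseteq> {c}" using c(1,2) by auto
    then have "interior K \<subseteq> interior {c}" by (rule interior_mono)
    then show False using Kc(3) by simp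
  qed
  define K' where "K' = (+) (- c) ` K"
  have K': "convex K'" "compact K'" "K' \<noteq> {}"
    using Kc K0 unfolding K'_def by (simp_all only: convex_translation compact_translation image_is_empty not_False_eq_True)
  have memK': "x \<in> K' \<longleftrightarrow> c + x \<in> K" for x
    unfolding K'_def by (auto simp: image_iff) (metis add.commute add_diff_cancel_left' uminus_add_conv_diff)
  have normal: "K' \<subseteq> cball (q - L *\<^sub>R u) L" if u: "norm u = 1" and q: "q \<in> K'" "\<And>k. k \<in> K' \<Longrightarrow> k \<bullet> u \<le> q \<bullet> u" for u q
  proof
    fix x assume x: "x \<in> K'"
    have "K \<subseteq> cball ((c + q) - L *\<^sub>R u) L"
    proof (rule normalK[OF u])
      show "c + q \<in> K" using q(1) memK' by blast
      fix k assume "k \<in> K"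
      then have "k - c \<in> K'" using memK' by simp
      then show "k \<bullet> u \<le> (c + q) \<bullet> u" using q(2)[of "k - c"] by (simp add: inner_diff_left inner_add_left)
    qed
    then have "c + x \<in> cball ((c + q) - L *\<^sub>R u) L" using x memK' by blast
    moreover have "dist ((c + q) - L *\<^sub>R u) (c + x) = dist (q - L *\<^sub>R u) x"
      unfolding dist_norm by (rule arg_cong[of _ _ norm]) simp
    ultimately show "x \<in> cball (q - L *\<^sub>R u) L" by simp
  qed
  have RL: "R \<le> L"
  proof -
    obtain u :: "real^'n" where u: "norm u = 1" using vector_choose_size[of 1] by auto
    obtain q where q: "q \<in> K" "q \<bullet> u = support_fn K u" using support_fn_attained[OF Kc(2) K0] by blast
    have "K \<subseteq> cball (q - L *\<^sub>R u) L"
      using support_fn_ge[OF Kc(2)] q(2) by (intro normalK[OF u q(1)]) auto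
    then show ?thesis using L by (intro c(3)) auto
  qed
  have sub: "K' \<subseteq> cball 0 R"
  proof
    fix x assume "x \<in> K'"
    then have "c + x \<in> cball c R" using memK' c(1) by blast
    then show "x \<in> cball 0 R" by (simp add: dist_norm)
  qed
  have hull: "0 \<in> convex hull (K' \<inter> sphere 0 R)"
  proof (rule circumcenter_in_hull[OF K'(2,3) sub])
    fix b r assume br: "0 \<le> r" "K' \<subseteq> cball b r"
    have "K \<subseteq> cball (c + b) r"
    proof
      fix x assume "x \<in> K"
      then have "x - c \<in> cball b r" using br(2) memK'[of "x - c"] by auto
      moreover have "dist (c + b) x = dist b (x - c)" unfolding dist_norm by (rule arg_cong[of _ _ norm]) simp
      ultimately show "x \<in> cball (c + b) r" by simp
    qed
    then show "R \<le> r" using br(1) by (intro c(3))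
  qed
  note mc = mean_support_centered[OF n K' L normal R0 RL sub hull]
  show ?thesis
  proof (rule that[OF Kc(1,2) K0, of c])
    show "\<mu> \<le> mean_support ((+) (- c) ` K)" using mc(1) unfolding \<mu>_def K'_def .
    assume "mean_support ((+) (- c) ` K) = \<mu>"
    then obtain w where w: "norm w = 1" "K' = centred_spindle L (R *\<^sub>R w)" using mc(2) unfolding \<mu>_def K'_def by blast
    have "K = (+) c ` K'" using memK' by (auto simp: image_iff) (metis add_diff_cancel_left' diff_add_cancel add.commute)
    then have "\<exists>c w R. norm w = 1 \<and> 0 < R \<and> R \<le> 1 / lam \<and> K = (+) c ` centred_spindle (1 / lam) (R *\<^sub>R w)"
      using w R0 RL unfolding L_def by blast
    then show "lambda_convex_spindle lam K" unfolding lambda_convex_spindle_iff[OF lam] .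
  qed
qed

lemma intrinsic_volume_1_mean_support:
  fixes K :: "(real^'n) set"
  assumes "convex K" "compact K" "K \<noteq> {}"
  shows "intrinsic_volumes K 1 = CARD('n) / unit_ball_vol (real (CARD('n) - 1)) * mean_support ((+) a ` K)"
proof -
  have "convex ((+) a ` K)" "compact ((+) a ` K)" "(+) a ` K \<noteq> {}"
    using assms by (simp_all only: convex_translation compact_translation image_is_empty not_False_eq_True)
  from intrinsic_volume_1_eq[OF this]
  have "unit_ball_vol (real (CARD('n) - 1)) * intrinsic_volumes K 1 = CARD('n) * mean_support ((+) a ` K)"
    unfolding intrinsic_volumes_translation[OF assms(2)] mean_support_def .
  moreover have "unit_ball_vol (real (CARD('n) - 1)) \<noteq> 0"
    by (rule less_imp_neq[symmetric], rule unit_ball_vol_pos) simp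
  ultimately show ?thesis by (simp add: field_simps)
qed

lemma intrinsic_volume_1_spindle:
  fixes S :: "(real^'n) set"
  assumes n: "CARD('n) = k + 2" and lam: "lam > 0" and S: "lambda_convex_spindle lam S"
  shows "intrinsic_volumes S 1 = CARD('n) / unit_ball_vol (real (CARD('n) - 1)) *
    (slope_mean k (spindle_profile (1 / lam) (circumradius S)) * vol (cball (0::real^'n) 1))"
proof -
  obtain c w R where w: "norm w = 1" "0 < R" "R \<le> 1 / lam" "S = (+) c ` centred_spindle (1 / lam) (R *\<^sub>R w)"
    using S unfolding lambda_convex_spindle_iff[OF lam] by blast
  let ?S = "centred_spindle (1 / lam) (R *\<^sub>R w)"
  have cs: "compact ?S" "convex ?S" "?S \<noteq> {}"
    using compact_centred_spindle[of "R *\<^sub>R w" "1 / lam"] w convex_centred_spindle centred_spindle_mem(1)[of "R *\<^sub>R w" "1 / lam"] by (simp, blast, blast)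
  have "intrinsic_volumes S 1 = intrinsic_volumes ?S 1"
    unfolding w(4) intrinsic_volumes_translation[OF cs(1)] ..
  also have "\<dots> = CARD('n) / unit_ball_vol (real (CARD('n) - 1)) * mean_support ?S"
    using intrinsic_volume_1_mean_support[OF cs(2,1,3), of 0] by simp
  also have "circumradius S = R" unfolding w(4) by (rule circumradius_centred_spindle[OF w(2,3,1)])
  then have "mean_support ?S = slope_mean k (spindle_profile (1 / lam) (circumradius S)) * vol (cball (0::real^'n) 1)"
    using mean_support_centred_spindle[OF n w(2,3,1)] by simp
  finally show ?thesis .
qed

theorem theorem2:
  fixes K S :: "(real ^ 'n::finite) set" and lam :: real
  assumes "CARD('n) \<ge> 2"
    and "lam > 0"
    and "lambda_convex_body lam K"
    and "lambda_convex_spindle lam S"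
    and "circumradius K = circumradius S"
  shows "intrinsic_volume 1 K \<ge> intrinsic_volume 1 S \<and>
    (intrinsic_volume 1 K = intrinsic_volume 1 S \<longleftrightarrow> lambda_convex_spindle lam K)"
proof -
  \<comment> \<open>The exponent of \<open>slope_density\<close> is n - 2, and natural subtraction
    is avoided.\<close>
  obtain k where n: "CARD('n) = k + 2" using assms(1) by (metis add.commute le_add_diff_inverse)
  define \<mu> where "\<mu> = slope_mean k (spindle_profile (1 / lam) (circumradius K)) * vol (cball (0::real^'n) 1)"
  define \<beta> where "\<beta> = CARD('n) / unit_ball_vol (real (CARD('n) - 1))"
  have \<beta>: "\<beta> > 0" by (simp add: \<beta>_def)
  obtain c where c: "convex K" "compact K" "K \<noteq> {}" "\<mu> \<le> mean_support ((+) (- c) ` K)"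
    "mean_support ((+) (- c) ` K) = \<mu> \<Longrightarrow> lambda_convex_spindle lam K"
    using lambda_convex_body_mean_support[OF n assms(2,3)] unfolding \<mu>_def by blast
  have VK: "intrinsic_volume 1 K = \<beta> * mean_support ((+) (- c) ` K)"
    unfolding \<beta>_def by (rule intrinsic_volume_1_mean_support[OF c(1-3)])
  have VS: "intrinsic_volume 1 S = \<beta> * \<mu>"
    unfolding \<beta>_def \<mu>_def assms(5) by (rule intrinsic_volume_1_spindle[OF n assms(2,4)])
  show ?thesis
  proof
    show "intrinsic_volume 1 K \<ge> intrinsic_volume 1 S" unfolding VK VS using c(4) \<beta> by simp
    show "intrinsic_volume 1 K = intrinsic_volume 1 S \<longleftrightarrow> lambda_convex_spindle lam K"
    proof
      assume "intrinsic_volume 1 K = intrinsic_volume 1 S"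
      then show "lambda_convex_spindle lam K" unfolding VK VS using \<beta> by (intro c(5)) simp
    next
      \<comment> \<open>The value for a spindle is a function of its circumradius, and that is
        shared by K and S.\<close>
      assume "lambda_convex_spindle lam K"
      from intrinsic_volume_1_spindle[OF n assms(2) this]
      show "intrinsic_volume 1 K = intrinsic_volume 1 S" unfolding VS \<mu>_def \<beta>_def .
    qed
  qed
qed

end
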